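(* Let $U$ and $V$ be freely independent unitary operators in a tracial von Neumann algebra $(\mathfrak{M},\tau)$ such that $\tau(U)\neq0$ and $\tau(V)\neq0$. Then, as an identity of analytic functions in a neighbourhood of $(0,0)$ (wherever $z\neq\psi_U^{-1}(\psi_{VU}(w))$), $$H_{L(U),R(VU)}(z,w)=1+\frac{z\,\psi_U(z)-\psi_U^{-1}(\psi_{VU}(w))\,\psi_{VU}(w)}{z-\psi_U^{-1}(\psi_{VU}(w))}.$$ Consequently, since $\psi_{VU}$ is determined by the distributions of $U$ and $V$ (through $S_{VU}=S_VS_U$), the functions $\psi_{L(U),R(VU)}$, $\psi_U$, $\psi_{VU}$ and $g_{L(U),R(VU)}$, and thus the joint distribution of $(L(U),R(VU))$ and the transition operator of $VU$ onto $U$, are determined by the distributions of $U$ and $V$. In particular, if $(U_t)_{t\in T}$ is a unitary non-commutative stochastic process in $(\mathfrak{M},\tau)$ with (left) multiplicatively free increments, then for all $\ell<r$ in $T$ the formula $H_{L(U),R(VU)}(z,w)=1+\frac{z\,\psi_U(z)-\psi_U^{-1}(\psi_{VU}(w))\,\psi_{VU}(w)}{z-\psi_U^{-1}(\psi_{VU}(w))}$ and the resulting determination of the joint distribution of $(L(U),R(VU))$ and of the transition operator of $VU$ onto $U$ hold with $U=U_\ell$ and $V=U_rU_\ell^{-1}$ (provided $\tau(U_\ell)\neq0$ and $\tau(U_rU_\ell^{-1})\neq0$), so that $H_{L(U_\ell),R(U_r)}$ is expressed through the individual transforms of $U_\ell$ and $U_r$: $$H_{L(U_\ell),R(U_r)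}(z,w)=1+\frac{z\,\psi_{U_\ell}(z)-\psi_{U_\ell}^{-1}(\psi_{U_r}(w))\,\psi_{U_r}(w)}{z-\psi_{U_\ell}^{-1}(\psi_{U_r}(w))}.$$
   Context: A tracial von Neumann algebra $(\mathfrak{M},\tau)$ is a von Neumann algebra with a faithful normal tracial state. $L_2(\mathfrak{M},\tau)$ is the GNS Hilbert space, $\xi=1_{\mathfrak{M}}$, and $L(S)$, $R(S)$ are left and right multiplication by $S\in\mathfrak{M}$ on $L_2(\mathfrak{M},\tau)$. Operators on $L_2(\mathfrak{M},\tau)$ are considered with respect to the vector state $\langle\,\cdot\,\xi,\xi\rangle$, also denoted $\tau$; for unitaries $A,B\in\mathfrak{M}$, $L(A)$ and $R(B)$ are commuting unitaries with $\tau(L(A)^nR(B)^m)=\tau(A^nB^m)$ for $n,m\in\mathbb{Z}$. For a unitary $A$ with distribution $\mu_A$ on the unit circle $\mathbb{T}$: $\psi_A(z)=\tau(zA(1-zA)^{-1})=\int_{\mathbb{T}}\frac{zs}{1-zs}\,d\mu_A(s)$, $z\in\mathbb{C}\setminus\mathbb{T}$. When $\tau(A)\ne0$, $\psi_A$ is invertible near $0$, with compositional inverse $\psi_A^{-1}$; $\eta_A=\psi_A/(1+\psi_A)$, and the S-transform is $S_A(z)=\frac1z\eta_A^{-1}(z)$. For commuting unitaries $(A,B)$ with joint distribution $\mu_{A,B}$ on $\mathbb{T}^2$: $\psi_{A,B}(z,w)=\int_{\mathbb{T}^2}\frac{zs}{1-zs}\frac{wt}{1-wt}\,d\mu_{A,B}(s,t)$;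 $H_{A,B}(z,w)=\psi_{A,B}(z,w)+\psi_A(z)+\psi_B(w)+1=\int_{\mathbb{T}^2}\frac{1}{(1-zs)(1-wt)}\,d\mu_{A,B}(s,t)$; and $g_{A,B}(z,w)=4\psi_{A,B}(z,w)+2(\psi_A(z)+\psi_B(w))+1=\int_{\mathbb{T}^2}\frac{1+zs}{1-zs}\frac{1+wt}{1-wt}\,d\mu_{A,B}(s,t)$, for $(z,w)\in(\mathbb{C}\setminus\mathbb{T})^2$. The function $\Re\left(\frac{g_{A,B}(z,w)-g_{A,B}(1/\overline z,w)}{2}\right)=\int_{\mathbb{T}^2}\Re\left(\frac{1+zs}{1-zs}\right)\Re\left(\frac{1+wt}{1-wt}\right)d\mu_{A,B}(s,t)$ is the Poisson integral of $d\mu_{A,B}(1/s,1/t)$ and hence recovers $\mu_{A,B}$. Transition operator of $B$ onto $A$ (unitaries in $\mathfrak{M}$ with distributions $\mu_A,\mu_B$): the operator $K:L_\infty(\mu_B)\to L_\infty(\mu_A)$ with $E(h(B))=(K(h))(A)$ for all $h\in L_\infty(\mu_B)$, where $E:\mathfrak{M}\to W^*(A)$ is the trace-preserving conditional expectation; it is determined by the joint distribution of $(L(A),R(B))$. A unitary non-commutative stochastic process is a family $(U_t)_{t\in T}$ of unitaries in $\mathfrak{M}$ indexed by a (totally ordered) time set $T$. It has (left) multiplicatively free increments if for all $t_1<t_2<\cdots<t_n$ in $T$ the operators $U_{t_1},U_{t_2}U_{t_1}^{-1},\ldots,U_{t_n}U_{t_{n-1}}^{-1}$ are freely independent. *)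

theory Defs
  imports "HOL-Complex_Analysis.Complex_Analysis"
begin

(* Complex Hilbert spaces.  The complex inner product is linear in the first argument; the real
   inner product, norm and topology are those of the underlying real Hilbert space. *)
class chilbert_space = real_inner + complete_space +
  fixes scaleC :: "complex \<Rightarrow> 'a \<Rightarrow> 'a"
    and cinner :: "'a \<Rightarrow> 'a \<Rightarrow> complex"
  assumes scaleC_add_right: "scaleC c (x + y) = scaleC c x + scaleC c y"
    and scaleC_add_left: "scaleC (c + d) x = scaleC c x + scaleC d x"
    and scaleC_scaleC: "scaleC c (scaleC d x) = scaleC (c * d) x"
    and scaleC_of_real: "scaleC (complex_of_real r) x = r *\<^sub>R x"
    and cinner_commute: "cinner x y = cnj (cinner y x)"
    and cinner_add_left: "cinner (x + y) z = cinner x z + cinner y z"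
    and cinner_scaleC_left: "cinner (scaleC c x) y = c * cinner x y"
    and Re_cinner: "Re (cinner x y) = inner x y"

instantiation complex :: chilbert_space
begin
definition scaleC_complex :: "complex \<Rightarrow> complex \<Rightarrow> complex"
  where "scaleC_complex c x = c * x"
definition cinner_complex :: "complex \<Rightarrow> complex \<Rightarrow> complex"
  where "cinner_complex x y = x * cnj y"
instance
  by standard
    (auto simp: scaleC_complex_def cinner_complex_def inner_complex_def algebra_simps scaleR_conv_of_real)
end

(* The library type of bounded operators only knows real linearity; bops is B(H). *)
definition bops :: "('h::chilbert_space \<Rightarrow>\<^sub>L 'h) set" where
  "bops = {x. \<forall>c u. blinfun_apply x (scaleC c u) = scaleC c (blinfun_apply x u)}"

definition op_scale :: "complex \<Rightarrow> ('h::chilbert_space \<Rightarrow>\<^sub>L 'h) \<Rightarrow> 'h \<Rightarrow>\<^sub>L 'h" where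
  "op_scale c x = Blinfun (\<lambda>u. scaleC c (x u))"

definition op_inv :: "('h::chilbert_space \<Rightarrow>\<^sub>L 'h) \<Rightarrow> 'h \<Rightarrow>\<^sub>L 'h" where
  "op_inv x = (THE y. x o\<^sub>L y = id_blinfun \<and> y o\<^sub>L x = id_blinfun)"

definition op_powi :: "('h::chilbert_space \<Rightarrow>\<^sub>L 'h) \<Rightarrow> int \<Rightarrow> 'h \<Rightarrow>\<^sub>L 'h" where
  "op_powi x n =
     (if 0 \<le> n then (((o\<^sub>L) x) ^^ nat n) id_blinfun
      else (((o\<^sub>L) (op_inv x)) ^^ nat (- n)) id_blinfun)"

definition is_adjoint :: "('h::chilbert_space \<Rightarrow>\<^sub>L 'h) \<Rightarrow> ('h \<Rightarrow>\<^sub>L 'h) \<Rightarrow> bool" where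
  "is_adjoint x y \<longleftrightarrow> (\<forall>u v. cinner (x u) v = cinner u (y v))"

definition adj :: "('h::chilbert_space \<Rightarrow>\<^sub>L 'h) \<Rightarrow> 'h \<Rightarrow>\<^sub>L 'h" where
  "adj x = (THE y. is_adjoint x y)"

definition positive_op :: "('h::chilbert_space \<Rightarrow>\<^sub>L 'h) \<Rightarrow> bool" where
  "positive_op x \<longleftrightarrow> (\<forall>u. cinner (x u) u \<in> \<real> \<and> 0 \<le> Re (cinner (x u) u))"

definition commutant :: "('h::chilbert_space \<Rightarrow>\<^sub>L 'h) set \<Rightarrow> ('h \<Rightarrow>\<^sub>L 'h) set" where
  "commutant S = {y \<in> bops. \<forall>x\<in>S. x o\<^sub>L y = y o\<^sub>L x}"

definition von_neumann_algebra :: "('h::chilbert_space \<Rightarrow>\<^sub>L 'h) set \<Rightarrow> bool" where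
  "von_neumann_algebra M \<longleftrightarrow>
     M \<subseteq> bops \<and> (\<forall>x\<in>M. \<exists>y\<in>M. is_adjoint x y) \<and> commutant (commutant M) = M"

definition vn_generated :: "('h::chilbert_space \<Rightarrow>\<^sub>L 'h) \<Rightarrow> ('h \<Rightarrow>\<^sub>L 'h) set" where
  "vn_generated a = \<Inter>{N. von_neumann_algebra N \<and> a \<in> N}"

definition unitary_in :: "('h::chilbert_space \<Rightarrow>\<^sub>L 'h) set \<Rightarrow> ('h \<Rightarrow>\<^sub>L 'h) \<Rightarrow> bool" where
  "unitary_in M x \<longleftrightarrow> x \<in> M \<and> adj x o\<^sub>L x = id_blinfun \<and> x o\<^sub>L adj x = id_blinfun"

(* The ultraweak (sigma-weak) topology; normality of a functional is ultraweak continuity. *)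
definition ultraweak_functionals :: "(('h::chilbert_space \<Rightarrow>\<^sub>L 'h) \<Rightarrow> complex) set" where
  "ultraweak_functionals =
     {\<lambda>x. \<Sum>n. cinner (blinfun_apply x (p n)) (q n) | p q :: nat \<Rightarrow> 'h.
        summable (\<lambda>n. (norm (p n))\<^sup>2) \<and> summable (\<lambda>n. (norm (q n))\<^sup>2)}"

definition ultraweak_topology :: "('h::chilbert_space \<Rightarrow>\<^sub>L 'h) topology" where
  "ultraweak_topology = topology_generated_by {f -` W | f W. f \<in> ultraweak_functionals \<and> open W}"

locale tracial_vna =
  fixes M :: "('h::chilbert_space \<Rightarrow>\<^sub>L 'h) set"
    and \<tau> :: "('h \<Rightarrow>\<^sub>L 'h) \<Rightarrow> complex"
  assumes vna: "von_neumann_algebra M"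
    and tr_add: "\<lbrakk>x \<in> M; y \<in> M\<rbrakk> \<Longrightarrow> \<tau> (x + y) = \<tau> x + \<tau> y"
    and tr_scale: "x \<in> M \<Longrightarrow> \<tau> (op_scale c x) = c * \<tau> x"
    and tr_one: "\<tau> id_blinfun = 1"
    and tr_positive: "x \<in> M \<Longrightarrow> \<tau> (adj x o\<^sub>L x) \<in> \<real> \<and> 0 \<le> Re (\<tau> (adj x o\<^sub>L x))"
    and tr_faithful: "\<lbrakk>x \<in> M; \<tau> (adj x o\<^sub>L x) = 0\<rbrakk> \<Longrightarrow> x = 0"
    and tr_trace: "\<lbrakk>x \<in> M; y \<in> M\<rbrakk> \<Longrightarrow> \<tau> (x o\<^sub>L y) = \<tau> (y o\<^sub>L x)"
    and tr_normal: "continuous_map (subtopology ultraweak_topology M) euclidean \<tau>"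

(* The type 'g together with Lam is a model of the Hilbert space completion of M for the
   inner product tau (y* x), with Lam the canonical embedding of M.  These properties determine
   the GNS space up to a unique unitary intertwining the embeddings. *)
locale gns_space = tracial_vna M \<tau>
  for M :: "('h::chilbert_space \<Rightarrow>\<^sub>L 'h) set" and \<tau> :: "('h \<Rightarrow>\<^sub>L 'h) \<Rightarrow> complex" +
  fixes Lam :: "('h \<Rightarrow>\<^sub>L 'h) \<Rightarrow> 'g::chilbert_space"
  assumes Lam_add: "\<lbrakk>x \<in> M; y \<in> M\<rbrakk> \<Longrightarrow> Lam (x + y) = Lam x + Lam y"
    and Lam_scale: "x \<in> M \<Longrightarrow> Lam (op_scale c x) = scaleC c (Lam x)"
    and Lam_cinner: "\<lbrakk>x \<in> M; y \<in> M\<rbrakk> \<Longrightarrow> cinner (Lam x) (Lam y) = \<tau> (adj y o\<^sub>L x)"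
    and Lam_dense: "closure (Lam ` M) = UNIV"

(* The bounded operators L(S) and R(S) on the GNS space: they are determined by their values on
   the dense subspace Lam ` M. *)
definition left_mult ::
  "('h::chilbert_space \<Rightarrow>\<^sub>L 'h) set \<Rightarrow> (('h \<Rightarrow>\<^sub>L 'h) \<Rightarrow> 'g::chilbert_space) \<Rightarrow> ('h \<Rightarrow>\<^sub>L 'h) \<Rightarrow> 'g \<Rightarrow>\<^sub>L 'g" where
  "left_mult M Lam S = (THE X. X \<in> bops \<and> (\<forall>x\<in>M. blinfun_apply X (Lam x) = Lam (S o\<^sub>L x)))"

definition right_mult ::
  "('h::chilbert_space \<Rightarrow>\<^sub>L 'h) set \<Rightarrow> (('h \<Rightarrow>\<^sub>L 'h) \<Rightarrow> 'g::chilbert_space) \<Rightarrow> ('h \<Rightarrow>\<^sub>L 'h) \<Rightarrow> 'g \<Rightarrow>\<^sub>L 'g" where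
  "right_mult M Lam S = (THE X. X \<in> bops \<and> (\<forall>x\<in>M. blinfun_apply X (Lam x) = Lam (x o\<^sub>L S)))"

definition vec_state ::
  "(('h::chilbert_space \<Rightarrow>\<^sub>L 'h) \<Rightarrow> 'g::chilbert_space) \<Rightarrow> ('g \<Rightarrow>\<^sub>L 'g) \<Rightarrow> complex" where
  "vec_state Lam X = cinner (X (Lam id_blinfun)) (Lam id_blinfun)"

(* The unique finite Borel measures on the circle, respectively the torus, with prescribed
   trigonometric moments. *)
definition circle_measure :: "(int \<Rightarrow> complex) \<Rightarrow> complex measure" where
  "circle_measure c = (THE \<mu>. sets \<mu> = sets (restrict_space borel (sphere 0 1)) \<and>
     finite_measure \<mu> \<and> (\<forall>n. (\<integral>s. s powi n \<partial>\<mu>) = c n))"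

definition torus_measure :: "(int \<Rightarrow> int \<Rightarrow> complex) \<Rightarrow> (complex \<times> complex) measure" where
  "torus_measure c = (THE \<mu>. sets \<mu> = sets (restrict_space borel (sphere 0 1 \<times> sphere 0 1)) \<and>
     finite_measure \<mu> \<and> (\<forall>n m. (\<integral>p. fst p powi n * snd p powi m \<partial>\<mu>) = c n m))"

(* In what follows, phi is the state with respect to which operators are considered:
   the trace tau for elements of M, vec_state Lam for operators on the GNS space. *)
definition distribution ::
  "(('h::chilbert_space \<Rightarrow>\<^sub>L 'h) \<Rightarrow> complex) \<Rightarrow> ('h \<Rightarrow>\<^sub>L 'h) \<Rightarrow> complex measure" where
  "distribution \<phi> A = circle_measure (\<lambda>n. \<phi> (op_powi A n))"

definition joint_distribution ::
  "(('h::chilbert_space \<Rightarrow>\<^sub>L 'h) \<Rightarrow> complex) \<Rightarrow> ('h \<Rightarrow>\<^sub>L 'h) \<Rightarrow> ('h \<Rightarrow>\<^sub>L 'h) \<Rightarrow> (complex \<times> complex) measure" where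
  "joint_distribution \<phi> A B = torus_measure (\<lambda>n m. \<phi> (op_powi A n o\<^sub>L op_powi B m))"

definition psi :: "(('h::chilbert_space \<Rightarrow>\<^sub>L 'h) \<Rightarrow> complex) \<Rightarrow> ('h \<Rightarrow>\<^sub>L 'h) \<Rightarrow> complex \<Rightarrow> complex" where
  "psi \<phi> A z = \<phi> (op_scale z A o\<^sub>L op_inv (id_blinfun - op_scale z A))"

definition psi2 ::
  "(('h::chilbert_space \<Rightarrow>\<^sub>L 'h) \<Rightarrow> complex) \<Rightarrow> ('h \<Rightarrow>\<^sub>L 'h) \<Rightarrow> ('h \<Rightarrow>\<^sub>L 'h) \<Rightarrow> complex \<Rightarrow> complex \<Rightarrow> complex" where
  "psi2 \<phi> A B z w =
     (\<integral>p. (z * fst p / (1 - z * fst p)) * (w * snd p / (1 - w * snd p)) \<partial>joint_distribution \<phi> A B)"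

definition H_fun ::
  "(('h::chilbert_space \<Rightarrow>\<^sub>L 'h) \<Rightarrow> complex) \<Rightarrow> ('h \<Rightarrow>\<^sub>L 'h) \<Rightarrow> ('h \<Rightarrow>\<^sub>L 'h) \<Rightarrow> complex \<Rightarrow> complex \<Rightarrow> complex" where
  "H_fun \<phi> A B z w = psi2 \<phi> A B z w + psi \<phi> A z + psi \<phi> B w + 1"

definition g_fun ::
  "(('h::chilbert_space \<Rightarrow>\<^sub>L 'h) \<Rightarrow> complex) \<Rightarrow> ('h \<Rightarrow>\<^sub>L 'h) \<Rightarrow> ('h \<Rightarrow>\<^sub>L 'h) \<Rightarrow> complex \<Rightarrow> complex \<Rightarrow> complex" where
  "g_fun \<phi> A B z w = 4 * psi2 \<phi> A B z w + 2 * (psi \<phi> A z + psi \<phi> B w) + 1"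

(* The compositional inverse near 0 is only determined as a germ at 0; local_inverse chooses some
   representative. *)
definition is_local_inverse :: "(complex \<Rightarrow> complex) \<Rightarrow> (complex \<Rightarrow> complex) \<Rightarrow> bool" where
  "is_local_inverse f h \<longleftrightarrow> h analytic_on {0} \<and> h 0 = 0 \<and>
     (\<forall>\<^sub>F w in nhds 0. f (h w) = w) \<and> (\<forall>\<^sub>F z in nhds 0. h (f z) = z)"

definition local_inverse :: "(complex \<Rightarrow> complex) \<Rightarrow> complex \<Rightarrow> complex" where
  "local_inverse f = (SOME h. is_local_inverse f h)"

definition psi_inv :: "(('h::chilbert_space \<Rightarrow>\<^sub>L 'h) \<Rightarrow> complex) \<Rightarrow> ('h \<Rightarrow>\<^sub>L 'h) \<Rightarrow> complex \<Rightarrow> complex" where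
  "psi_inv \<phi> A = local_inverse (psi \<phi> A)"

definition eta :: "(('h::chilbert_space \<Rightarrow>\<^sub>L 'h) \<Rightarrow> complex) \<Rightarrow> ('h \<Rightarrow>\<^sub>L 'h) \<Rightarrow> complex \<Rightarrow> complex" where
  "eta \<phi> A z = psi \<phi> A z / (1 + psi \<phi> A z)"

definition S_transform ::
  "(('h::chilbert_space \<Rightarrow>\<^sub>L 'h) \<Rightarrow> complex) \<Rightarrow> ('h \<Rightarrow>\<^sub>L 'h) \<Rightarrow> complex \<Rightarrow> complex" where
  "S_transform \<phi> A z = local_inverse (eta \<phi> A) z / z"

(* Freeness of operators is freeness of the unital *-algebras they generate. *)
inductive_set star_alg :: "('h::chilbert_space \<Rightarrow>\<^sub>L 'h) \<Rightarrow> ('h \<Rightarrow>\<^sub>L 'h) set" for a where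
  one: "id_blinfun \<in> star_alg a"
| gen: "a \<in> star_alg a"
| gen_adj: "adj a \<in> star_alg a"
| add: "\<lbrakk>x \<in> star_alg a; y \<in> star_alg a\<rbrakk> \<Longrightarrow> x + y \<in> star_alg a"
| scale: "x \<in> star_alg a \<Longrightarrow> op_scale c x \<in> star_alg a"
| mult: "\<lbrakk>x \<in> star_alg a; y \<in> star_alg a\<rbrakk> \<Longrightarrow> x o\<^sub>L y \<in> star_alg a"

(* A word is a list of pairs (i, x) in which x belongs to the algebra generated by as ! i. *)
definition freely_independent ::
  "(('h::chilbert_space \<Rightarrow>\<^sub>L 'h) \<Rightarrow> complex) \<Rightarrow> ('h \<Rightarrow>\<^sub>L 'h) list \<Rightarrow> bool" where
  "freely_independent \<tau> as \<longleftrightarrow>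
     (\<forall>ws :: (nat \<times> ('h \<Rightarrow>\<^sub>L 'h)) list.
        ws \<noteq> [] \<longrightarrow>
        (\<forall>(i, x) \<in> set ws. i < length as \<and> x \<in> star_alg (as ! i) \<and> \<tau> x = 0) \<longrightarrow>
        (\<forall>j. Suc j < length ws \<longrightarrow> fst (ws ! j) \<noteq> fst (ws ! Suc j)) \<longrightarrow>
        \<tau> (foldr (o\<^sub>L) (map snd ws) id_blinfun) = 0)"

definition increments ::
  "('t \<Rightarrow> ('h::chilbert_space \<Rightarrow>\<^sub>L 'h)) \<Rightarrow> 't list \<Rightarrow> ('h \<Rightarrow>\<^sub>L 'h) list" where
  "increments X ts =
     map (\<lambda>i. if i = 0 then X (ts ! 0) else X (ts ! i) o\<^sub>L op_inv (X (ts ! (i - 1)))) [0..<length ts]"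

definition unitary_process ::
  "('h::chilbert_space \<Rightarrow>\<^sub>L 'h) set \<Rightarrow> 't set \<Rightarrow> ('t \<Rightarrow> ('h \<Rightarrow>\<^sub>L 'h)) \<Rightarrow> bool" where
  "unitary_process M T X \<longleftrightarrow> (\<forall>t\<in>T. unitary_in M (X t))"

definition left_mult_free_increments ::
  "(('h::chilbert_space \<Rightarrow>\<^sub>L 'h) \<Rightarrow> complex) \<Rightarrow> 't::linorder set \<Rightarrow> ('t \<Rightarrow> ('h \<Rightarrow>\<^sub>L 'h)) \<Rightarrow> bool" where
  "left_mult_free_increments \<tau> T X \<longleftrightarrow>
     (\<forall>ts. set ts \<subseteq> T \<longrightarrow> sorted_wrt (<) ts \<longrightarrow> freely_independent \<tau> (increments X ts))"

(* Bounded Borel functions on the circle, representing the elements of L_infinity. *)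
definition Linf :: "(complex \<Rightarrow> complex) set" where
  "Linf = {h. h \<in> borel_measurable (restrict_space borel (sphere 0 1)) \<and> bounded (h ` sphere 0 1)}"

(* x = h(A) for a unitary A: the circle_measure below is the spectral measure of A at u. *)
definition is_borel_calculus ::
  "('h::chilbert_space \<Rightarrow>\<^sub>L 'h) \<Rightarrow> (complex \<Rightarrow> complex) \<Rightarrow> ('h \<Rightarrow>\<^sub>L 'h) \<Rightarrow> bool" where
  "is_borel_calculus A h x \<longleftrightarrow> x \<in> bops \<and>
     (\<forall>u. cinner (x u) u = (\<integral>s. h s \<partial>circle_measure (\<lambda>n. cinner (op_powi A n u) u)))"

(* E is the trace-preserving conditional expectation of M onto N. *)
definition is_cond_exp ::
  "('h::chilbert_space \<Rightarrow>\<^sub>L 'h) set \<Rightarrow> (('h \<Rightarrow>\<^sub>L 'h) \<Rightarrow> complex) \<Rightarrow> ('h \<Rightarrow>\<^sub>L 'h) set \<Rightarrow>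
     (('h \<Rightarrow>\<^sub>L 'h) \<Rightarrow> ('h \<Rightarrow>\<^sub>L 'h)) \<Rightarrow> bool" where
  "is_cond_exp M \<tau> N E \<longleftrightarrow>
     (\<forall>x\<in>M. E x \<in> N) \<and>
     (\<forall>x\<in>M. \<forall>y\<in>M. E (x + y) = E x + E y) \<and>
     (\<forall>x\<in>M. \<forall>c. E (op_scale c x) = op_scale c (E x)) \<and>
     E id_blinfun = id_blinfun \<and>
     (\<forall>x\<in>M. positive_op (E (adj x o\<^sub>L x))) \<and>
     (\<forall>x\<in>M. \<forall>a\<in>N. \<forall>b\<in>N. E (a o\<^sub>L x o\<^sub>L b) = a o\<^sub>L E x o\<^sub>L b) \<and>
     (\<forall>x\<in>M. \<tau> (E x) = \<tau> x)"

(* K is a transition operator of B onto A, acting on bounded Borel representatives; as an operator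
   from L_infinity of the distribution of B to L_infinity of the distribution of A it is unique. *)
definition is_transition_operator ::
  "('h::chilbert_space \<Rightarrow>\<^sub>L 'h) set \<Rightarrow> (('h \<Rightarrow>\<^sub>L 'h) \<Rightarrow> complex) \<Rightarrow> ('h \<Rightarrow>\<^sub>L 'h) \<Rightarrow> ('h \<Rightarrow>\<^sub>L 'h) \<Rightarrow>
     ((complex \<Rightarrow> complex) \<Rightarrow> (complex \<Rightarrow> complex)) \<Rightarrow> bool" where
  "is_transition_operator M \<tau> B A K \<longleftrightarrow>
     (\<exists>E. is_cond_exp M \<tau> (vn_generated A) E \<and>
        (\<forall>h\<in>Linf. K h \<in> Linf \<and>
           (\<exists>x\<in>M. is_borel_calculus B h x \<and> is_borel_calculus A (K h) (E x))))"

(* Equality of everything that is claimed to be determined, for the pairs (L(A), R(B)) and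
   (L(A'), R(B')) in two systems; transition operators of B onto A are compared modulo null sets
   of the distribution of A. *)
definition same_transforms_and_transitions ::
  "('h::chilbert_space \<Rightarrow>\<^sub>L 'h) set \<Rightarrow> (('h \<Rightarrow>\<^sub>L 'h) \<Rightarrow> complex) \<Rightarrow> (('h \<Rightarrow>\<^sub>L 'h) \<Rightarrow> 'g::chilbert_space) \<Rightarrow>
     ('h \<Rightarrow>\<^sub>L 'h) \<Rightarrow> ('h \<Rightarrow>\<^sub>L 'h) \<Rightarrow>
   ('k::chilbert_space \<Rightarrow>\<^sub>L 'k) set \<Rightarrow> (('k \<Rightarrow>\<^sub>L 'k) \<Rightarrow> complex) \<Rightarrow> (('k \<Rightarrow>\<^sub>L 'k) \<Rightarrow> 'f::chilbert_space) \<Rightarrow>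
     ('k \<Rightarrow>\<^sub>L 'k) \<Rightarrow> ('k \<Rightarrow>\<^sub>L 'k) \<Rightarrow> bool" where
  "same_transforms_and_transitions M \<tau> Lam A B M' \<tau>' Lam' A' B' \<longleftrightarrow>
     (\<forall>z w. norm z \<noteq> 1 \<longrightarrow> norm w \<noteq> 1 \<longrightarrow>
        psi \<tau> A z = psi \<tau>' A' z \<and>
        psi \<tau> B w = psi \<tau>' B' w \<and>
        psi2 (vec_state Lam) (left_mult M Lam A) (right_mult M Lam B) z w =
          psi2 (vec_state Lam') (left_mult M' Lam' A') (right_mult M' Lam' B') z w \<and>
        g_fun (vec_state Lam) (left_mult M Lam A) (right_mult M Lam B) z w =
          g_fun (vec_state Lam') (left_mult M' Lam' A') (right_mult M' Lam' B') z w) \<and>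
     joint_distribution (vec_state Lam) (left_mult M Lam A) (right_mult M Lam B) =
       joint_distribution (vec_state Lam') (left_mult M' Lam' A') (right_mult M' Lam' B') \<and>
     (\<forall>K K'. is_transition_operator M \<tau> B A K \<longrightarrow> is_transition_operator M' \<tau>' B' A' K' \<longrightarrow>
        (\<forall>h\<in>Linf. AE s in distribution \<tau> A. K h s = K' h s))"

end

theory Submission
  imports Defs "HOL-Probability.Helly_Selection"
begin

text \<open>
The transform \<open>H(z, w)\<close> of the pair \<open>(L(U), R(VU))\<close> is, for small arguments, the trace
\<open>\<tau>((1 - zU)\<^sup>-\<^sup>1 (1 - wVU)\<^sup>-\<^sup>1)\<close> (lemma \<open>H_fun_resolvents\<close>), and the formula for it is an instance of
subordination: tested against the algebra generated by \<open>U\<close>, the resolvent of \<open>VU\<close> at \<open>w\<close> acts like the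
resolvent of \<open>U\<close> at \<open>\<alpha> = \<psi>\<^sub>U\<^sup>-\<^sup>1(\<psi>\<^sub>V\<^sub>U(w))\<close>. The trace of the product of two resolvents of \<open>U\<close> is then
a divided difference by the resolvent identity.

Subordination (lemma \<open>subordination\<close>) rests on an explicit factorization. For small \<open>s\<close> let
\<open>\<alpha> = \<psi>\<^sub>U\<^sup>-\<^sup>1(s)\<close> and \<open>\<beta> = \<psi>\<^sub>V\<^sup>-\<^sup>1(s)\<close>, so that the resolvents \<open>P\<close> of \<open>U\<close> at \<open>\<alpha>\<close> and \<open>Q\<close> of \<open>V\<close> at \<open>\<beta>\<close> have
the same trace \<open>1 + s\<close>; write \<open>P = (1 + s) + p\<close> and \<open>Q = (1 + s) + q\<close> with centred \<open>p\<close>, \<open>q\<close>. For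
\<open>w = \<alpha>\<beta>(1 + s)/s\<close> a computation gives
\<open>(1 - wVU)\<^sup>-\<^sup>1 = (1 + s)\<^sup>-\<^sup>1 P (1 - qp/(s(1 + s)))\<^sup>-\<^sup>1 Q\<close>. In the Neumann series of the middle factor
all terms but the first are alternating products of centred elements, which freeness annihilates.
Testing against \<open>1\<close> shows \<open>\<psi>\<^sub>V\<^sub>U(w) = s\<close>, that is
\<open>\<psi>\<^sub>V\<^sub>U\<^sup>-\<^sup>1(s) = \<psi>\<^sub>U\<^sup>-\<^sup>1(s) \<psi>\<^sub>V\<^sup>-\<^sup>1(s) (1 + s)/s\<close>, which is the multiplicativity of the S-transform;
testing against \<open>(1 - zU)\<^sup>-\<^sup>1\<close> gives the formula for \<open>H\<close>.

The determination statements use that freeness fixes all mixed moments of \<open>U\<close>, \<open>V\<close> and their inverses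
once the distributions are given (theorem \<open>mixed_moments_agree\<close>): letters of a word are centred one at
a time, and what is not annihilated is a shorter word. The joint distribution, \<open>\<psi>\<close> and \<open>g\<close> are functions
of these moments. A transition operator \<open>K\<close> is recognized from the moments
\<open>\<integral> s\<^sup>n (Kh)(s) d\<mu>\<^sub>U = \<tau>(U\<^sup>n h(VU))\<close>, whose right-hand side is an integral with respect to the joint
distribution because \<open>\<tau>\<close> is ultraweakly continuous (lemma \<open>trace_borel_calculus\<close>).

Behind all this stands the existence and uniqueness of the measures with given trigonometric
moments. Uniqueness follows from the Stone-Weierstrass theorem. For existence on the torus (theorem
\<open>stationary_measure_exists\<close>), Fejer-type discrete measures are lifted to the unit interval along a
space-filling curve, where Helly's selection theorem provides a weak limit, and the limit is pushed
forward to the torus.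
\<close>

section \<open>Complex Hilbert spaces and bounded operators\<close>

instance chilbert_space \<subseteq> banach ..

lemma cinner_add_right: "cinner x (y + z) = cinner x y + cinner (x::'a::chilbert_space) z"
  by (metis cinner_add_left cinner_commute complex_cnj_add)

lemma cinner_scaleC_right: "cinner x (scaleC c y) = cnj c * cinner (x::'a::chilbert_space) y"
  by (metis cinner_scaleC_left cinner_commute complex_cnj_mult)

lemma scaleC_minus1: "scaleC (-1) x = - (x::'a::chilbert_space)"
  using scaleC_of_real[of "-1" x] by simp

lemma scaleC_one [simp]: "scaleC 1 x = (x::'a::chilbert_space)"
  using scaleC_of_real[of 1 x] by simp

lemma scaleC_zero_left [simp]: "scaleC 0 x = (0::'a::chilbert_space)"
  using scaleC_of_real[of 0 x] by simp

lemma scaleC_zero_right [simp]: "scaleC c 0 = (0::'a::chilbert_space)"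
  using scaleC_add_right[of c 0 0] by simp

lemma cinner_minus_left: "cinner (- x) y = - cinner (x::'a::chilbert_space) y"
  using cinner_scaleC_left[of "-1" x y] by (simp add: scaleC_minus1)

lemma cinner_minus_right: "cinner x (- y) = - cinner (x::'a::chilbert_space) y"
  using cinner_scaleC_right[of x "-1" y] by (simp add: scaleC_minus1)

lemma cinner_diff_left: "cinner (x - y) z = cinner x z - cinner (y::'a::chilbert_space) z"
  using cinner_add_left[of x "-y" z] by (simp add: cinner_minus_left)

lemma cinner_diff_right: "cinner x (y - z) = cinner x y - cinner (x::'a::chilbert_space) z"
  using cinner_add_right[of x y "-z"] by (simp add: cinner_minus_right)

lemma cinner_zero_left [simp]: "cinner 0 x = (0::complex)" for x :: "'a::chilbert_space"
  using cinner_diff_left[of 0 0 x] by simp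

lemma cinner_zero_right [simp]: "cinner x 0 = (0::complex)" for x :: "'a::chilbert_space"
  using cinner_diff_right[of x 0 0] by simp

lemmas cinner_simps = cinner_add_left cinner_add_right cinner_diff_left cinner_diff_right
  cinner_minus_left cinner_minus_right cinner_scaleC_left cinner_scaleC_right

lemma cinner_sum_left: "cinner (sum f A) y = (\<Sum>i\<in>A. cinner (f i) (y::'a::chilbert_space))"
  by (induction A rule: infinite_finite_induct) (auto simp: cinner_simps)

lemma cinner_sum_right: "cinner y (sum f A) = (\<Sum>i\<in>A. cinner (y::'a::chilbert_space) (f i))"
  by (induction A rule: infinite_finite_induct) (auto simp: cinner_simps)

lemma cinner_self: "cinner x x = complex_of_real ((norm (x::'a::chilbert_space))\<^sup>2)"
proof (rule complex_eqI)
  show "Re (cinner x x) = Re (complex_of_real ((norm x)\<^sup>2))"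
    by (simp add: Re_cinner power2_norm_eq_inner)
  show "Im (cinner x x) = Im (complex_of_real ((norm x)\<^sup>2))"
    using arg_cong[OF cinner_commute[of x x], of Im] by simp
qed

text \<open>The norm comes from the real inner product; that complex scalars act on it by their modulus is
  derived from \<open>\<langle>cx, cx\<rangle> = |c|\<^sup>2 \<langle>x, x\<rangle>\<close>.\<close>

lemma norm_scaleC: "norm (scaleC c x) = norm c * norm (x::'a::chilbert_space)"
proof -
  have "complex_of_real ((norm (scaleC c x))\<^sup>2) = (c * cnj c) * complex_of_real ((norm x)\<^sup>2)"
    unfolding cinner_self[symmetric] by (simp add: cinner_simps)
  also have "c * cnj c = complex_of_real ((norm c)\<^sup>2)"
    using complex_norm_square[of c] by simp
  also have "complex_of_real ((norm c)\<^sup>2) * complex_of_real ((norm x)\<^sup>2) = complex_of_real ((norm c * norm x)\<^sup>2)"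
    by (simp add: power_mult_distrib)
  finally have "(norm (scaleC c x))\<^sup>2 = (norm c * norm x)\<^sup>2"
    using of_real_eq_iff by blast
  then show ?thesis
    by (simp add: power2_eq_iff_nonneg)
qed

text \<open>A unimodular factor rotates \<open>\<langle>x, y\<rangle>\<close> onto the positive real axis, where it agrees with the real
  inner product; the real Cauchy-Schwarz inequality then applies.\<close>

lemma norm_cinner_le: "norm (cinner x y) \<le> norm x * norm (y::'a::chilbert_space)"
proof (cases "cinner x y = 0")
  case False
  define c where "c = cnj (cinner x y) / norm (cinner x y)"
  have nc: "norm c = 1" using False by (simp add: c_def norm_divide)
  have "cinner (scaleC c x) y = complex_of_real (norm (cinner x y))"
    using False by (simp add: c_def cinner_simps field_simps complex_norm_square[symmetric] power2_eq_square)
  then have "norm (cinner x y) = inner (scaleC c x) y"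
    by (metis Re_cinner Re_complex_of_real)
  also have "\<dots> \<le> norm (scaleC c x) * norm y" by (rule norm_cauchy_schwarz)
  finally show ?thesis by (simp add: norm_scaleC nc)
qed auto

lemma cinner_scaleR_left: "cinner (r *\<^sub>R x) y = r *\<^sub>R cinner (x::'a::chilbert_space) y"
  using cinner_scaleC_left[of "complex_of_real r" x y] by (simp add: scaleC_of_real scaleR_conv_of_real)

lemma cinner_scaleR_right: "cinner x (r *\<^sub>R y) = r *\<^sub>R cinner (x::'a::chilbert_space) y"
  using cinner_scaleC_right[of x "complex_of_real r" y] by (simp add: scaleC_of_real scaleR_conv_of_real)

lemma bounded_bilinear_cinner: "bounded_bilinear (cinner :: 'a::chilbert_space \<Rightarrow> 'a \<Rightarrow> complex)"
proof
  show "\<exists>K. \<forall>a b::'a. norm (cinner a b) \<le> norm a * norm b * K"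
    by (intro exI[of _ 1]) (auto intro: norm_cinner_le)
qed (auto simp: cinner_simps cinner_scaleR_left cinner_scaleR_right)

lemmas tendsto_cinner = bounded_bilinear.tendsto[OF bounded_bilinear_cinner]

lemma cinner_eqI:
  assumes "\<And>v. cinner x v = cinner (y::'a::chilbert_space) v" shows "x = y"
proof -
  have "cinner (x - y) (x - y) = 0" using assms[of "x - y"] by (simp add: cinner_diff_left)
  then show ?thesis by (simp add: cinner_self)
qed

lemma bounded_linear_scaleC: "bounded_linear (scaleC c :: 'a::chilbert_space \<Rightarrow> 'a)"
proof
  fix r :: real and x :: 'a
  show "scaleC c (r *\<^sub>R x) = r *\<^sub>R scaleC c x"
    unfolding scaleC_of_real[symmetric] scaleC_scaleC by (simp add: mult.commute)
  show "\<exists>K. \<forall>x::'a. norm (scaleC c x) \<le> norm x * K"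
    by (intro exI[of _ "norm c"]) (auto simp: norm_scaleC mult.commute)
qed (rule scaleC_add_right)

lemma op_scale_apply [simp]: "blinfun_apply (op_scale c x) u = scaleC c (x u)"
  unfolding op_scale_def
  by (subst bounded_linear_Blinfun_apply)
     (auto intro!: bounded_linear_compose[OF bounded_linear_scaleC] blinfun.bounded_linear_right)

text \<open>Identities between operators are checked on the matrix coefficients
  \<open>\<langle>x u, v\<rangle>\<close>, where they become identities between complex numbers.\<close>

lemma op_eqI:
  assumes "\<And>u v. cinner (blinfun_apply x u) v = cinner (blinfun_apply y u) (v::'a::chilbert_space)"
  shows "x = y"
  by (rule blinfun_eqI, rule cinner_eqI, rule assms)

lemma op_scale_scale: "op_scale c (op_scale d x) = op_scale (c * d) (x :: 'h::chilbert_space \<Rightarrow>\<^sub>L 'h)"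
  by (rule blinfun_eqI) (simp add: scaleC_scaleC)

lemma op_scale_one [simp]: "op_scale 1 (x :: 'h::chilbert_space \<Rightarrow>\<^sub>L 'h) = x"
  by (rule blinfun_eqI) simp

lemma op_scale_zero [simp]: "op_scale 0 (x :: 'h::chilbert_space \<Rightarrow>\<^sub>L 'h) = 0"
  by (rule blinfun_eqI) simp

lemma op_scale_minus1: "op_scale (-1) (x :: 'h::chilbert_space \<Rightarrow>\<^sub>L 'h) = - x"
  by (rule blinfun_eqI) (simp add: scaleC_minus1 blinfun.bilinear_simps)

lemma op_scale_add: "op_scale c (x + y) = op_scale c x + op_scale c (y :: 'h::chilbert_space \<Rightarrow>\<^sub>L 'h)"
  by (rule blinfun_eqI) (simp add: scaleC_add_right blinfun.bilinear_simps)

lemma op_scale_add_left: "op_scale (c + d) x = op_scale c x + op_scale d (x :: 'h::chilbert_space \<Rightarrow>\<^sub>L 'h)"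
  by (rule blinfun_eqI) (simp add: scaleC_add_left blinfun.bilinear_simps)

lemma op_scale_diff: "op_scale c (x - y) = op_scale c x - op_scale c (y :: 'h::chilbert_space \<Rightarrow>\<^sub>L 'h)"
  by (rule op_eqI) (simp add: blinfun.bilinear_simps cinner_simps algebra_simps)

lemma op_scale_compose_left: "op_scale c x o\<^sub>L y = op_scale c (x o\<^sub>L (y :: 'h::chilbert_space \<Rightarrow>\<^sub>L 'h))"
  by (rule blinfun_eqI) simp

lemma bops_apply: "x \<in> bops \<Longrightarrow> blinfun_apply x (scaleC c u) = scaleC c (blinfun_apply x u)"
  by (simp add: bops_def)

lemma op_scale_compose_right: "x \<in> bops \<Longrightarrow> x o\<^sub>L op_scale c y = op_scale c (x o\<^sub>L (y :: 'h::chilbert_space \<Rightarrow>\<^sub>L 'h))"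
  by (rule blinfun_eqI) (simp add: bops_apply)

lemma norm_op_scale: "norm (op_scale c (x :: 'h::chilbert_space \<Rightarrow>\<^sub>L 'h)) \<le> norm c * norm x"
  by (rule norm_blinfun_bound) (auto simp: norm_scaleC mult.assoc intro!: mult_left_mono norm_blinfun)

lemma norm_id_blinfun_le: "norm (id_blinfun :: 'h::chilbert_space \<Rightarrow>\<^sub>L 'h) \<le> 1"
  by (rule norm_blinfun_bound) auto

lemma bounded_linear_op_scale: "bounded_linear (op_scale c :: ('h::chilbert_space \<Rightarrow>\<^sub>L 'h) \<Rightarrow> _)"
proof
  fix r :: real and x :: "'h \<Rightarrow>\<^sub>L 'h"
  show "op_scale c (r *\<^sub>R x) = r *\<^sub>R op_scale c x"
    by (rule op_eqI) (simp add: blinfun.bilinear_simps cinner_simps cinner_scaleR_left)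
  show "\<exists>K. \<forall>x::'h \<Rightarrow>\<^sub>L 'h. norm (op_scale c x) \<le> norm x * K"
    by (intro exI[of _ "norm c"]) (metis norm_op_scale mult.commute)
qed (rule op_scale_add)

lemmas tendsto_op_scale = bounded_linear.tendsto[OF bounded_linear_op_scale]
lemmas tendsto_blinfun_compose = bounded_bilinear.tendsto[OF bounded_bilinear_blinfun_compose]

lemmas compose_simps =
  bounded_bilinear.add_left[OF bounded_bilinear_blinfun_compose]
  bounded_bilinear.add_right[OF bounded_bilinear_blinfun_compose]
  bounded_bilinear.diff_left[OF bounded_bilinear_blinfun_compose]
  bounded_bilinear.diff_right[OF bounded_bilinear_blinfun_compose]
  bounded_bilinear.minus_left[OF bounded_bilinear_blinfun_compose]
  bounded_bilinear.minus_right[OF bounded_bilinear_blinfun_compose]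

lemma compose_id [simp]: "x o\<^sub>L id_blinfun = x" "id_blinfun o\<^sub>L x = x"
  by (auto intro: blinfun_eqI)

lemma compose_assoc: "(x o\<^sub>L y) o\<^sub>L z = x o\<^sub>L (y o\<^sub>L z)"
  by (auto intro: blinfun_eqI)

lemma compose_cancel: "x o\<^sub>L y = id_blinfun \<Longrightarrow> x o\<^sub>L (y o\<^sub>L z) = z"
  by (metis compose_assoc compose_id(2))

text \<open>The closure properties shared by von Neumann algebras, by \<open>B(H)\<close> and by the norm-closed algebra
  generated by one unitary; they keep the resolvents of a unitary inside the algebra of its powers.\<close>

locale op_algebra =
  fixes N :: "('h::chilbert_space \<Rightarrow>\<^sub>L 'h) set"
  assumes sub_bops: "N \<subseteq> bops"
    and one_in: "id_blinfun \<in> N"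
    and add_in: "x \<in> N \<Longrightarrow> y \<in> N \<Longrightarrow> x + y \<in> N"
    and scale_in: "x \<in> N \<Longrightarrow> op_scale c x \<in> N"
    and mult_in: "x \<in> N \<Longrightarrow> y \<in> N \<Longrightarrow> x o\<^sub>L y \<in> N"
    and closed_in: "closed N"
begin

lemma zero_in: "0 \<in> N"
  using scale_in[OF one_in, of 0] by simp

lemma minus_in: "x \<in> N \<Longrightarrow> - x \<in> N"
  using scale_in[of x "-1"] by (simp add: op_scale_minus1)

lemma diff_in: "x \<in> N \<Longrightarrow> y \<in> N \<Longrightarrow> x - y \<in> N"
  using add_in[of x "-y"] minus_in[of y] by simp

lemma sum_in: "(\<And>i. i \<in> A \<Longrightarrow> f i \<in> N) \<Longrightarrow> sum f A \<in> N"
  by (induction A rule: infinite_finite_induct) (auto intro: zero_in add_in)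

lemma lim_in: "(\<And>n. f n \<in> N) \<Longrightarrow> f \<longlonglongrightarrow> x \<Longrightarrow> x \<in> N"
  using closed_sequentially[OF closed_in] by blast

lemma compose_scale: "x \<in> N \<Longrightarrow> x o\<^sub>L op_scale c y = op_scale c (x o\<^sub>L y)"
  using op_scale_compose_right sub_bops by blast

end

lemma bops_closed: "closed (bops :: ('h::chilbert_space \<Rightarrow>\<^sub>L 'h) set)"
proof -
  have "closed {x :: 'h \<Rightarrow>\<^sub>L 'h. blinfun_apply x (scaleC c u) = scaleC c (blinfun_apply x u)}" for c u
    by (intro closed_Collect_eq continuous_intros
          bounded_linear.continuous_on[OF bounded_linear_scaleC] blinfun.continuous_on)
  then have "closed (\<Inter>c. \<Inter>u. {x :: 'h \<Rightarrow>\<^sub>L 'h. blinfun_apply x (scaleC c u) = scaleC c (blinfun_apply x u)})"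
    by auto
  moreover have "bops = (\<Inter>c. \<Inter>u. {x :: 'h \<Rightarrow>\<^sub>L 'h. blinfun_apply x (scaleC c u) = scaleC c (blinfun_apply x u)})"
    by (auto simp: bops_def)
  ultimately show ?thesis by simp
qed

lemma bops_algebra: "op_algebra bops"
  by unfold_locales
     (auto simp: bops_closed, auto simp: bops_def blinfun.bilinear_simps scaleC_add_right scaleC_scaleC mult.commute)

lemma commutant_algebra:
  assumes "S \<subseteq> bops" shows "op_algebra (commutant (S :: ('h::chilbert_space \<Rightarrow>\<^sub>L 'h) set))"
proof -
  interpret b: op_algebra bops by (rule bops_algebra)
  have eq: "commutant S = bops \<inter> (\<Inter>x\<in>S. {y. x o\<^sub>L y = y o\<^sub>L x})" by (auto simp: commutant_def)
  show ?thesis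
  proof
    show "closed (commutant S)"
      unfolding eq
      by (intro closed_Int bops_closed closed_INT ballI closed_Collect_eq
          bounded_bilinear.continuous_on[OF bounded_bilinear_blinfun_compose] continuous_intros)
    show "x o\<^sub>L y \<in> commutant S" if "x \<in> commutant S" "y \<in> commutant S" for x y
    proof -
      have "z o\<^sub>L (x o\<^sub>L y) = (x o\<^sub>L y) o\<^sub>L z" if "z \<in> S" for z
        using \<open>x \<in> commutant S\<close> \<open>y \<in> commutant S\<close> that
      proof -
        have c: "z o\<^sub>L x = x o\<^sub>L z" "z o\<^sub>L y = y o\<^sub>L z"
          using \<open>x \<in> commutant S\<close> \<open>y \<in> commutant S\<close> that by (auto simp: commutant_def)
        have "z o\<^sub>L (x o\<^sub>L y) = (x o\<^sub>L z) o\<^sub>L y" by (simp only: compose_assoc[symmetric] c(1))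
        also have "\<dots> = (x o\<^sub>L y) o\<^sub>L z" by (simp only: compose_assoc c(2))
        finally show ?thesis .
      qed
      then show ?thesis using that by (auto simp: commutant_def intro: b.mult_in)
    qed
  qed (use assms in \<open>auto simp: commutant_def compose_simps op_scale_compose_left op_scale_compose_right
        intro: b.add_in b.one_in b.scale_in\<close>)
qed

lemma von_neumann_op_algebra: "von_neumann_algebra N \<Longrightarrow> op_algebra N"
  using commutant_algebra[of "commutant N"] unfolding von_neumann_algebra_def
  by (auto simp: commutant_def)

section \<open>Adjoints, inverses and integer powers\<close>

lemma is_adjoint_unique: "is_adjoint x y \<Longrightarrow> is_adjoint x z \<Longrightarrow> y = (z :: 'h::chilbert_space \<Rightarrow>\<^sub>L 'h)"
  unfolding is_adjoint_def by (rule op_eqI) (metis cinner_commute)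

lemma adj_eqI: "is_adjoint x y \<Longrightarrow> adj x = y"
  unfolding adj_def by (rule the_equality) (auto intro: is_adjoint_unique)

lemma op_inv_eqI: "x o\<^sub>L y = id_blinfun \<Longrightarrow> y o\<^sub>L x = id_blinfun \<Longrightarrow> op_inv x = y"
  unfolding op_inv_def
proof (rule the_equality)
  fix z assume "x o\<^sub>L z = id_blinfun \<and> z o\<^sub>L x = id_blinfun" "x o\<^sub>L y = id_blinfun" "y o\<^sub>L x = id_blinfun"
  then have "z = (y o\<^sub>L x) o\<^sub>L z" "y o\<^sub>L (x o\<^sub>L z) = y" by auto
  then show "z = y" by (simp only: compose_assoc)
qed auto

lemma von_neumann_adj:
  assumes "von_neumann_algebra N" "x \<in> N"
  shows "adj x \<in> N" "is_adjoint x (adj x)"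
  using assms adj_eqI unfolding von_neumann_algebra_def by blast+

text \<open>Invertibility in \<open>B(H)\<close> is part of the definition, so that no adjoint has to be constructed from
  the Riesz representation; the inverse turns out to be the adjoint.\<close>

definition unitary_op :: "('h::chilbert_space \<Rightarrow>\<^sub>L 'h) \<Rightarrow> bool" where
  "unitary_op x \<longleftrightarrow> x \<in> bops \<and> (\<exists>y\<in>bops. x o\<^sub>L y = id_blinfun \<and> y o\<^sub>L x = id_blinfun) \<and>
     (\<forall>u v. cinner (x u) (x v) = cinner u v)"

lemma unitary_op_inv:
  assumes "unitary_op x"
  shows "x o\<^sub>L op_inv x = id_blinfun" "op_inv x o\<^sub>L x = id_blinfun" "op_inv x \<in> bops" "x \<in> bops"
    "op_inv (op_inv x) = x" "is_adjoint x (op_inv x)" "unitary_op (op_inv x)" "adj x = op_inv x"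
proof -
  obtain y where y: "x \<in> bops" "y \<in> bops" "x o\<^sub>L y = id_blinfun" "y o\<^sub>L x = id_blinfun"
    and iso: "\<And>u v. cinner (x u) (x v) = cinner u v"
    using assms unfolding unitary_op_def by blast
  have e: "op_inv x = y" using y op_inv_eqI by blast
  have xy: "x (y u) = u" "y (x u) = u" for u
    using y(3,4) by (metis blinfun_apply_blinfun_compose blinfun_apply_id_blinfun id_apply)+
  show "x o\<^sub>L op_inv x = id_blinfun" "op_inv x o\<^sub>L x = id_blinfun" "op_inv x \<in> bops" "x \<in> bops"
    "op_inv (op_inv x) = x"
    unfolding e using y by (auto intro: op_inv_eqI)
  show a: "is_adjoint x (op_inv x)"
    unfolding is_adjoint_def e using iso xy by metis
  show "adj x = op_inv x" using a by (rule adj_eqI)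
  show "unitary_op (op_inv x)"
    unfolding unitary_op_def e using y iso xy by metis
qed

lemma unitary_op_apply:
  assumes "unitary_op x"
  shows "x (op_inv x u) = u" "op_inv x (x u) = u" "cinner (x u) (x v) = cinner u v" "norm (x u) = norm u"
proof -
  show "x (op_inv x u) = u" "op_inv x (x u) = u"
    using unitary_op_inv[OF assms] by (metis blinfun_apply_blinfun_compose blinfun_apply_id_blinfun id_apply)+
  show c: "cinner (x u) (x v) = cinner u v" for u v using assms by (auto simp: unitary_op_def)
  have "complex_of_real ((norm (x u))\<^sup>2) = complex_of_real ((norm u)\<^sup>2)"
    using c[of u u] by (simp only: cinner_self)
  then show "norm (x u) = norm u"
    by (metis of_real_eq_iff norm_ge_zero power2_eq_iff_nonneg)
qed

lemma unitary_op_norm_le: "unitary_op x \<Longrightarrow> norm x \<le> 1"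
  by (rule norm_blinfun_bound) (auto simp: unitary_op_apply)

lemma unitary_op_id: "unitary_op id_blinfun"
  unfolding unitary_op_def by (auto intro!: bexI[of _ id_blinfun] simp: bops_def)

lemma unitary_op_mult:
  assumes "unitary_op x" "unitary_op y"
  shows "unitary_op (x o\<^sub>L y)" "op_inv (x o\<^sub>L y) = op_inv y o\<^sub>L op_inv x"
proof -
  have c: "(x o\<^sub>L y) o\<^sub>L (op_inv y o\<^sub>L op_inv x) = id_blinfun" "(op_inv y o\<^sub>L op_inv x) o\<^sub>L (x o\<^sub>L y) = id_blinfun"
    using assms by (simp_all add: compose_assoc compose_cancel unitary_op_inv)
  then show "op_inv (x o\<^sub>L y) = op_inv y o\<^sub>L op_inv x" by (rule op_inv_eqI)
  have b: "op_inv y o\<^sub>L op_inv x \<in> bops" "x o\<^sub>L y \<in> bops"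
    using op_algebra.mult_in[OF bops_algebra] unitary_op_inv assms by blast+
  show "unitary_op (x o\<^sub>L y)"
    unfolding unitary_op_def using b c
    by (auto intro!: bexI[of _ "op_inv y o\<^sub>L op_inv x"] simp: unitary_op_apply[OF assms(1)] unitary_op_apply[OF assms(2)])
qed

lemma op_powi_0 [simp]: "op_powi x 0 = id_blinfun" by (simp add: op_powi_def)

lemma op_powi_1 [simp]: "op_powi x 1 = x" by (simp add: op_powi_def)

lemma op_powi_succ:
  assumes "unitary_op x"
  shows "op_powi x (n + 1) = x o\<^sub>L op_powi x n"
proof (cases "0 \<le> n")
  case True
  then have "nat (n + 1) = Suc (nat n)" by simp
  then show ?thesis using True by (simp add: op_powi_def)
next
  case False
  define k where "k = nat (- n) - 1"
  have n: "n = - int (Suc k)" "n + 1 = - int k" using False by (auto simp: k_def)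
  show ?thesis unfolding n
    using unitary_op_inv(1)[OF assms] by (cases k) (auto simp: op_powi_def compose_cancel nat_add_distrib)
qed

lemma op_powi_pred:
  assumes "unitary_op x"
  shows "op_powi x (n - 1) = op_inv x o\<^sub>L op_powi x n"
  using op_powi_succ[OF assms, of "n - 1"] unitary_op_inv(2)[OF assms] by (simp add: compose_cancel)

text \<open>Induction on \<open>n\<close> in both directions reduces the law of exponents to the two one-step recursions.\<close>

lemma op_powi_add:
  assumes "unitary_op x"
  shows "op_powi x (n + m) = op_powi x n o\<^sub>L op_powi x m"
proof (induction n rule: int_induct[of _ 0])
  case (step1 i)
  show ?case using op_powi_succ[OF assms, of "i + m"] op_powi_succ[OF assms, of i] step1
    by (simp add: compose_assoc algebra_simps)
next
  case (step2 i)
  show ?case using op_powi_pred[OF assms, of "i + m"] op_powi_pred[OF assms, of i] step2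
    by (simp add: compose_assoc algebra_simps)
qed simp

lemma op_powi_minus_1: "unitary_op x \<Longrightarrow> op_powi x (-1) = op_inv x"
  using op_powi_pred[of x 0] by simp

lemma op_powi_unitary:
  assumes "unitary_op x" shows "unitary_op (op_powi x n)"
  by (induction n rule: int_induct[of _ 0])
     (auto simp: unitary_op_id op_powi_succ[OF assms] op_powi_pred[OF assms] unitary_op_inv[OF assms]
       intro!: unitary_op_mult assms)

lemma op_powi_commute:
  assumes "unitary_op x" "z o\<^sub>L x = x o\<^sub>L z"
  shows "z o\<^sub>L op_powi x n = op_powi x n o\<^sub>L z"
proof -
  have z: "z o\<^sub>L op_inv x = op_inv x o\<^sub>L z"
  proof -
    have "op_inv x o\<^sub>L ((z o\<^sub>L x) o\<^sub>L op_inv x) = op_inv x o\<^sub>L ((x o\<^sub>L z) o\<^sub>L op_inv x)"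
      by (simp only: assms(2))
    then show ?thesis using assms(1) by (simp add: compose_assoc compose_cancel unitary_op_inv)
  qed
  show ?thesis
  proof (induction n rule: int_induct[of _ 0])
    case (step1 i)
    show ?case unfolding op_powi_succ[OF assms(1)] using step1(2) assms(2) by (metis compose_assoc)
  next
    case (step2 i)
    show ?case unfolding op_powi_pred[OF assms(1)] using step2(2) z by (metis compose_assoc)
  qed simp
qed

lemma (in op_algebra) op_powi_in:
  assumes "unitary_op x" "x \<in> N" "op_inv x \<in> N" shows "op_powi x n \<in> N"
  by (induction n rule: int_induct[of _ 0])
     (auto simp: op_powi_succ[OF assms(1)] op_powi_pred[OF assms(1)] one_in intro!: mult_in assms)

section \<open>The Neumann series\<close>

text \<open>Powers of operators that need not be invertible; \<open>op_powi\<close> agrees with them on exponents \<open>\<ge> 0\<close>.\<close>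

definition opow :: "('h::chilbert_space \<Rightarrow>\<^sub>L 'h) \<Rightarrow> nat \<Rightarrow> 'h \<Rightarrow>\<^sub>L 'h" where
  "opow x n = (((o\<^sub>L) x) ^^ n) id_blinfun"

lemma opow_simps [simp]: "opow x 0 = id_blinfun" "opow x (Suc n) = x o\<^sub>L opow x n"
  by (simp_all add: opow_def)

lemma opow_Suc2: "opow x (Suc n) = opow x n o\<^sub>L x"
  by (induction n) (simp, metis compose_assoc opow_simps(2))

lemma op_powi_int [simp]: "op_powi x (int n) = opow x n"
  by (simp add: op_powi_def opow_def)

lemma norm_opow: "norm (opow (x :: 'h::chilbert_space \<Rightarrow>\<^sub>L 'h) n) \<le> norm x ^ n"
proof (induction n)
  case (Suc n)
  have "norm (opow x (Suc n)) \<le> norm x * norm (opow x n)" by (simp add: norm_blinfun_compose)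
  also have "\<dots> \<le> norm x * norm x ^ n" using Suc by (intro mult_left_mono) auto
  finally show ?case by simp
qed (use norm_id_blinfun_le in auto)

lemma opow_scale: "x \<in> bops \<Longrightarrow> opow (op_scale c x) n = op_scale (c ^ n) (opow x n)"
  by (induction n) (auto simp: op_scale_compose_left op_scale_compose_right op_scale_scale)

text \<open>The sum \<open>z\<close> of the geometric series satisfies \<open>xz = zx = z - 1\<close> by shifting the series, so it is a
  two-sided inverse of \<open>1 - x\<close>, and inverses are unique.\<close>

lemma neumann:
  fixes x :: "'h::chilbert_space \<Rightarrow>\<^sub>L 'h"
  assumes "norm x < 1"
  shows "opow x sums op_inv (id_blinfun - x)"
    "(id_blinfun - x) o\<^sub>L op_inv (id_blinfun - x) = id_blinfun"
    "op_inv (id_blinfun - x) o\<^sub>L (id_blinfun - x) = id_blinfun"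
proof -
  have s: "summable (opow x)"
    by (rule summable_comparison_test'[of "\<lambda>n. norm x ^ n" 0]) (use assms norm_opow in auto)
  define z where "z = suminf (opow x)"
  have sz: "opow x sums z" using s by (simp add: z_def summable_sums)
  have s1: "(\<lambda>n. opow x (Suc n)) sums (z - id_blinfun)" using sz sums_Suc_iff[of "opow x"] by simp
  have "(\<lambda>n. x o\<^sub>L opow x n) sums (x o\<^sub>L z)"
    using bounded_linear.sums[OF bounded_bilinear.bounded_linear_right[OF bounded_bilinear_blinfun_compose] sz] .
  then have "x o\<^sub>L z = z - id_blinfun" by (intro sums_unique2[OF _ s1]) simp
  then have 1: "(id_blinfun - x) o\<^sub>L z = id_blinfun" by (simp add: compose_simps)
  have "(\<lambda>n. opow x n o\<^sub>L x) sums (z o\<^sub>L x)"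
    using bounded_linear.sums[OF bounded_bilinear.bounded_linear_left[OF bounded_bilinear_blinfun_compose] sz] .
  then have "z o\<^sub>L x = z - id_blinfun" by (intro sums_unique2[OF _ s1]) (simp only: opow_Suc2)
  then have 2: "z o\<^sub>L (id_blinfun - x) = id_blinfun" by (simp add: compose_simps)
  have "op_inv (id_blinfun - x) = z" using 1 2 by (rule op_inv_eqI)
  then show "opow x sums op_inv (id_blinfun - x)"
    "(id_blinfun - x) o\<^sub>L op_inv (id_blinfun - x) = id_blinfun"
    "op_inv (id_blinfun - x) o\<^sub>L (id_blinfun - x) = id_blinfun" using 1 2 sz by auto
qed

section \<open>A continuous curve through all dyadic points of the square\<close>

text \<open>The function \<open>t \<mapsto> (schoenberg t, schoenberg (3 t))\<close> is a variant of Schoenberg's space-filling curve. Its purpose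
  is to lift discrete measures on the torus to the unit interval, where Helly's selection theorem
  yields weak limits. The building block \<open>tooth\<close> is a clipped cosine instead of the usual piecewise
  linear function: it is obviously continuous and 2-periodic, and it still vanishes on \<open>[0, 1/3]\<close> and
  equals 1 on \<open>[2/3, 1]\<close>, which is all that matters.\<close>

definition tooth :: "real \<Rightarrow> real" where
  "tooth t = max 0 (min 1 (1/2 - cos (pi * t)))"

definition schoenberg :: "real \<Rightarrow> real" where
  "schoenberg t = (\<Sum>k. tooth (9 ^ k * t) / 2 ^ Suc k)"

lemma tooth_bounds: "0 \<le> tooth t" "tooth t \<le> 1"
  by (auto simp: tooth_def)

lemma tooth_periodic: "tooth (x + 2 * real m) = tooth x"
proof -
  have "cos (pi * (x + 2 * real m)) = cos (pi * x + 2 * real m * pi)" by (simp add: algebra_simps)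
  also have "\<dots> = cos (pi * x)" unfolding cos_add cos_2npi sin_2npi by simp
  finally show ?thesis by (simp add: tooth_def)
qed

lemma tooth_low:
  assumes "0 \<le> t" "t \<le> 1/3" shows "tooth t = 0"
proof -
  have "cos (pi / 3) \<le> cos (pi * t)"
    using assms by (intro cos_monotone_0_pi_le) (auto simp: field_simps)
  then show ?thesis by (simp add: tooth_def cos_60)
qed

lemma tooth_high:
  assumes "2/3 \<le> t" "t \<le> 1" shows "tooth t = 1"
proof -
  have "cos (pi * t) \<le> cos (2 * pi / 3)"
    using assms by (intro cos_monotone_0_pi_le) (auto simp: field_simps)
  then show ?thesis by (simp add: tooth_def cos_120)
qed

text \<open>On a point whose first ternary digit is \<open>2a\<close> the function reads off the binary digit \<open>a\<close>.\<close>

lemma tooth_digit: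
  assumes "0 \<le> r" "r \<le> 1" "a < (2::nat)" shows "tooth (2 * real a / 3 + r / 3) = real a"
proof (cases "a = 0")
  case True
  then show ?thesis using assms by (auto intro!: tooth_low)
next
  case False
  then have "a = 1" using assms by simp
  then show ?thesis using assms by (auto intro!: tooth_high)
qed

lemma schoenberg_summable: "summable (\<lambda>k. tooth (9 ^ k * t) / 2 ^ Suc k)"
proof (rule summable_comparison_test'[of "\<lambda>k. (1/2) * (1/2) ^ k" 0])
  show "summable (\<lambda>k. (1/2) * (1/2::real) ^ k)" by (intro summable_mult summable_geometric) simp
qed (use tooth_bounds in \<open>auto simp: power_divide divide_simps\<close>)

lemma schoenberg_step: "schoenberg t = tooth t / 2 + schoenberg (9 * t) / 2"
proof -
  have "schoenberg t = (\<Sum>k. tooth (9 ^ Suc k * t) / 2 ^ Suc (Suc k)) + tooth t / 2"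
    unfolding schoenberg_def using suminf_split_head[OF schoenberg_summable[of t]] by simp
  also have "(\<Sum>k. tooth (9 ^ Suc k * t) / 2 ^ Suc (Suc k)) = (\<Sum>k. tooth (9 ^ k * (9 * t)) / 2 ^ Suc k / 2)"
    by (simp add: mult_ac)
  also have "\<dots> = schoenberg (9 * t) / 2"
    unfolding schoenberg_def using schoenberg_summable by (rule suminf_divide)
  finally show ?thesis by simp
qed

lemma schoenberg_periodic: "schoenberg (x + 2 * real m) = schoenberg x"
proof -
  have "tooth (9 ^ k * (x + 2 * real m)) = tooth (9 ^ k * x)" for k
    using tooth_periodic[of "9 ^ k * x" "9 ^ k * m"] by (simp add: algebra_simps)
  then show ?thesis by (simp add: schoenberg_def)
qed

lemma continuous_schoenberg: "continuous_on UNIV schoenberg"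
proof -
  have "uniform_limit UNIV (\<lambda>n t. \<Sum>k<n. tooth (9 ^ k * t) / 2 ^ Suc k) (\<lambda>t. \<Sum>k. tooth (9 ^ k * t) / 2 ^ Suc k) sequentially"
  proof (rule Weierstrass_m_test_ev[where M = "\<lambda>k. (1/2) * (1/2) ^ k"])
    show "summable (\<lambda>k. (1/2) * (1/2::real) ^ k)" by (intro summable_mult summable_geometric) simp
  qed (use tooth_bounds in \<open>auto simp: power_divide divide_simps\<close>)
  then have "continuous_on UNIV (\<lambda>t. \<Sum>k. tooth (9 ^ k * t) / 2 ^ Suc k)"
    by (rule uniform_limit_theorem[rotated]) (auto simp: tooth_def intro!: always_eventually continuous_intros)
  then show ?thesis by (simp add: schoenberg_def[abs_def])
qed

text \<open>Reading the ternary digits of \<open>t\<close> alternately yields the binary digits of the two coordinates: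
  prefixing the digits \<open>2a, 2b\<close> to \<open>t\<close> prefixes the digit \<open>a\<close> to the first coordinate
  and the digit \<open>b\<close> to the second.\<close>

lemma schoenberg_hits_dyadics:
  "j < 2 ^ n \<Longrightarrow> k < 2 ^ n \<Longrightarrow>
    \<exists>t\<in>{0..1}. schoenberg t = real j / 2 ^ n \<and> schoenberg (3 * t) = real k / 2 ^ n"
proof (induction n arbitrary: j k)
  case 0
  have "schoenberg 0 = 0" by (simp add: schoenberg_def tooth_low)
  then show ?case using 0 by (intro bexI[of _ 0]) auto
next
  case (Suc n)
  define a j' where "a = j div 2 ^ n" and "j' = j mod 2 ^ n"
  define b k' where "b = k div 2 ^ n" and "k' = k mod 2 ^ n"
  have j: "j = a * 2 ^ n + j'" "a < 2" "j' < 2 ^ n"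
    using Suc.prems div_mult_mod_eq[of j "2 ^ n"] by (auto simp: a_def j'_def less_mult_imp_div_less)
  have k: "k = b * 2 ^ n + k'" "b < 2" "k' < 2 ^ n"
    using Suc.prems div_mult_mod_eq[of k "2 ^ n"] by (auto simp: b_def k'_def less_mult_imp_div_less)
  obtain t where t: "0 \<le> t" "t \<le> 1" "schoenberg t = real j' / 2 ^ n" "schoenberg (3 * t) = real k' / 2 ^ n"
    using Suc.IH[OF j(3) k(3)] by auto
  define r where "r = 2 * real b / 3 + t / 3"
  have r: "0 \<le> r" "r \<le> 1" using t k(2) by (auto simp: r_def less_2_cases_iff)
  define u where "u = 2 * real a / 3 + r / 3"
  have u: "0 \<le> u" "u \<le> 1" using r j(2) by (auto simp: u_def less_2_cases_iff)
  have 1: "tooth u = real a" unfolding u_def using r j(2) by (rule tooth_digit)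
  have "3 * u = r + 2 * real a" by (simp add: u_def)
  then have 2: "tooth (3 * u) = real b"
    using tooth_periodic[of r a] tooth_digit[OF t(1,2) k(2)] by (simp add: r_def)
  have "9 * u = t + 2 * real (3 * a + b)" by (simp add: u_def r_def)
  then have 3: "schoenberg (9 * u) = schoenberg t" by (simp only: schoenberg_periodic)
  have "9 * (3 * u) = 3 * t + 2 * real (9 * a + 3 * b)" by (simp add: u_def r_def)
  then have 4: "schoenberg (9 * (3 * u)) = schoenberg (3 * t)" by (simp only: schoenberg_periodic)
  have "schoenberg u = real j / 2 ^ Suc n"
    using schoenberg_step[of u] j(1) unfolding 1 3 t(3) by (simp add: field_simps)
  moreover have "schoenberg (3 * u) = real k / 2 ^ Suc n"
    using schoenberg_step[of "3 * u"] k(1) unfolding 2 4 t(4) by (simp add: field_simps)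
  ultimately show ?case using u by auto
qed

section \<open>Stationary families are Fourier transforms of measures on the torus\<close>

abbreviation circle :: "complex set" where "circle \<equiv> sphere 0 1"

abbreviation torus :: "(complex \<times> complex) set" where "torus \<equiv> sphere 0 1 \<times> sphere 0 1"

text \<open>For \<open>d \<noteq> 0\<close> this is a geometric sum with ratio \<open>\<omega> = e\<^sup>2\<^sup>\<pi>\<^sup>i\<^sup>d\<^sup>/\<^sup>K\<close>, where \<open>\<omega>\<^sup>K = 1\<close>; the bound on \<open>d\<close>
  excludes \<open>\<omega> = 1\<close>.\<close>

lemma roots_of_unity_orthogonal:
  assumes "\<bar>d\<bar> < int K"
  shows "(\<Sum>j<K. cis (2 * pi * real j / real K) powi d) = (if d = 0 then of_nat K else 0)"
proof (cases "d = 0")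
  case False
  have K: "K > 0" using assms by simp
  define \<omega> where "\<omega> = cis (2 * pi * of_int d / real K)"
  have p: "cis (2 * pi * real j / real K) powi d = \<omega> ^ j" for j
  proof -
    have "\<omega> ^ j = cis (real j * (2 * pi * of_int d / real K))" unfolding \<omega>_def by (rule Complex.DeMoivre)
    also have "real j * (2 * pi * of_int d / real K) = of_int d * (2 * pi * real j / real K)" by simp
    finally show ?thesis by (simp only: cis_power_int)
  qed
  have "real K * (2 * pi * of_int d / real K) = 2 * pi * of_int d" using K by simp
  then have K1: "\<omega> ^ K = 1" unfolding \<omega>_def Complex.DeMoivre by simp
  have "\<omega> \<noteq> 1"
  proof
    assume "\<omega> = 1"
    then have "cos (2 * pi * of_int d / real K) = 1" by (simp add: \<omega>_def complex_eq_iff)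
    then obtain n :: int where "2 * pi * of_int d / real K = of_int n * 2 * pi"
      unfolding cos_one_2pi_int by blast
    then have "real_of_int d = of_int n * real K" using K by (simp add: field_simps)
    then have "d = n * int K" by (metis of_int_eq_iff of_int_mult of_int_of_nat_eq)
    then have "int K dvd d" by simp
    then have "int K \<le> \<bar>d\<bar>" using False dvd_imp_le_int[of d "int K"] by simp
    then show False using assms by simp
  qed
  then show ?thesis using False K1 by (simp add: p sum_gp_strict)
qed simp

lemma card_differences:
  assumes "\<bar>n\<bar> \<le> int N"
  shows "card {p \<in> {..<N} \<times> {..<N}. int (fst p) - int (snd p) = n} = nat (int N - \<bar>n\<bar>)"
proof (cases "n \<ge> 0")
  case True
  have "bij_betw (\<lambda>a. (a + nat n, a)) {..<N - nat n} {p \<in> {..<N} \<times> {..<N}. int (fst p) - int (snd p) = n}"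
    by (rule bij_betwI[where g = snd]) (use True in auto)
  then show ?thesis using bij_betw_same_card[of _ "{..<N - nat n}"] True by fastforce
next
  case False
  have "bij_betw (\<lambda>a. (a, a + nat (- n))) {..<N - nat (- n)} {p \<in> {..<N} \<times> {..<N}. int (fst p) - int (snd p) = n}"
    by (rule bij_betwI[where g = fst]) (use False in auto)
  then show ?thesis using bij_betw_same_card[of _ "{..<N - nat (- n)}"] False by fastforce
qed

lemma sum_square_product:
  fixes f g :: "'i \<Rightarrow> 'i \<Rightarrow> complex"
  shows "(\<Sum>p\<in>A\<times>A. \<Sum>q\<in>A\<times>A. f (fst p) (fst q) * g (snd p) (snd q)) = (\<Sum>a\<in>A. \<Sum>a'\<in>A. f a a') * (\<Sum>b\<in>A. \<Sum>b'\<in>A. g b b')"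
proof -
  have prod: "(\<Sum>q\<in>A\<times>A. F (fst q) * G (snd q)) = (\<Sum>a\<in>A. F a) * (\<Sum>b\<in>A. G b)" for F G :: "'i \<Rightarrow> complex"
    by (simp only: sum_product sum.cartesian_product case_prod_unfold)
  show ?thesis using prod[of "\<lambda>a. sum (f a) A" "\<lambda>b. sum (g b) A"] by (simp only: prod)
qed

text \<open>The orbit of a vector under two commuting unitaries has this property, with \<open>c\<close> the matrix
  coefficient of their powers at that vector.\<close>

definition stationary :: "(int \<Rightarrow> int \<Rightarrow> 'a::chilbert_space) \<Rightarrow> (int \<Rightarrow> int \<Rightarrow> complex) \<Rightarrow> bool" where
  "stationary x c \<longleftrightarrow> (\<forall>a b a' b'. cinner (x a b) (x a' b') = c (a - a') (b - b'))"

text \<open>The squared norms of these vectors are, up to normalization, the values of the Fejer means of the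
  Fourier series with coefficients \<open>c\<close>. They are nonnegative by construction, and stationarity expresses
  them through \<open>c\<close>.\<close>

definition fejer_vec :: "(int \<Rightarrow> int \<Rightarrow> 'a::chilbert_space) \<Rightarrow> nat \<Rightarrow> complex \<Rightarrow> complex \<Rightarrow> 'a" where
  "fejer_vec x N s t = (\<Sum>p\<in>{..<N}\<times>{..<N}. scaleC (cnj s ^ fst p * cnj t ^ snd p) (x (int (fst p)) (int (snd p))))"

text \<open>The squared norms at pairs of \<open>2N\<close>-th roots of unity are weights of a discrete measure on the
  torus, and its low moments are the Fejer-damped coefficients. The reason for the grid of size \<open>2N\<close>
  is that all exponents \<open>n - a + a'\<close> with \<open>|n| \<le> N\<close> and \<open>a, a' < N\<close> are then smaller than the period
  in absolute value, so that the orthogonality relations pick out exactly the pairs with \<open>a - a' = n\<close>.\<close>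

lemma fejer_moments:
  fixes N :: nat and x :: "int \<Rightarrow> int \<Rightarrow> 'a::chilbert_space"
  assumes st: "stationary x c" and N: "0 < N" and n: "\<bar>n\<bar> \<le> int N" and m: "\<bar>m\<bar> \<le> int N"
  defines "K \<equiv> 2 * N"
  defines "\<zeta> \<equiv> \<lambda>j. cis (2 * pi * real j / real K)"
  shows "(\<Sum>(j,k)\<in>{..<K}\<times>{..<K}. ((norm (fejer_vec x N (\<zeta> j) (\<zeta> k)))\<^sup>2 / (real K * real N)\<^sup>2) *\<^sub>R (\<zeta> j powi n * \<zeta> k powi m))
     = c n m * of_real ((1 - \<bar>real_of_int n\<bar> / real N) * (1 - \<bar>real_of_int m\<bar> / real N))"
proof -
  let ?I = "{..<N} \<times> {..<N}"
  have z0: "\<zeta> j \<noteq> 0" for j by (simp add: \<zeta>_def)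
  have cz: "cnj (\<zeta> j) = inverse (\<zeta> j)" for j by (simp add: \<zeta>_def cis_cnj)
  have pw: "cnj (\<zeta> j) ^ a * \<zeta> j ^ a' * \<zeta> j powi n = \<zeta> j powi (n - int a + int a')" for j a a' n
    by (simp add: cz power_int_add power_int_diff z0 power_inverse divide_inverse mult_ac)
  have sq: "complex_of_real ((norm (fejer_vec x N (\<zeta> j) (\<zeta> k)))\<^sup>2) * (\<zeta> j powi n * \<zeta> k powi m)
     = (\<Sum>p\<in>?I. \<Sum>q\<in>?I. c (int (fst p) - int (fst q)) (int (snd p) - int (snd q)) *
          (\<zeta> j powi (n - int (fst p) + int (fst q)) * \<zeta> k powi (m - int (snd p) + int (snd q))))" for j k
  proof -
    have "complex_of_real ((norm (fejer_vec x N (\<zeta> j) (\<zeta> k)))\<^sup>2) =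
      (\<Sum>p\<in>?I. \<Sum>q\<in>?I. (cnj (\<zeta> j) ^ fst p * cnj (\<zeta> k) ^ snd p) * (\<zeta> j ^ fst q * \<zeta> k ^ snd q) *
         c (int (fst p) - int (fst q)) (int (snd p) - int (snd q)))"
      unfolding cinner_self[symmetric] fejer_vec_def
      apply (subst cinner_sum_left, subst cinner_sum_right)
      unfolding cinner_scaleC_left cinner_scaleC_right
      using st by (intro sum.cong refl) (simp add: stationary_def mult_ac)
    then show ?thesis
      by (simp only: sum_distrib_right sum_distrib_left pw[symmetric] mult_ac)
  qed
  have orth: "(\<Sum>j<K. \<zeta> j powi (n - int a + int a')) = (if int a - int a' = n then of_nat K else 0)"
    if "a < N" "a' < N" "\<bar>n\<bar> \<le> int N" for a a' n
    unfolding \<zeta>_def by (subst roots_of_unity_orthogonal) (use that in \<open>auto simp: K_def\<close>)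
  have cnt: "(\<Sum>a<N. \<Sum>a'<N. if int a - int a' = n then 1 else 0) = (of_real (real N - \<bar>real_of_int n\<bar>) :: complex)" if n: "\<bar>n\<bar> \<le> int N" for n
  proof -
    have "(\<Sum>a<N. \<Sum>a'<N. if int a - int a' = n then 1 else 0) =
        (\<Sum>p\<in>{..<N}\<times>{..<N}. if int (fst p) - int (snd p) = n then 1 else (0::complex))"
      by (simp only: sum.cartesian_product case_prod_unfold)
    also have "\<dots> = of_nat (card {p \<in> {..<N} \<times> {..<N}. int (fst p) - int (snd p) = n})"
      by (simp flip: sum.inter_filter)
    also have "\<dots> = of_real (real (nat (int N - \<bar>n\<bar>)))" by (simp only: card_differences[OF n] of_real_of_nat_eq)
    also have "real (nat (int N - \<bar>n\<bar>)) = real N - \<bar>real_of_int n\<bar>" using n by (simp add: of_nat_nat)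
    finally show ?thesis .
  qed
  have "(\<Sum>(j,k)\<in>{..<K}\<times>{..<K}. complex_of_real ((norm (fejer_vec x N (\<zeta> j) (\<zeta> k)))\<^sup>2) * (\<zeta> j powi n * \<zeta> k powi m))
    = (\<Sum>jk\<in>{..<K}\<times>{..<K}. \<Sum>p\<in>?I. \<Sum>q\<in>?I. c (int (fst p) - int (fst q)) (int (snd p) - int (snd q)) *
          (\<zeta> (fst jk) powi (n - int (fst p) + int (fst q)) * \<zeta> (snd jk) powi (m - int (snd p) + int (snd q))))"
    by (intro sum.cong refl) (auto simp: sq simp del: of_real_power split: prod.splits)
  also have "\<dots> = (\<Sum>p\<in>?I. \<Sum>q\<in>?I. \<Sum>jk\<in>{..<K}\<times>{..<K}. c (int (fst p) - int (fst q)) (int (snd p) - int (snd q)) *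
          (\<zeta> (fst jk) powi (n - int (fst p) + int (fst q)) * \<zeta> (snd jk) powi (m - int (snd p) + int (snd q))))"
    by (subst sum.swap, rule sum.cong[OF refl], rule sum.swap)
  also have "\<dots> = (\<Sum>p\<in>?I. \<Sum>q\<in>?I. c (int (fst p) - int (fst q)) (int (snd p) - int (snd q)) *
       ((\<Sum>j<K. \<zeta> j powi (n - int (fst p) + int (fst q))) * (\<Sum>k<K. \<zeta> k powi (m - int (snd p) + int (snd q)))))"
    by (intro sum.cong refl, subst sum_distrib_left[symmetric]) (simp only: sum_product sum.cartesian_product case_prod_unfold)
  also have "\<dots> = (\<Sum>p\<in>?I. \<Sum>q\<in>?I. c n m * (of_nat K)\<^sup>2 *
       ((if int (fst p) - int (fst q) = n then 1 else 0) * (if int (snd p) - int (snd q) = m then 1 else 0)))"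
    using n m by (intro sum.cong refl) (auto simp: orth power2_eq_square)
  also have "\<dots> = c n m * (of_nat K)\<^sup>2 * (\<Sum>p\<in>?I. \<Sum>q\<in>?I.
       ((if int (fst p) - int (fst q) = n then 1 else 0) * (if int (snd p) - int (snd q) = m then 1 else 0)))"
    by (simp only: sum_distrib_left)
  also have "(\<Sum>p\<in>?I. \<Sum>q\<in>?I.
       ((if int (fst p) - int (fst q) = n then 1 else 0) * (if int (snd p) - int (snd q) = m then 1 else 0)))
     = (\<Sum>a<N. \<Sum>a'<N. if int a - int a' = n then 1 else 0) * (\<Sum>b<N. \<Sum>b'<N. if int b - int b' = m then 1 else (0::complex))"
    by (rule sum_square_product)
  also have "\<dots> = of_real (real N - \<bar>real_of_int n\<bar>) * of_real (real N - \<bar>real_of_int m\<bar>)"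
    by (simp only: cnt[OF n] cnt[OF m])
  finally have eq: "(\<Sum>(j,k)\<in>{..<K}\<times>{..<K}. complex_of_real ((norm (fejer_vec x N (\<zeta> j) (\<zeta> k)))\<^sup>2) * (\<zeta> j powi n * \<zeta> k powi m))
    = c n m * (of_nat K)\<^sup>2 * (of_real (real N - \<bar>real_of_int n\<bar>) * of_real (real N - \<bar>real_of_int m\<bar>))" .
  have "(\<Sum>(j,k)\<in>{..<K}\<times>{..<K}. ((norm (fejer_vec x N (\<zeta> j) (\<zeta> k)))\<^sup>2 / (real K * real N)\<^sup>2) *\<^sub>R (\<zeta> j powi n * \<zeta> k powi m))
     = (\<Sum>(j,k)\<in>{..<K}\<times>{..<K}. complex_of_real ((norm (fejer_vec x N (\<zeta> j) (\<zeta> k)))\<^sup>2) * (\<zeta> j powi n * \<zeta> k powi m)) / (of_real ((real K * real N)\<^sup>2))"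
    by (simp add: sum_divide_distrib case_prod_beta scaleR_conv_of_real)
  also have "\<dots> = c n m * of_real (((real N - \<bar>real_of_int n\<bar>) / real N) * ((real N - \<bar>real_of_int m\<bar>) / real N))"
    unfolding eq using N by (simp add: K_def field_simps power2_eq_square)
  also have "\<dots> = c n m * of_real ((1 - \<bar>real_of_int n\<bar> / real N) * (1 - \<bar>real_of_int m\<bar> / real N))"
    using N by (simp add: diff_divide_distrib)
  finally show ?thesis .
qed

lemma tendsto_fejer_factor:
  "(\<lambda>i. of_real ((1 - \<bar>real_of_int n\<bar> / real (2 ^ i)) * (1 - \<bar>real_of_int m\<bar> / real (2 ^ i))) :: complex) \<longlonglongrightarrow> 1"
proof -
  have "(\<lambda>i. \<bar>real_of_int n\<bar> / real (2 ^ i)) \<longlonglongrightarrow> 0" for n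
  proof -
    have "(\<lambda>i. \<bar>real_of_int n\<bar> * (1/2) ^ i) \<longlonglongrightarrow> \<bar>real_of_int n\<bar> * 0"
      by (intro tendsto_intros LIMSEQ_power_zero) auto
    then show ?thesis by (simp add: power_divide)
  qed
  note this[of n] this[of m]
  then have "(\<lambda>i. of_real ((1 - \<bar>real_of_int n\<bar> / real (2 ^ i)) * (1 - \<bar>real_of_int m\<bar> / real (2 ^ i))) :: complex)
      \<longlonglongrightarrow> of_real ((1 - 0) * (1 - 0))"
    by (intro tendsto_intros)
  then show ?thesis by simp
qed

text \<open>The discrete measures of the preceding lemma, lifted along the curve to measures on \<open>[0, 1]\<close>,
  are tight; a weak limit of a subsequence has the required moments because the characters composed
  with the curve are bounded and continuous.\<close>

lemma stationary_limit_measure: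
  fixes x :: "int \<Rightarrow> int \<Rightarrow> 'a::chilbert_space"
  assumes st: "stationary x c" and c0: "c 0 0 = 1"
  defines "\<phi> \<equiv> \<lambda>t::real. (cis (2 * pi * schoenberg t), cis (2 * pi * schoenberg (3 * t)))"
  obtains \<nu> where "real_distribution \<nu>" "\<And>n m. (\<integral>t. fst (\<phi> t) powi n * snd (\<phi> t) powi m \<partial>\<nu>) = c n m"
proof -
  \<comment> \<open>Powers of two make the grid points dyadic, hence values of the curve.\<close>
  define K :: "nat \<Rightarrow> nat" where "K i = 2 ^ Suc i" for i
  define \<zeta> where "\<zeta> i j = cis (2 * pi * real j / real (K i))" for i j
  define wt where "wt i = (\<lambda>(j,k). (norm (fejer_vec x (2 ^ i) (\<zeta> i j) (\<zeta> i k)))\<^sup>2 / (real (K i) * real (2 ^ i))\<^sup>2)" for i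
  have "\<forall>i. \<forall>p\<in>{..<K i} \<times> {..<K i}. \<exists>t. t \<in> {0..1} \<and>
      schoenberg t = real (fst p) / real (K i) \<and> schoenberg (3 * t) = real (snd p) / real (K i)"
    using schoenberg_hits_dyadics unfolding K_def by (fastforce simp del: power_Suc)
  then obtain t where t: "\<And>i p. p \<in> {..<K i} \<times> {..<K i} \<Longrightarrow> t i p \<in> {0..1}"
     "\<And>i p. p \<in> {..<K i} \<times> {..<K i} \<Longrightarrow> schoenberg (t i p) = real (fst p) / real (K i)"
     "\<And>i p. p \<in> {..<K i} \<times> {..<K i} \<Longrightarrow> schoenberg (3 * t i p) = real (snd p) / real (K i)"
    by metis
  define \<mu> where "\<mu> i = distr (point_measure ({..<K i} \<times> {..<K i}) (\<lambda>p. ennreal (wt i p))) borel (t i)" for i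
  have wt0: "0 \<le> wt i p" for i p by (auto simp: wt_def split: prod.splits)
  have tm: "t i \<in> measurable (point_measure ({..<K i} \<times> {..<K i}) (\<lambda>p. ennreal (wt i p))) borel" for i
    by (simp add: measurable_point_measure_eq1)
  have int: "integral\<^sup>L (\<mu> i) f = (\<Sum>p\<in>{..<K i} \<times> {..<K i}. wt i p *\<^sub>R f (t i p))"
    if [measurable]: "f \<in> borel_measurable borel" for f :: "real \<Rightarrow> complex" and i
    unfolding \<mu>_def using wt0 by (subst integral_distr[OF tm that], subst lebesgue_integral_point_measure_finite) auto
  have mom: "(\<Sum>p\<in>{..<K i} \<times> {..<K i}. wt i p *\<^sub>R (\<zeta> i (fst p) powi n * \<zeta> i (snd p) powi m)) =
      c n m * of_real ((1 - \<bar>real_of_int n\<bar> / real (2 ^ i)) * (1 - \<bar>real_of_int m\<bar> / real (2 ^ i)))"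
    if "\<bar>n\<bar> \<le> 2 ^ i" "\<bar>m\<bar> \<le> 2 ^ i" for i n m
    using fejer_moments[OF st, of "2 ^ i" n m] that
    by (simp add: wt_def \<zeta>_def K_def case_prod_beta)
  have total: "(\<Sum>p\<in>{..<K i} \<times> {..<K i}. wt i p) = 1" for i
  proof -
    have "complex_of_real (\<Sum>p\<in>{..<K i} \<times> {..<K i}. wt i p) = 1"
      using mom[of 0 i 0] c0 by (simp add: scaleR_conv_of_real)
    then show ?thesis by (metis of_real_eq_1_iff)
  qed
  have em: "emeasure (\<mu> i) A = (\<Sum>p\<in>{p\<in>{..<K i} \<times> {..<K i}. t i p \<in> A}. ennreal (wt i p))" if "A \<in> sets borel" for i A
  proof -
    have "emeasure (\<mu> i) A = emeasure (point_measure ({..<K i} \<times> {..<K i}) (\<lambda>p. ennreal (wt i p))) (t i -` A \<inter> ({..<K i} \<times> {..<K i}))"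
      unfolding \<mu>_def using that by (subst emeasure_distr[OF tm]) (auto simp: space_point_measure)
    also have "\<dots> = (\<Sum>p\<in>t i -` A \<inter> ({..<K i} \<times> {..<K i}). ennreal (wt i p))"
      by (rule emeasure_point_measure_finite2) auto
    also have "t i -` A \<inter> ({..<K i} \<times> {..<K i}) = {p\<in>{..<K i} \<times> {..<K i}. t i p \<in> A}" by auto
    finally show ?thesis .
  qed
  have all: "emeasure (\<mu> i) A = 1" if "A \<in> sets borel" "{0..1} \<subseteq> A" for i A
  proof -
    have "{p\<in>{..<K i} \<times> {..<K i}. t i p \<in> A} = {..<K i} \<times> {..<K i}" using t(1) that by blast
    then show ?thesis using em[OF that(1), of i] wt0 total[of i] by (simp add: sum_ennreal)
  qed
  have rd: "real_distribution (\<mu> i)" for i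
  proof -
    have "prob_space (\<mu> i)" by standard (use all[of UNIV i] in \<open>auto simp: \<mu>_def\<close>)
    then show ?thesis unfolding real_distribution_def real_distribution_axioms_def by (simp add: \<mu>_def)
  qed
  have tight: "tight \<mu>"
    unfolding tight_def
  proof (intro conjI allI impI rd)
    fix \<epsilon> :: real assume "0 < \<epsilon>"
    have "measure (\<mu> i) {-1<..1} = 1" for i using all[of "{-1<..1}" i] by (simp add: measure_def subset_eq)
    then show "\<exists>a b. a < b \<and> (\<forall>n. measure (\<mu> n) {a<..b} > 1 - \<epsilon>)"
      using \<open>0 < \<epsilon>\<close> by (intro exI[of _ "-1"] exI[of _ 1]) auto
  qed
  obtain r \<nu> where r: "strict_mono (r :: nat \<Rightarrow> nat)" "real_distribution \<nu>" "weak_conv_m (\<mu> \<circ> id \<circ> r) \<nu>"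
    using tight_imp_convergent_subsubsequence[OF tight, of id] by (auto simp: strict_mono_def)
  have "(\<integral>t. fst (\<phi> t) powi n * snd (\<phi> t) powi m \<partial>\<nu>) = c n m" for n m
  proof -
    define f where "f t = fst (\<phi> t) powi n * snd (\<phi> t) powi m" for t
    have f_cis: "f = (\<lambda>t. cis (of_int n * (2 * pi * schoenberg t)) * cis (of_int m * (2 * pi * schoenberg (3 * t))))"
      by (simp add: f_def \<phi>_def cis_power_int fun_eq_iff)
    have cs: "continuous_on UNIV (\<lambda>t. schoenberg (3 * t))"
      by (rule continuous_on_compose2[OF continuous_schoenberg]) (auto intro!: continuous_intros)
    have cf: "continuous_on UNIV f"
      unfolding f_cis cis_conv_exp by (intro continuous_intros continuous_schoenberg cs)
    have fm: "f \<in> borel_measurable borel" using cf by (rule borel_measurable_continuous_onI)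
    have "(\<lambda>i. integral\<^sup>L ((\<mu> \<circ> id \<circ> r) i) f) \<longlonglongrightarrow> integral\<^sup>L \<nu> f"
    proof (rule weak_conv_imp_integral_bdd_continuous_conv)
      show "\<And>t. isCont f t" using cf by (simp add: continuous_on_eq_continuous_at)
      show "norm (f t) \<le> 1" for t by (simp add: f_cis norm_mult)
    qed (use rd r in \<open>auto simp: o_def\<close>)
    moreover have "(\<lambda>i. integral\<^sup>L (\<mu> i) f) \<longlonglongrightarrow> c n m"
    proof (rule Lim_transform_eventually)
      show "(\<lambda>i. c n m * of_real ((1 - \<bar>real_of_int n\<bar> / real (2 ^ i)) * (1 - \<bar>real_of_int m\<bar> / real (2 ^ i)))) \<longlonglongrightarrow> c n m"
        using tendsto_mult_left[OF tendsto_fejer_factor, of "c n m" n m] by simp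
      obtain i0 where i0: "nat \<bar>n\<bar> + nat \<bar>m\<bar> < 2 ^ i0"
        using less_exp by blast
      show "\<forall>\<^sub>F i in sequentially. c n m * of_real ((1 - \<bar>real_of_int n\<bar> / real (2 ^ i)) * (1 - \<bar>real_of_int m\<bar> / real (2 ^ i)))
          = integral\<^sup>L (\<mu> i) f"
      proof (rule eventually_sequentiallyI[of i0])
        fix i assume "i0 \<le> i"
        then have "(2::nat) ^ i0 \<le> 2 ^ i" by (rule power_increasing) simp
        then have "nat \<bar>n\<bar> + nat \<bar>m\<bar> \<le> 2 ^ i" using i0 by linarith
        then have "int (nat \<bar>n\<bar> + nat \<bar>m\<bar>) \<le> int (2 ^ i)" by (simp only: of_nat_le_iff)
        then have nm: "\<bar>n\<bar> \<le> 2 ^ i" "\<bar>m\<bar> \<le> 2 ^ i" by auto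
        have "integral\<^sup>L (\<mu> i) f = (\<Sum>p\<in>{..<K i} \<times> {..<K i}. wt i p *\<^sub>R f (t i p))" by (rule int[OF fm])
        also have "\<dots> = (\<Sum>p\<in>{..<K i} \<times> {..<K i}. wt i p *\<^sub>R (\<zeta> i (fst p) powi n * \<zeta> i (snd p) powi m))"
          by (intro sum.cong refl) (simp add: f_def \<phi>_def \<zeta>_def t(2,3))
        finally show "c n m * of_real ((1 - \<bar>real_of_int n\<bar> / real (2 ^ i)) * (1 - \<bar>real_of_int m\<bar> / real (2 ^ i)))
          = integral\<^sup>L (\<mu> i) f" using mom[OF nm] by simp
      qed
    qed
    then have "(\<lambda>i. integral\<^sup>L ((\<mu> \<circ> id \<circ> r) i) f) \<longlonglongrightarrow> c n m"
      using LIMSEQ_subseq_LIMSEQ[OF _ r(1)] by (fastforce simp: o_def)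
    ultimately show ?thesis using LIMSEQ_unique unfolding f_def by blast
  qed
  then show ?thesis using r(2) that by blast
qed

text \<open>This is the theorem of Herglotz and Bochner on the group of pairs of integers. The reduction to
  \<open>c 0 0 = 1\<close> is a rescaling of the vectors and of the measure; the measure itself is the image under
  the curve of the limit found above.\<close>

theorem stationary_measure_exists:
  fixes x :: "int \<Rightarrow> int \<Rightarrow> 'a::chilbert_space"
  assumes st: "stationary x c"
  obtains \<mu> where "sets \<mu> = sets (restrict_space borel torus)" "finite_measure \<mu>"
    "\<And>n m. (\<integral>p. fst p powi n * snd p powi m \<partial>\<mu>) = c n m"
proof (cases "x 0 0 = 0")
  case True
  have "c n m = 0" for n m
    using st True unfolding stationary_def by (metis cinner_zero_right diff_zero)
  moreover have "finite_measure (null_measure (restrict_space borel torus))"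
    by standard simp
  ultimately show ?thesis using that[of "null_measure (restrict_space borel torus)"] by simp
next
  case False
  define r where "r = (norm (x 0 0))\<^sup>2"
  have r: "r > 0" using False by (simp add: r_def)
  have c0: "c 0 0 = of_real r"
    using st cinner_self[of "x 0 0"] unfolding stationary_def r_def by (metis diff_zero)
  have st': "stationary (\<lambda>a b. scaleC (1 / of_real (sqrt r)) (x a b)) (\<lambda>n m. c n m / of_real r)"
  proof -
    have "complex_of_real (sqrt r) * complex_of_real (sqrt r) = of_real r"
      using r by (simp flip: of_real_mult)
    then show ?thesis using st by (simp add: stationary_def cinner_simps field_simps)
  qed
  have "c 0 0 / of_real r = 1" using c0 r by simp
  from stationary_limit_measure[OF st' this] obtain \<nu> where \<nu>: "real_distribution \<nu>"
    "\<And>n m. (\<integral>t. fst (cis (2 * pi * schoenberg t), cis (2 * pi * schoenberg (3 * t))) powi n *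
        snd (cis (2 * pi * schoenberg t), cis (2 * pi * schoenberg (3 * t))) powi m \<partial>\<nu>) = c n m / of_real r"
    by blast
  define \<phi> where "\<phi> t = (cis (2 * pi * schoenberg t), cis (2 * pi * schoenberg (3 * t)))" for t
  interpret \<nu>: real_distribution \<nu> by fact
  have cs: "continuous_on UNIV (\<lambda>t. schoenberg (3 * t))"
    by (rule continuous_on_compose2[OF continuous_schoenberg]) (auto intro!: continuous_intros)
  have "continuous_on UNIV \<phi>"
    unfolding \<phi>_def cis_conv_exp by (intro continuous_intros continuous_schoenberg cs)
  then have "\<phi> \<in> borel_measurable borel" by (rule borel_measurable_continuous_onI)
  then have \<phi>m: "\<phi> \<in> measurable \<nu> (restrict_space borel torus)"
    by (intro measurable_restrict_space2) (auto simp: \<phi>_def)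
  define \<rho> where "\<rho> = distr \<nu> (restrict_space borel torus) \<phi>"
  define \<mu> where "\<mu> = density \<rho> (\<lambda>_. ennreal r)"
  have fin: "finite_measure \<rho>" unfolding \<rho>_def by (rule \<nu>.finite_measure_distr[OF \<phi>m])
  have "finite_measure \<mu>"
    by standard (use finite_measure.emeasure_finite[OF fin] in \<open>auto simp: \<mu>_def emeasure_density ennreal_mult_eq_top_iff\<close>)
  moreover have "sets \<mu> = sets (restrict_space borel torus)" by (simp add: \<mu>_def \<rho>_def)
  moreover have "(\<integral>p. fst p powi n * snd p powi m \<partial>\<mu>) = c n m" for n m
  proof -
    have mm: "(\<lambda>p::complex\<times>complex. fst p powi n * snd p powi m) \<in> borel_measurable (restrict_space borel torus)"
      by (intro borel_measurable_continuous_on_restrict continuous_intros) auto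
    have "(\<integral>p. fst p powi n * snd p powi m \<partial>\<mu>) = (\<integral>p. r *\<^sub>R (fst p powi n * snd p powi m) \<partial>\<rho>)"
      unfolding \<mu>_def using r mm by (subst integral_density) (auto simp: \<rho>_def)
    also have "\<dots> = r *\<^sub>R (\<integral>p. fst p powi n * snd p powi m \<partial>\<rho>)" by simp
    also have "(\<integral>p. fst p powi n * snd p powi m \<partial>\<rho>) = c n m / of_real r"
      unfolding \<rho>_def by (subst integral_distr[OF \<phi>m mm]) (use \<nu>(2) in \<open>simp add: \<phi>_def\<close>)
    finally show ?thesis using r by (simp add: scaleR_conv_of_real)
  qed
  ultimately show ?thesis using that by blast
qed

section \<open>Density in \<open>L\<^sup>1\<close> and sums of measures\<close>

text \<open>The set \<open>P\<close> stands for the trigonometric polynomials on the circle or on the torus. Products and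
  coordinate functions are only required to lie in \<open>P\<close> up to their values outside of \<open>S\<close>, because
  laws such as \<open>s\<^sup>n s\<^sup>m = s\<^sup>n\<^sup>+\<^sup>m\<close> for integer exponents fail at \<open>s = 0\<close>.\<close>

locale dense_functions =
  fixes S :: "'a::euclidean_space set" and P :: "('a \<Rightarrow> complex) set"
  assumes S_compact: "compact S"
    and P_cont: "f \<in> P \<Longrightarrow> continuous_on S f"
    and P_const: "(\<lambda>_. c) \<in> P"
    and P_add: "f \<in> P \<Longrightarrow> g \<in> P \<Longrightarrow> (\<lambda>x. f x + g x) \<in> P"
    and P_mult: "f \<in> P \<Longrightarrow> g \<in> P \<Longrightarrow> \<exists>h\<in>P. \<forall>x\<in>S. h x = f x * g x"
    and P_coord: "b \<in> Basis \<Longrightarrow> \<exists>h\<in>P. \<forall>x\<in>S. h x = of_real (x \<bullet> b)"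
begin

lemma P_scale: "f \<in> P \<Longrightarrow> \<exists>h\<in>P. \<forall>x\<in>S. h x = c * f x"
  using P_mult[OF P_const] by blast

lemma P_sum:
  assumes "\<And>i. i \<in> I \<Longrightarrow> \<exists>h\<in>P. \<forall>x\<in>S. h x = F i x"
  shows "\<exists>h\<in>P. \<forall>x\<in>S. h x = (\<Sum>i\<in>I. F i x)"
  using assms
proof (induction I rule: infinite_finite_induct)
  case (insert i I)
  obtain h where h: "h \<in> P" "\<forall>x\<in>S. h x = (\<Sum>i\<in>I. F i x)" using insert by auto
  obtain g where g: "g \<in> P" "\<forall>x\<in>S. g x = F i x" using insert.prems[of i] by auto
  show ?case using P_add[OF g(1) h(1)] g h insert by (intro bexI[of _ "\<lambda>x. g x + h x"]) auto
qed (use P_const[of 0] in auto)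

text \<open>A linear functional is a combination of coordinates; sums and products of real polynomial
  functions are then imitated inside \<open>P\<close>.\<close>

lemma P_polynomial:
  assumes "real_polynomial_function f" shows "\<exists>h\<in>P. \<forall>x\<in>S. h x = of_real (f x)"
  using assms
proof (induction rule: real_polynomial_function.induct)
  case (linear f)
  have "f x = (\<Sum>b\<in>Basis. (x \<bullet> b) * f b)" for x
  proof -
    have "f x = f (\<Sum>b\<in>Basis. (x \<bullet> b) *\<^sub>R b)" by (simp add: euclidean_representation)
    also have "\<dots> = (\<Sum>b\<in>Basis. (x \<bullet> b) * f b)"
      using linear by (simp add: linear_sum linear_scale bounded_linear.linear)
    finally show ?thesis .
  qed
  then have eq: "complex_of_real (f x) = (\<Sum>b\<in>Basis. of_real (f b) * of_real (x \<bullet> b))" for x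
    by (metis (no_types, lifting) mult.commute of_real_mult of_real_sum sum.cong)
  have "\<exists>h\<in>P. \<forall>x\<in>S. h x = of_real (f b) * of_real (x \<bullet> b)" if "b \<in> Basis" for b
    using P_coord[OF that] P_scale by metis
  then obtain h where "h \<in> P" "\<forall>x\<in>S. h x = (\<Sum>b\<in>Basis. of_real (f b) * of_real (x \<bullet> b))"
    using P_sum[of Basis "\<lambda>b x. of_real (f b) * of_real (x \<bullet> b)"] by blast
  then have "h x = of_real (f x)" if "x \<in> S" for x using that by (subst eq) blast
  with \<open>h \<in> P\<close> show ?case by blast
next
  case (add f g)
  then obtain h1 h2 where h: "h1 \<in> P" "\<forall>x\<in>S. h1 x = of_real (f x)" "h2 \<in> P" "\<forall>x\<in>S. h2 x = of_real (g x)" by blast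
  then show ?case using P_add[OF h(1,3)] by (intro bexI[of _ "\<lambda>x. h1 x + h2 x"]) auto
next
  case (mult f g)
  then obtain h1 h2 where h: "h1 \<in> P" "\<forall>x\<in>S. h1 x = of_real (f x)" "h2 \<in> P" "\<forall>x\<in>S. h2 x = of_real (g x)" by blast
  then show ?case using P_mult[OF h(1,3)] by auto
qed (use P_const in auto)

context
  fixes \<nu> :: "'a measure"
  assumes sets_nu: "sets \<nu> = sets (restrict_space borel S)" and fin_nu: "finite_measure \<nu>"
begin

interpretation \<nu>: finite_measure \<nu> by (rule fin_nu)

lemma space_nu: "space \<nu> = S"
  using sets_eq_imp_space_eq[OF sets_nu] by (simp add: space_restrict_space)

lemma measurable_cont: "continuous_on S f \<Longrightarrow> f \<in> borel_measurable \<nu>"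
  for f :: "'a \<Rightarrow> 'b::topological_space"
  using borel_measurable_continuous_on_restrict[of S f] measurable_cong_sets[OF sets_nu refl] by blast

lemma integrable_cont: 
  fixes f :: "'a \<Rightarrow> complex"
  assumes "continuous_on S f" shows "integrable \<nu> f"
proof -
  obtain B where "\<And>x. x \<in> S \<Longrightarrow> norm (f x) \<le> B"
    using compact_imp_bounded[OF compact_continuous_image[OF assms S_compact]] by (auto simp: bounded_iff)
  then show ?thesis
    by (intro \<nu>.integrable_const_bound[of _ B] measurable_cont assms) (auto simp: space_nu)
qed

lemma integrable_P: "g \<in> P \<Longrightarrow> integrable \<nu> g"
  by (intro integrable_cont P_cont)

definition approximable :: "('a \<Rightarrow> complex) \<Rightarrow> bool" where
  "approximable f \<longleftrightarrow> integrable \<nu> f \<and> (\<forall>e>0. \<exists>g\<in>P. (\<integral>x. norm (f x - g x) \<partial>\<nu>) < e)"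

lemma approximable_lim:
  assumes f: "integrable \<nu> f" and "\<And>i. approximable (s i)" and "(\<lambda>i. \<integral>x. norm (f x - s i x) \<partial>\<nu>) \<longlonglongrightarrow> 0"
  shows "approximable f"
  unfolding approximable_def
proof (intro conjI f allI impI)
  fix e :: real assume e: "e > 0"
  then obtain i where i: "(\<integral>x. norm (f x - s i x) \<partial>\<nu>) < e / 2"
    using order_tendstoD(2)[OF assms(3), of "e/2"] by (auto simp: eventually_sequentially)
  obtain g where g: "g \<in> P" "(\<integral>x. norm (s i x - g x) \<partial>\<nu>) < e / 2" and si: "integrable \<nu> (s i)"
    using assms(2)[of i] e unfolding approximable_def by (meson half_gt_zero)
  have "(\<integral>x. norm (f x - g x) \<partial>\<nu>) \<le> (\<integral>x. norm (f x - s i x) + norm (s i x - g x) \<partial>\<nu>)"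
    using f si integrable_P[OF g(1)]
    by (intro integral_mono) (auto intro: norm_triangle_sub order_trans[OF _ norm_triangle_ineq])
  also have "\<dots> = (\<integral>x. norm (f x - s i x) \<partial>\<nu>) + (\<integral>x. norm (s i x - g x) \<partial>\<nu>)"
    using f si integrable_P[OF g(1)] by simp
  finally show "\<exists>g\<in>P. (\<integral>x. norm (f x - g x) \<partial>\<nu>) < e" using g i by (intro bexI[of _ g]) auto
qed

lemma approximable_cont:
  assumes "continuous_on S f" shows "approximable (\<lambda>x. complex_of_real (f x))"
  unfolding approximable_def
proof (intro conjI integrable_cont allI impI)
  show c: "continuous_on S (\<lambda>x. complex_of_real (f x))" using assms by (intro continuous_intros)
  fix e :: real assume e: "e > 0"
  define d where "d = e / (measure \<nu> S + 1)"
  have mp: "0 < measure \<nu> S + 1" by (simp add: add_nonneg_pos)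
  have d: "d > 0" "d * measure \<nu> S < e" using e mp by (simp_all add: d_def divide_less_eq algebra_simps)
  obtain p where p: "real_polynomial_function p" "\<And>x. x \<in> S \<Longrightarrow> \<bar>f x - p x\<bar> < d"
    using Stone_Weierstrass_real_polynomial_function[OF S_compact assms d(1)] by blast
  obtain g where g: "g \<in> P" "\<forall>x\<in>S. g x = of_real (p x)" using P_polynomial[OF p(1)] by blast
  have "(\<integral>x. norm (complex_of_real (f x) - g x) \<partial>\<nu>) \<le> (\<integral>x. d \<partial>\<nu>)"
  proof (rule integral_mono)
    show "integrable \<nu> (\<lambda>x. norm (complex_of_real (f x) - g x))"
      using integrable_cont[OF c] integrable_P[OF g(1)] by simp
    fix x assume "x \<in> space \<nu>"
    then have "x \<in> S" by (simp add: space_nu)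
    then show "norm (complex_of_real (f x) - g x) \<le> d" using p(2)[of x] g(2)
      by (simp flip: of_real_diff add: less_imp_le)
  qed simp
  also have "\<dots> = d * measure \<nu> S" by (simp add: space_nu)
  finally show "\<exists>g\<in>P. (\<integral>x. norm (complex_of_real (f x) - g x) \<partial>\<nu>) < e" using g d by (intro bexI[of _ g]) auto
qed

lemma approximable_dominated:
  assumes "f \<in> borel_measurable \<nu>" "\<And>i. approximable (s i)" "integrable \<nu> w"
    and lim: "\<And>x. x \<in> S \<Longrightarrow> (\<lambda>i. s i x) \<longlonglongrightarrow> f x" and bound: "\<And>i x. x \<in> S \<Longrightarrow> norm (s i x) \<le> (w x :: real)"
  shows "approximable f"
proof -
  have sm[measurable]: "s i \<in> borel_measurable \<nu>" for i
    using assms(2)[of i] unfolding approximable_def by (auto intro: borel_measurable_integrable)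
  have fb: "norm (f x) \<le> w x" if "x \<in> S" for x
    using tendsto_norm[OF lim[OF that]] bound[OF that] by (intro LIMSEQ_le_const2) auto
  have f: "integrable \<nu> f"
    by (rule Bochner_Integration.integrable_bound[OF assms(3,1)]) (use fb in \<open>force simp: space_nu intro!: AE_I2\<close>)
  have lim': "(\<lambda>i. \<integral>x. norm (f x - s i x) \<partial>\<nu>) \<longlonglongrightarrow> (\<integral>x. 0 \<partial>\<nu>)"
  proof (rule integral_dominated_convergence[where w = "\<lambda>x. 2 * w x"])
    show "AE x in \<nu>. (\<lambda>i. norm (f x - s i x)) \<longlonglongrightarrow> 0"
    proof (rule AE_I2)
      fix x assume "x \<in> space \<nu>"
      then have "(\<lambda>i. norm (f x - s i x)) \<longlonglongrightarrow> norm (f x - f x)"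
        by (intro tendsto_intros lim) (simp add: space_nu)
      then show "(\<lambda>i. norm (f x - s i x)) \<longlonglongrightarrow> 0" by simp
    qed
    show "AE x in \<nu>. norm (norm (f x - s i x)) \<le> 2 * w x" for i
    proof (rule AE_I2)
      fix x assume "x \<in> space \<nu>"
      then show "norm (norm (f x - s i x)) \<le> 2 * w x"
        using fb[of x] bound[of x i] norm_triangle_ineq4[of "f x" "s i x"] by (simp add: space_nu)
    qed
  qed (use assms in auto)
  show ?thesis by (rule approximable_lim[OF f assms(2)]) (use lim' in simp)
qed

lemma approximable_closed:
  assumes "closed C" shows "approximable (indicator (C \<inter> S))"
proof (cases "C = {}")
  case True
  then show ?thesis using approximable_cont[of "\<lambda>_. 0"] by (simp add: indicator_def[abs_def])
next
  case False
  define s where "s n x = max 0 (1 - real n * infdist x C)" for n x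
  have "C \<inter> S \<in> sets \<nu>" using assms by (auto simp: sets_nu sets_restrict_space)
  then have "(indicator (C \<inter> S) :: 'a \<Rightarrow> complex) \<in> borel_measurable \<nu>" by simp
  then show ?thesis
  proof (rule approximable_dominated[where w = "\<lambda>_. 1"])
    have "continuous_on S (s n)" for n unfolding s_def by (intro continuous_intros)
    then show "approximable (\<lambda>x. complex_of_real (s n x))" for n by (rule approximable_cont)
    show "norm (complex_of_real (s n x)) \<le> 1" for n x by (simp add: s_def infdist_nonneg)
    fix x assume xS: "x \<in> S"
    show "(\<lambda>n. complex_of_real (s n x)) \<longlonglongrightarrow> indicator (C \<inter> S) x"
    proof (cases "x \<in> C")
      case True
      then show ?thesis using xS by (simp add: s_def)
    next
      case F: False
      then have d: "infdist x C > 0"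
        using assms False by (metis infdist_nonneg in_closed_iff_infdist_zero less_eq_real_def)
      obtain n0 where "1 / infdist x C < real n0" using reals_Archimedean2 by blast
      then have n0: "1 < real n0 * infdist x C" using d by (simp add: field_simps)
      have "s n x = 0" if "n \<ge> n0" for n
      proof -
        have "real n0 * infdist x C \<le> real n * infdist x C" using that d by (intro mult_right_mono) auto
        then show ?thesis using n0 by (simp add: s_def)
      qed
      then show ?thesis using F by (intro tendsto_eventually eventually_sequentiallyI[of n0]) auto
    qed
  qed simp
qed

lemma approximable_add:
  assumes "approximable f" "approximable g" shows "approximable (\<lambda>x. f x + g x)"
  unfolding approximable_def
proof (intro conjI allI impI)
  show i: "integrable \<nu> (\<lambda>x. f x + g x)" using assms by (simp add: approximable_def)
  fix e :: real assume e: "e > 0"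
  obtain f' where f': "f' \<in> P" "(\<integral>x. norm (f x - f' x) \<partial>\<nu>) < e / 2" and fi: "integrable \<nu> f"
    using assms(1) e unfolding approximable_def by (meson half_gt_zero)
  obtain g' where g': "g' \<in> P" "(\<integral>x. norm (g x - g' x) \<partial>\<nu>) < e / 2" and gi: "integrable \<nu> g"
    using assms(2) e unfolding approximable_def by (meson half_gt_zero)
  have "(\<integral>x. norm (f x + g x - (f' x + g' x)) \<partial>\<nu>) \<le> (\<integral>x. norm (f x - f' x) + norm (g x - g' x) \<partial>\<nu>)"
    using fi gi integrable_P[OF f'(1)] integrable_P[OF g'(1)]
    by (intro integral_mono) (auto intro: norm_diff_triangle_ineq)
  also have "\<dots> = (\<integral>x. norm (f x - f' x) \<partial>\<nu>) + (\<integral>x. norm (g x - g' x) \<partial>\<nu>)"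
    using fi gi integrable_P[OF f'(1)] integrable_P[OF g'(1)] by simp
  finally show "\<exists>h\<in>P. (\<integral>x. norm (f x + g x - h x) \<partial>\<nu>) < e"
    using f' g' P_add by (intro bexI[of _ "\<lambda>x. f' x + g' x"]) auto
qed

lemma approximable_scale:
  assumes "approximable f" shows "approximable (\<lambda>x. c * f x)"
  unfolding approximable_def
proof (intro conjI allI impI)
  show i: "integrable \<nu> (\<lambda>x. c * f x)" using assms by (simp add: approximable_def)
  fix e :: real assume e: "e > 0"
  define d where "d = e / (norm c + 1)"
  have d: "d > 0" using e by (auto simp: d_def intro!: divide_pos_pos add_nonneg_pos)
  obtain f' where f': "f' \<in> P" "(\<integral>x. norm (f x - f' x) \<partial>\<nu>) < d"
    using assms(1) d unfolding approximable_def by blast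
  obtain h where h: "h \<in> P" "\<forall>x\<in>S. h x = c * f' x" using P_scale f' by blast
  have "(\<integral>x. norm (c * f x - h x) \<partial>\<nu>) = (\<integral>x. norm c * norm (f x - f' x) \<partial>\<nu>)"
    using h by (intro Bochner_Integration.integral_cong) (auto simp: space_nu norm_mult[symmetric] algebra_simps)
  also have "\<dots> = norm c * (\<integral>x. norm (f x - f' x) \<partial>\<nu>)" by simp
  also have "\<dots> \<le> norm c * d" using f' by (intro mult_left_mono) auto
  also have "\<dots> < (norm c + 1) * d" using d by (simp add: algebra_simps)
  also have "\<dots> = e" by (simp add: d_def add_nonneg_eq_0_iff)
  finally show "\<exists>h\<in>P. (\<integral>x. norm (c * f x - h x) \<partial>\<nu>) < e" using h by blast
qed

lemma sets_generated: "sets \<nu> = sigma_sets S ((\<inter>) S ` Collect closed)"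
proof -
  have "sets (borel :: 'a measure) = sigma_sets UNIV (Collect closed)"
    unfolding borel_eq_closed by simp
  moreover have "S \<in> sigma_sets UNIV (Collect closed)"
    using S_compact by (intro sigma_sets.Basic) (auto intro: compact_imp_closed)
  ultimately show ?thesis
    by (simp add: sets_nu sets_restrict_space sigma_sets_Int)
qed

lemma approximable_cong:
  assumes "approximable f" "\<And>x. x \<in> S \<Longrightarrow> f x = g x" shows "approximable g"
proof -
  have "integrable \<nu> f \<longleftrightarrow> integrable \<nu> g"
    by (rule Bochner_Integration.integrable_cong) (auto simp: space_nu assms(2))
  moreover have "(\<integral>x. norm (f x - h x) \<partial>\<nu>) = (\<integral>x. norm (g x - h x) \<partial>\<nu>)" for h
    by (rule Bochner_Integration.integral_cong) (auto simp: space_nu assms(2))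
  ultimately show ?thesis using assms(1) by (simp add: approximable_def)
qed

lemma approximable_indicator:
  assumes "A \<in> sets \<nu>" shows "approximable (indicator A)"
proof -
  have zero: "approximable (indicator {})"
    using approximable_cont[of "\<lambda>_. 0"] by (simp add: indicator_def[abs_def])
  have "Int_stable ((\<inter>) S ` Collect closed)"
  proof (rule Int_stableI)
    fix A B assume "A \<in> (\<inter>) S ` Collect closed" "B \<in> (\<inter>) S ` Collect closed"
    then obtain C D where "A = S \<inter> C" "B = S \<inter> D" "closed C" "closed D" by auto
    then have "A \<inter> B = S \<inter> (C \<inter> D)" "closed (C \<inter> D)" by auto
    then show "A \<inter> B \<in> (\<inter>) S ` Collect closed" by blast
  qed
  moreover have "(\<inter>) S ` Collect closed \<subseteq> Pow S" by auto
  moreover have "A \<in> sigma_sets S ((\<inter>) S ` Collect closed)" using assms sets_generated by simp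
  ultimately show ?thesis
  proof (induction rule: sigma_sets_induct_disjoint)
    case (basic A) then show ?case using approximable_closed by (auto simp: Int_commute)
  next
    case empty show ?case by (rule zero)
  next
    case (compl A)
    have "approximable (\<lambda>x. of_real 1 + (-1) * indicator A x)"
      by (intro approximable_add approximable_scale compl approximable_cont) auto
    then show ?case by (rule approximable_cong) (auto simp: indicator_def)
  next
    case (union A)
    have fin: "approximable (indicator (\<Union>i<n. A i))" for n
    proof (induction n)
      case (Suc n)
      have "A n \<inter> A i = {}" if "i < n" for i
        using disjoint_family_onD[OF union(1), of n i] that by simp
      then have "A n \<inter> (\<Union>i<n. A i) = {}" by blast
      moreover have "approximable (\<lambda>x. indicator (\<Union>i<n. A i) x + indicator (A n) x)"
        by (intro approximable_add Suc union)
      moreover have "indicator (\<Union>i<n. A i) x + indicator (A n) x = (indicator (\<Union>i<Suc n. A i) x :: complex)" for x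
        using \<open>A n \<inter> (\<Union>i<n. A i) = {}\<close> indicator_add[of "\<Union>i<n. A i" "A n" x]
        unfolding lessThan_Suc UN_insert by (simp add: Int_commute Un_commute)
      ultimately show ?case by (simp only:)
    qed (use approximable_cont[of "\<lambda>_. 0"] in simp)
    have "(\<Union>i. A i) \<in> sets \<nu>" unfolding sets_generated using union(2) by (intro sigma_sets.Union) auto
    then have "(indicator (\<Union>i. A i) :: 'a \<Rightarrow> complex) \<in> borel_measurable \<nu>" by simp
    then show ?case
    proof (rule approximable_dominated[OF _ fin])
      show "(\<lambda>n. indicator (\<Union>i<n. A i) x) \<longlonglongrightarrow> (indicator (\<Union>i. A i) x :: complex)" for x
        by (rule LIMSEQ_indicator_UN)
      show "norm (indicator (\<Union>i<n. A i) x :: complex) \<le> 1" for n x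
        by (cases "x \<in> (\<Union>i<n. A i)") (simp_all only: indicator_simps, simp_all)
    qed simp
  qed
qed

text \<open>Density in \<open>L\<^sup>1\<close>: continuous functions are uniform limits of functions in \<open>P\<close> by Stone-Weierstrass,
  indicators of closed sets are limits of continuous functions, and the rest is measure theory.\<close>

lemma integrable_approximable:
  assumes "integrable \<nu> f" shows "approximable f"
  using assms
proof (induction f rule: integrable_induct)
  case (base A c)
  have "approximable (\<lambda>x. c * indicator A x)" by (intro approximable_scale approximable_indicator base)
  then show ?case by (rule approximable_cong) (auto simp: indicator_def)
next
  case (add f g)
  then show ?case by (intro approximable_add)
next
  case (lim f s)
  then show ?case
    by (intro approximable_dominated[of f s "\<lambda>x. 2 * norm (f x)"]) (auto simp: space_nu)
qed

lemma P_dense: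
  assumes "integrable \<nu> f" "e > 0" obtains g where "g \<in> P" "(\<integral>x. norm (f x - g x) \<partial>\<nu>) < e"
  using integrable_approximable[OF assms(1)] assms(2) unfolding approximable_def by blast

end

end

text \<open>A sum of arbitrarily many measures; it dominates each of its terms, so an approximation in its
  \<open>L\<^sup>1\<close>-norm is an approximation for all the terms at once.\<close>

definition sum_measure :: "'i set \<Rightarrow> ('i \<Rightarrow> 'a measure) \<Rightarrow> 'a measure \<Rightarrow> 'a measure" where
  "sum_measure I \<mu> R = measure_of (space R) (sets R) (\<lambda>A. \<integral>\<^sup>+i. emeasure (\<mu> i) A \<partial>count_space I)"

lemma sets_sum_measure [simp]: "sets (sum_measure I \<mu> R) = sets R"
  by (simp add: sum_measure_def)

lemma space_sum_measure [simp]: "space (sum_measure I \<mu> R) = space R"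
  by (simp add: sum_measure_def)

context
  fixes I :: "'i set" and \<mu> :: "'i \<Rightarrow> 'a measure" and R :: "'a measure"
  assumes sets_mu: "\<And>i. i \<in> I \<Longrightarrow> sets (\<mu> i) = sets R"
begin

lemma emeasure_sum_measure:
  assumes "A \<in> sets R"
  shows "emeasure (sum_measure I \<mu> R) A = (\<integral>\<^sup>+i. emeasure (\<mu> i) A \<partial>count_space I)"
proof (rule emeasure_measure_of[OF sum_measure_def])
  show "countably_additive (sets (sum_measure I \<mu> R)) (\<lambda>A. \<integral>\<^sup>+i. emeasure (\<mu> i) A \<partial>count_space I)"
  proof (rule countably_additiveI)
    fix B :: "nat \<Rightarrow> 'a set" assume B: "range B \<subseteq> sets (sum_measure I \<mu> R)" "disjoint_family B"
    have "(\<Sum>n. \<integral>\<^sup>+i. emeasure (\<mu> i) (B n) \<partial>count_space I) = (\<integral>\<^sup>+i. (\<Sum>n. emeasure (\<mu> i) (B n)) \<partial>count_space I)"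
      by (rule nn_integral_suminf[symmetric]) simp
    also have "\<dots> = (\<integral>\<^sup>+i. emeasure (\<mu> i) (\<Union>n. B n) \<partial>count_space I)"
      using B sets_mu by (intro nn_integral_cong suminf_emeasure) auto
    finally show "(\<Sum>n. \<integral>\<^sup>+i. emeasure (\<mu> i) (B n) \<partial>count_space I) = (\<integral>\<^sup>+i. emeasure (\<mu> i) (\<Union>n. B n) \<partial>count_space I)" .
  qed
qed (use assms sets.space_closed in \<open>auto simp: positive_def\<close>)

lemma borel_measurable_sum_measure:
  "borel_measurable (sum_measure I \<mu> R) = borel_measurable R"
  "i \<in> I \<Longrightarrow> borel_measurable (\<mu> i) = borel_measurable R"
  by (rule measurable_cong_sets; simp add: sets_mu)+

text \<open>By induction on the integrand: both sides are additive and homogeneous and commute with suprema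
  of increasing sequences, and for indicators the equation is the definition.\<close>

lemma nn_integral_sum_measure:
  assumes "f \<in> borel_measurable R"
  shows "(\<integral>\<^sup>+x. f x \<partial>sum_measure I \<mu> R) = (\<integral>\<^sup>+i. \<integral>\<^sup>+x. f x \<partial>\<mu> i \<partial>count_space I)"
proof -
  have sp: "i \<in> I \<Longrightarrow> space (\<mu> i) = space R" for i using sets_eq_imp_space_eq[OF sets_mu] by simp
  show ?thesis using assms
  proof (induction f rule: borel_measurable_induct)
    case (cong f g)
    have "(\<integral>\<^sup>+x. f x \<partial>sum_measure I \<mu> R) = (\<integral>\<^sup>+x. g x \<partial>sum_measure I \<mu> R)"
      by (rule nn_integral_cong) (use cong in auto)
    moreover have "(\<integral>\<^sup>+i. \<integral>\<^sup>+x. f x \<partial>\<mu> i \<partial>count_space I) = (\<integral>\<^sup>+i. \<integral>\<^sup>+x. g x \<partial>\<mu> i \<partial>count_space I)"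
      by (intro nn_integral_cong) (use cong sp in auto)
    ultimately show ?case using cong by simp
  next
    case (set A)
    have "(\<integral>\<^sup>+i. \<integral>\<^sup>+x. indicator A x \<partial>\<mu> i \<partial>count_space I) = (\<integral>\<^sup>+i. emeasure (\<mu> i) A \<partial>count_space I)"
      using set sets_mu by (intro nn_integral_cong nn_integral_indicator) auto
    then show ?case using set by (simp add: emeasure_sum_measure)
  next
    case (mult u c)
    have "(\<integral>\<^sup>+i. \<integral>\<^sup>+x. c * u x \<partial>\<mu> i \<partial>count_space I) = (\<integral>\<^sup>+i. c * (\<integral>\<^sup>+x. u x \<partial>\<mu> i) \<partial>count_space I)"
      using mult by (intro nn_integral_cong nn_integral_cmult) (auto simp: borel_measurable_sum_measure)
    moreover have "(\<integral>\<^sup>+x. c * u x \<partial>sum_measure I \<mu> R) = c * (\<integral>\<^sup>+x. u x \<partial>sum_measure I \<mu> R)"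
      using mult by (intro nn_integral_cmult) (simp add: borel_measurable_sum_measure)
    moreover have "(\<integral>\<^sup>+i. c * (\<integral>\<^sup>+x. u x \<partial>\<mu> i) \<partial>count_space I) = c * (\<integral>\<^sup>+i. (\<integral>\<^sup>+x. u x \<partial>\<mu> i) \<partial>count_space I)"
      by (intro nn_integral_cmult) simp
    ultimately show ?case using mult by simp
  next
    case (add u v)
    have "(\<integral>\<^sup>+i. \<integral>\<^sup>+x. v x + u x \<partial>\<mu> i \<partial>count_space I) = (\<integral>\<^sup>+i. (\<integral>\<^sup>+x. v x \<partial>\<mu> i) + (\<integral>\<^sup>+x. u x \<partial>\<mu> i) \<partial>count_space I)"
      using add by (intro nn_integral_cong nn_integral_add) (auto simp: borel_measurable_sum_measure)
    moreover have "(\<integral>\<^sup>+x. v x + u x \<partial>sum_measure I \<mu> R) = (\<integral>\<^sup>+x. v x \<partial>sum_measure I \<mu> R) + (\<integral>\<^sup>+x. u x \<partial>sum_measure I \<mu> R)"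
      using add by (intro nn_integral_add) (simp_all add: borel_measurable_sum_measure)
    moreover have "(\<integral>\<^sup>+i. (\<integral>\<^sup>+x. v x \<partial>\<mu> i) + (\<integral>\<^sup>+x. u x \<partial>\<mu> i) \<partial>count_space I)
        = (\<integral>\<^sup>+i. (\<integral>\<^sup>+x. v x \<partial>\<mu> i) \<partial>count_space I) + (\<integral>\<^sup>+i. (\<integral>\<^sup>+x. u x \<partial>\<mu> i) \<partial>count_space I)"
      by (intro nn_integral_add) simp_all
    ultimately show ?case using add by simp
  next
    case (seq U)
    have e: "Sup (range U) x = (SUP n. U n x)" for x by (simp add: image_comp)
    have "(\<integral>\<^sup>+x. (SUP n. U n x) \<partial>sum_measure I \<mu> R) = (SUP n. \<integral>\<^sup>+x. U n x \<partial>sum_measure I \<mu> R)"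
      using seq by (intro nn_integral_monotone_convergence_SUP) (auto simp: borel_measurable_sum_measure)
    also have "\<dots> = (SUP n. \<integral>\<^sup>+i. \<integral>\<^sup>+x. U n x \<partial>\<mu> i \<partial>count_space I)" using seq by simp
    also have "\<dots> = (\<integral>\<^sup>+i. (SUP n. \<integral>\<^sup>+x. U n x \<partial>\<mu> i) \<partial>count_space I)"
      using \<open>incseq U\<close> by (intro nn_integral_monotone_convergence_SUP[symmetric])
        (auto simp: incseq_def le_fun_def intro!: nn_integral_mono)
    also have "\<dots> = (\<integral>\<^sup>+i. \<integral>\<^sup>+x. (SUP n. U n x) \<partial>\<mu> i \<partial>count_space I)"
      using seq by (intro nn_integral_cong nn_integral_monotone_convergence_SUP[symmetric]) (auto simp: borel_measurable_sum_measure)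
    finally show ?case unfolding e .
  qed
qed

lemma integral_le_sum_measure:
  assumes fin: "finite_measure (sum_measure I \<mu> R)" and h: "h \<in> borel_measurable R" "\<And>x. x \<in> space R \<Longrightarrow> norm (h x :: complex) \<le> B"
    and F: "finite F" "F \<subseteq> I"
  shows "(\<Sum>i\<in>F. \<integral>x. norm (h x) \<partial>\<mu> i) \<le> (\<integral>x. norm (h x) \<partial>sum_measure I \<mu> R)"
proof -
  interpret s: finite_measure "sum_measure I \<mu> R" by fact
  have nm: "(\<lambda>x. ennreal (norm (h x))) \<in> borel_measurable R" using h by measurable
  have ints: "integrable (sum_measure I \<mu> R) h"
    using h by (intro s.integrable_const_bound[of _ B]) (auto simp: borel_measurable_sum_measure)
  have le: "(\<integral>x. norm (h x) \<partial>\<mu> i) = enn2real (\<integral>\<^sup>+x. norm (h x) \<partial>\<mu> i)" if "i \<in> I" for i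
  proof (rule integral_eq_nn_integral)
    show "(\<lambda>x. norm (h x)) \<in> borel_measurable (\<mu> i)"
      unfolding borel_measurable_sum_measure(2)[OF that] using h(1) by measurable
  qed simp
  have tot: "(\<integral>\<^sup>+i. \<integral>\<^sup>+x. norm (h x) \<partial>\<mu> i \<partial>count_space I) = ennreal (\<integral>x. norm (h x) \<partial>sum_measure I \<mu> R)"
    using nn_integral_sum_measure[OF nm] ints by (simp add: nn_integral_eq_integral)
  have "(\<Sum>i\<in>F. \<integral>\<^sup>+x. norm (h x) \<partial>\<mu> i) = (\<integral>\<^sup>+i. (\<integral>\<^sup>+x. norm (h x) \<partial>\<mu> i) * indicator F i \<partial>count_space I)"
    using F by (subst nn_integral_count_space'[of F]) (auto simp: indicator_def)
  also have "\<dots> \<le> (\<integral>\<^sup>+i. \<integral>\<^sup>+x. norm (h x) \<partial>\<mu> i \<partial>count_space I)"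
    by (intro nn_integral_mono) (auto simp: indicator_def)
  finally have le2: "(\<Sum>i\<in>F. \<integral>\<^sup>+x. norm (h x) \<partial>\<mu> i) \<le> ennreal (\<integral>x. norm (h x) \<partial>sum_measure I \<mu> R)" using tot by simp
  then have ft: "(\<integral>\<^sup>+x. norm (h x) \<partial>\<mu> i) < top" if "i \<in> F" for i
  proof -
    have "(\<integral>\<^sup>+x. norm (h x) \<partial>\<mu> i) \<le> (\<Sum>i\<in>F. \<integral>\<^sup>+x. norm (h x) \<partial>\<mu> i)"
      using F(1) that by (intro member_le_sum) auto
    also note le2
    also have "ennreal (\<integral>x. norm (h x) \<partial>sum_measure I \<mu> R) < top" by simp
    finally show ?thesis .
  qed
  have "ennreal (\<Sum>i\<in>F. \<integral>x. norm (h x) \<partial>\<mu> i) = (\<Sum>i\<in>F. ennreal (\<integral>x. norm (h x) \<partial>\<mu> i))"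
    by (simp add: sum_ennreal)
  also have "\<dots> = (\<Sum>i\<in>F. \<integral>\<^sup>+x. norm (h x) \<partial>\<mu> i)"
    using F ft by (intro sum.cong refl) (auto simp: le)
  finally have "ennreal (\<Sum>i\<in>F. \<integral>x. norm (h x) \<partial>\<mu> i) \<le> ennreal (\<integral>x. norm (h x) \<partial>sum_measure I \<mu> R)"
    using le2 by simp
  then show ?thesis by (subst (asm) ennreal_le_iff) auto
qed

end

section \<open>Measures on the circle and the torus with given moments\<close>

lemma finite_sum_measure:
  assumes "\<And>i. i \<in> I \<Longrightarrow> sets (\<mu> i) = sets R" "(\<integral>\<^sup>+i. emeasure (\<mu> i) (space R) \<partial>count_space I) < top"
  shows "finite_measure (sum_measure I \<mu> R)"
  by standard (use assms in \<open>simp add: emeasure_sum_measure less_top\<close>)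

lemma finite_sum_measure_finite:
  assumes "finite I" "\<And>i. i \<in> I \<Longrightarrow> sets (\<mu> i) = sets R" "\<And>i. i \<in> I \<Longrightarrow> finite_measure (\<mu> i)"
  shows "finite_measure (sum_measure I \<mu> R)"
proof (rule finite_sum_measure)
  have "emeasure (\<mu> i) (space R) < top" if "i \<in> I" for i
    using finite_measure.emeasure_finite[OF assms(3)[OF that], of "space R"] by (simp add: less_top)
  then show "(\<integral>\<^sup>+i. emeasure (\<mu> i) (space R) \<partial>count_space I) < top"
    using assms(1) by (simp add: nn_integral_count_space_finite ennreal_sum_less_top)
qed (rule assms(2))

context dense_functions
begin

lemma P_bounded:
  assumes "g \<in> P" obtains B where "\<And>x. x \<in> S \<Longrightarrow> norm (g x) \<le> B"
  using compact_imp_bounded[OF compact_continuous_image[OF P_cont[OF assms] S_compact]] by (auto simp: bounded_iff)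

lemma P_measurable: "g \<in> P \<Longrightarrow> g \<in> borel_measurable (restrict_space borel S)"
  by (intro borel_measurable_continuous_on_restrict P_cont)

text \<open>Some \<open>g\<close> in \<open>P\<close> approximates the indicator of a given set in the \<open>L\<^sup>1\<close>-norm of \<open>\<mu>1 + \<mu>2\<close>, hence for
  both measures at once, and the two integrals of \<open>g\<close> agree.\<close>

lemma measure_unique:
  assumes s: "sets \<mu>1 = sets (restrict_space borel S)" "sets \<mu>2 = sets (restrict_space borel S)"
    and f: "finite_measure \<mu>1" "finite_measure \<mu>2"
    and eq: "\<And>g. g \<in> P \<Longrightarrow> (\<integral>x. g x \<partial>\<mu>1) = (\<integral>x. g x \<partial>\<mu>2)"
  shows "\<mu>1 = \<mu>2"
proof (rule measure_eqI)
  fix A assume A: "A \<in> sets \<mu>1"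
  define R where "R = restrict_space borel S"
  define \<nu> where "\<nu> = sum_measure {\<mu>1, \<mu>2} (\<lambda>\<mu>. \<mu>) R"
  have sR: "sets \<mu> = sets R" "finite_measure \<mu>" if "\<mu> \<in> {\<mu>1, \<mu>2}" for \<mu> using s f that by (auto simp: R_def)
  have fin: "finite_measure \<nu>" unfolding \<nu>_def by (rule finite_sum_measure_finite) (use sR in auto)
  interpret \<nu>: finite_measure \<nu> by fact
  have s\<nu>: "sets \<nu> = sets (restrict_space borel S)" by (simp add: \<nu>_def R_def)
  have AR: "A \<in> sets R" using A s by (simp add: R_def)
  have bound: "norm (complex_of_real (measure \<mu> A) - (\<integral>x. g x \<partial>\<mu>)) \<le> (\<integral>x. norm (indicator A x - g x) \<partial>\<nu>)" if mu: "\<mu> \<in> {\<mu>1, \<mu>2}" and gP: "g \<in> P" for \<mu> g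
  proof -
    interpret m: finite_measure \<mu> using sR mu by auto
    have ind: "integrable \<mu> (indicator A :: _ \<Rightarrow> complex)"
      using AR sR[OF mu] by (intro m.integrable_const_bound[of _ 1]) (auto simp: indicator_def)
    have gi: "integrable \<mu> g"
      using integrable_P[of \<mu>] sR[OF mu] gP by (auto simp: R_def)
    have "(\<integral>x. indicator A x \<partial>\<mu>) = complex_of_real (measure \<mu> A)"
    proof -
      have "(\<integral>x. indicator A x \<partial>\<mu>) = (\<integral>x. complex_of_real (indicator A x) \<partial>\<mu>)"
        by (intro Bochner_Integration.integral_cong) (auto simp: indicator_def)
      also have "\<dots> = complex_of_real (\<integral>x. indicator A x \<partial>\<mu>)" by (rule integral_complex_of_real)
      also have "(\<integral>x. indicator A x \<partial>\<mu>) = measure \<mu> A"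
        using AR sR[OF mu] sets.sets_into_space[of A \<mu>] by (simp add: Int_absorb2)
      finally show ?thesis .
    qed
    then have "complex_of_real (measure \<mu> A) - (\<integral>x. g x \<partial>\<mu>) = (\<integral>x. indicator A x - g x \<partial>\<mu>)"
      using ind gi by simp
    then have "norm (complex_of_real (measure \<mu> A) - (\<integral>x. g x \<partial>\<mu>)) \<le> (\<integral>x. norm (indicator A x - g x) \<partial>\<mu>)"
      by (metis integral_norm_bound)
    moreover obtain B where B: "\<And>x. x \<in> S \<Longrightarrow> norm (g x) \<le> B" using P_bounded[OF gP] by blast
    have "(\<Sum>\<mu>\<in>{\<mu>}. \<integral>x. norm (indicator A x - g x) \<partial>\<mu>) \<le> (\<integral>x. norm (indicator A x - g x) \<partial>\<nu>)"
      unfolding \<nu>_def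
    proof (rule integral_le_sum_measure[where B = "1 + B"])
      show "(\<lambda>x. indicator A x - g x) \<in> borel_measurable R"
        using AR P_measurable[OF gP] unfolding R_def by measurable
      show "norm (indicator A x - g x) \<le> 1 + B" if "x \<in> space R" for x
        using B[of x] that norm_triangle_ineq4[of "indicator A x" "g x"]
        by (auto simp: R_def space_restrict_space indicator_def split: if_splits)
    qed (use mu sR fin \<nu>_def in auto)
    ultimately show ?thesis by simp
  qed
  have "measure \<mu>1 A = measure \<mu>2 A"
  proof (rule ccontr)
    assume ne: "measure \<mu>1 A \<noteq> measure \<mu>2 A"
    define e where "e = \<bar>measure \<mu>1 A - measure \<mu>2 A\<bar> / 2"
    have e: "e > 0" using ne by (simp add: e_def)
    have "integrable \<nu> (indicator A :: _ \<Rightarrow> complex)"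
    proof (rule \<nu>.integrable_const_bound[of _ 1])
      have "A \<in> sets \<nu>" using AR by (simp add: \<nu>_def)
      then show "(indicator A :: _ \<Rightarrow> complex) \<in> borel_measurable \<nu>" by simp
    qed (auto simp: indicator_def)
    then obtain g where g: "g \<in> P" "(\<integral>x. norm (indicator A x - g x) \<partial>\<nu>) < e"
      using P_dense[OF s\<nu> fin _ e] by blast
    have "norm (complex_of_real (measure \<mu>1 A) - complex_of_real (measure \<mu>2 A)) < 2 * e"
      using bound[of \<mu>1 g] bound[of \<mu>2 g] g eq[OF g(1)]
        norm_triangle_ineq4[of "complex_of_real (measure \<mu>1 A) - (\<integral>x. g x \<partial>\<mu>1)" "complex_of_real (measure \<mu>2 A) - (\<integral>x. g x \<partial>\<mu>2)"]
      by simp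
    then show False by (simp add: e_def flip: of_real_diff)
  qed
  then show "emeasure \<mu>1 A = emeasure \<mu>2 A"
    using f by (simp add: finite_measure.emeasure_eq_measure)
qed (use s in simp)

end

inductive_set fspan :: "('a \<Rightarrow> complex) set \<Rightarrow> ('a \<Rightarrow> complex) set" for G where
  gen: "f \<in> G \<Longrightarrow> f \<in> fspan G"
| add: "f \<in> fspan G \<Longrightarrow> g \<in> fspan G \<Longrightarrow> (\<lambda>x. f x + g x) \<in> fspan G"
| scale: "f \<in> fspan G \<Longrightarrow> (\<lambda>x. c * f x) \<in> fspan G"

lemma fspan_mult:
  assumes G: "\<And>f g. f \<in> G \<Longrightarrow> g \<in> G \<Longrightarrow> \<exists>h\<in>G. \<forall>x\<in>S. h x = f x * g x"
    and "f \<in> fspan G" "g \<in> fspan G"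
  shows "\<exists>h\<in>fspan G. \<forall>x\<in>S. h x = f x * g x"
  using assms(2,3)
proof (induction f)
  case (gen f)
  from \<open>g \<in> fspan G\<close> show ?case
  proof (induction g)
    case (gen g)
    then show ?case using G[OF \<open>f \<in> G\<close>] fspan.gen by blast
  next
    case (add g1 g2)
    then obtain u v where "u \<in> fspan G" "\<forall>x\<in>S. u x = f x * g1 x" "v \<in> fspan G" "\<forall>x\<in>S. v x = f x * g2 x" by blast
    then show ?case by (intro bexI[OF _ fspan.add[of u G v]]) (auto simp: algebra_simps)
  next
    case (scale g c)
    then obtain u where "u \<in> fspan G" "\<forall>x\<in>S. u x = f x * g x" by blast
    then show ?case by (intro bexI[OF _ fspan.scale[of u G c]]) auto
  qed
next
  case (add f1 f2)
  then obtain u v where "u \<in> fspan G" "\<forall>x\<in>S. u x = f1 x * g x" "v \<in> fspan G" "\<forall>x\<in>S. v x = f2 x * g x" by blast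
  then show ?case by (intro bexI[OF _ fspan.add[of u G v]]) (auto simp: algebra_simps)
next
  case (scale f c)
  then obtain u where "u \<in> fspan G" "\<forall>x\<in>S. u x = f x * g x" by blast
  then show ?case by (intro bexI[OF _ fspan.scale[of u G c]]) auto
qed

lemma fspan_cont:
  "f \<in> fspan G \<Longrightarrow> (\<And>g. g \<in> G \<Longrightarrow> continuous_on S g) \<Longrightarrow> continuous_on S f"
  by (induction rule: fspan.induct) (auto intro!: continuous_intros)

definition trig1 :: "(complex \<Rightarrow> complex) set" where
  "trig1 = fspan (range (\<lambda>n s. s powi n))"

definition trig2 :: "(complex \<times> complex \<Rightarrow> complex) set" where
  "trig2 = fspan (range (\<lambda>(n, m) p. fst p powi n * snd p powi m))"

lemma trig1_mono: "(\<lambda>s. s powi n) \<in> trig1"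
  unfolding trig1_def by (rule fspan.gen) auto

lemma trig2_mono: "(\<lambda>p. fst p powi n * snd p powi m) \<in> trig2"
  unfolding trig2_def by (rule fspan.gen) (auto intro!: image_eqI[where x = "(n, m)"])

lemma trig1_induct [consumes 1, case_names mono add scale]:
  assumes "f \<in> trig1" "\<And>n. Q (\<lambda>s. s powi n)"
    and "\<And>f g. f \<in> trig1 \<Longrightarrow> g \<in> trig1 \<Longrightarrow> Q f \<Longrightarrow> Q g \<Longrightarrow> Q (\<lambda>s. f s + g s)"
    and "\<And>f c. f \<in> trig1 \<Longrightarrow> Q f \<Longrightarrow> Q (\<lambda>s. c * f s)"
  shows "Q f"
  using assms(1) unfolding trig1_def
  by (induction rule: fspan.induct) (use assms(2-4)[unfolded trig1_def] in auto)

lemma trig2_induct [consumes 1, case_names mono add scale]: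
  assumes "f \<in> trig2" "\<And>n m. Q (\<lambda>p. fst p powi n * snd p powi m)"
    and "\<And>f g. f \<in> trig2 \<Longrightarrow> g \<in> trig2 \<Longrightarrow> Q f \<Longrightarrow> Q g \<Longrightarrow> Q (\<lambda>s. f s + g s)"
    and "\<And>f c. f \<in> trig2 \<Longrightarrow> Q f \<Longrightarrow> Q (\<lambda>s. c * f s)"
  shows "Q f"
  using assms(1) unfolding trig2_def
  by (induction rule: fspan.induct) (use assms(2-4)[unfolded trig2_def] in auto)

lemma Re_circle: "s \<in> circle \<Longrightarrow> complex_of_real (Re s) = (1/2) * s powi 1 + (1/2) * s powi (-1)"
  and Im_circle: "s \<in> circle \<Longrightarrow> complex_of_real (Im s) = (-\<i>/2) * s powi 1 + (\<i>/2) * s powi (-1)"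
proof -
  assume "s \<in> circle"
  then have n: "(Re s)\<^sup>2 + (Im s)\<^sup>2 = 1" by (simp add: dist_norm cmod_def)
  have "s powi (-1) = cnj s" using n by (simp add: power_int_minus complex_eq_iff)
  then show "complex_of_real (Re s) = (1/2) * s powi 1 + (1/2) * s powi (-1)"
    "complex_of_real (Im s) = (-\<i>/2) * s powi 1 + (\<i>/2) * s powi (-1)" by (auto simp: complex_eq_iff)
qed

interpretation trig1: dense_functions circle trig1
proof
  show "compact (circle :: complex set)" by simp
  show "continuous_on circle f" if "f \<in> trig1" for f
    using that unfolding trig1_def by (rule fspan_cont) (auto intro!: continuous_intros)
  show "(\<lambda>_. c) \<in> trig1" for c
    using fspan.scale[OF trig1_mono[of 0, unfolded trig1_def], of c] by (simp add: trig1_def)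
  show "(\<lambda>x. f x + g x) \<in> trig1" if "f \<in> trig1" "g \<in> trig1" for f g
    using that unfolding trig1_def by (rule fspan.add)
  show "\<exists>h\<in>trig1. \<forall>x\<in>circle. h x = f x * g x" if "f \<in> trig1" "g \<in> trig1" for f g
    using that unfolding trig1_def
  proof (rule fspan_mult[rotated])
    fix f g :: "complex \<Rightarrow> complex"
    assume "f \<in> range (\<lambda>n s. s powi n)" "g \<in> range (\<lambda>n s. s powi n)"
    then obtain n m where fg: "f = (\<lambda>s. s powi n)" "g = (\<lambda>s. s powi m)" by auto
    have "s powi (n + m) = f s * g s" if "s \<in> circle" for s
    proof -
      have "s \<noteq> 0" using that by auto
      then show ?thesis by (simp add: fg power_int_add)
    qed
    then show "\<exists>h\<in>range (\<lambda>n s. s powi n). \<forall>x\<in>circle. h x = f x * g x"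
      by (intro bexI[of _ "\<lambda>s. s powi (n + m)"] ballI rangeI)
  qed
  fix b :: complex assume "b \<in> Basis"
  then consider "b = 1" | "b = \<i>" by (auto simp: Basis_complex_def)
  then show "\<exists>h\<in>trig1. \<forall>x\<in>circle. h x = complex_of_real (x \<bullet> b)"
  proof cases
    case 1
    have "(\<lambda>s. (1/2) * s powi 1 + (1/2) * s powi (-1)) \<in> trig1"
      unfolding trig1_def by (intro fspan.add fspan.scale trig1_mono[unfolded trig1_def])
    then show ?thesis by (rule bexI[rotated]) (use Re_circle in \<open>simp add: 1 inner_complex_def\<close>)
  next
    case 2
    have "(\<lambda>s. (-\<i>/2) * s powi 1 + (\<i>/2) * s powi (-1)) \<in> trig1"
      unfolding trig1_def by (intro fspan.add fspan.scale trig1_mono[unfolded trig1_def])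
    then show ?thesis by (rule bexI[rotated]) (use Im_circle in \<open>simp add: 2 inner_complex_def\<close>)
  qed
qed

interpretation trig2: dense_functions torus trig2
proof
  show "compact (torus :: (complex \<times> complex) set)" by (intro compact_Times) auto
  show "continuous_on torus f" if "f \<in> trig2" for f
    using that unfolding trig2_def by (rule fspan_cont) (auto intro!: continuous_intros)
  show "(\<lambda>_. c) \<in> trig2" for c
    using fspan.scale[OF trig2_mono[of 0 0, unfolded trig2_def], of c] by (simp add: trig2_def)
  show "(\<lambda>x. f x + g x) \<in> trig2" if "f \<in> trig2" "g \<in> trig2" for f g
    using that unfolding trig2_def by (rule fspan.add)
  show "\<exists>h\<in>trig2. \<forall>x\<in>torus. h x = f x * g x" if "f \<in> trig2" "g \<in> trig2" for f g
    using that unfolding trig2_def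
  proof (rule fspan_mult[rotated])
    fix f g :: "complex \<times> complex \<Rightarrow> complex"
    assume "f \<in> range (\<lambda>(n, m) p. fst p powi n * snd p powi m)" "g \<in> range (\<lambda>(n, m) p. fst p powi n * snd p powi m)"
    then obtain n m n' m' where fg: "f = (\<lambda>p. fst p powi n * snd p powi m)" "g = (\<lambda>p. fst p powi n' * snd p powi m')" by auto
    have "fst p powi (n + n') * snd p powi (m + m') = f p * g p" if "p \<in> torus" for p
    proof -
      have "fst p \<noteq> 0" "snd p \<noteq> 0" using that by auto
      then show ?thesis by (simp add: fg power_int_add)
    qed
    then show "\<exists>h\<in>range (\<lambda>(n, m) p. fst p powi n * snd p powi m). \<forall>x\<in>torus. h x = f x * g x"
      by (intro bexI[of _ "\<lambda>p. fst p powi (n + n') * snd p powi (m + m')"]) (auto intro!: image_eqI[where x = "(n + n', m + m')"])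
  qed
  have m1: "(\<lambda>p. c * (fst p powi n * snd p powi 0) + d * (fst p powi m * snd p powi 0)) \<in> trig2" for c d n m
    unfolding trig2_def by (intro fspan.add fspan.scale trig2_mono[unfolded trig2_def])
  have m2: "(\<lambda>p. c * (fst p powi 0 * snd p powi n) + d * (fst p powi 0 * snd p powi m)) \<in> trig2" for c d n m
    unfolding trig2_def by (intro fspan.add fspan.scale trig2_mono[unfolded trig2_def])
  fix b :: "complex \<times> complex" assume "b \<in> Basis"
  then consider "b = (1, 0)" | "b = (\<i>, 0)" | "b = (0, 1)" | "b = (0, \<i>)" by (auto simp: Basis_prod_def Basis_complex_def)
  then show "\<exists>h\<in>trig2. \<forall>x\<in>torus. h x = complex_of_real (x \<bullet> b)"
  proof cases
    case 1
    show ?thesis by (rule bexI[OF _ m1[of "1/2" 1 "1/2" "-1"]]) (use Re_circle in \<open>auto simp: 1 inner_complex_def\<close>)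
  next
    case 2
    show ?thesis by (rule bexI[OF _ m1[of "-\<i>/2" 1 "\<i>/2" "-1"]]) (use Im_circle in \<open>auto simp: 2 inner_complex_def\<close>)
  next
    case 3
    show ?thesis by (rule bexI[OF _ m2[of "1/2" 1 "1/2" "-1"]]) (use Re_circle in \<open>auto simp: 3 inner_complex_def\<close>)
  next
    case 4
    show ?thesis by (rule bexI[OF _ m2[of "-\<i>/2" 1 "\<i>/2" "-1"]]) (use Im_circle in \<open>auto simp: 4 inner_complex_def\<close>)
  qed
qed

definition has_circle_moments :: "complex measure \<Rightarrow> (int \<Rightarrow> complex) \<Rightarrow> bool" where
  "has_circle_moments \<mu> c \<longleftrightarrow> sets \<mu> = sets (restrict_space borel circle) \<and> finite_measure \<mu> \<and> (\<forall>n. (\<integral>s. s powi n \<partial>\<mu>) = c n)"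

definition has_torus_moments :: "(complex \<times> complex) measure \<Rightarrow> (int \<Rightarrow> int \<Rightarrow> complex) \<Rightarrow> bool" where
  "has_torus_moments \<mu> c \<longleftrightarrow> sets \<mu> = sets (restrict_space borel torus) \<and> finite_measure \<mu> \<and>
     (\<forall>n m. (\<integral>p. fst p powi n * snd p powi m \<partial>\<mu>) = c n m)"

lemma circle_measure_eq:
  assumes "has_circle_moments \<mu> c" shows "circle_measure c = \<mu>"
  unfolding circle_measure_def
proof (rule the_equality)
  fix \<nu> assume \<nu>: "sets \<nu> = sets (restrict_space borel circle) \<and> finite_measure \<nu> \<and> (\<forall>n. (\<integral>s. s powi n \<partial>\<nu>) = c n)"
  show "\<nu> = \<mu>"
  proof (rule trig1.measure_unique)
    fix g assume "g \<in> trig1"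
    then show "(\<integral>x. g x \<partial>\<nu>) = (\<integral>x. g x \<partial>\<mu>)"
    proof (induction g rule: trig1_induct)
      case (add f g)
      then show ?case using trig1.integrable_P \<nu> assms by (simp add: has_circle_moments_def)
    qed (use \<nu> assms in \<open>simp_all add: has_circle_moments_def\<close>)
  qed (use \<nu> assms in \<open>auto simp: has_circle_moments_def\<close>)
qed (use assms in \<open>simp add: has_circle_moments_def\<close>)

lemma torus_measure_eq:
  assumes "has_torus_moments \<mu> c" shows "torus_measure c = \<mu>"
  unfolding torus_measure_def
proof (rule the_equality)
  fix \<nu> assume \<nu>: "sets \<nu> = sets (restrict_space borel torus) \<and> finite_measure \<nu> \<and> (\<forall>n m. (\<integral>p. fst p powi n * snd p powi m \<partial>\<nu>) = c n m)"
  show "\<nu> = \<mu>"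
  proof (rule trig2.measure_unique)
    fix g assume "g \<in> trig2"
    then show "(\<integral>x. g x \<partial>\<nu>) = (\<integral>x. g x \<partial>\<mu>)"
    proof (induction g rule: trig2_induct)
      case (add f g)
      then show ?case using trig2.integrable_P \<nu> assms by (simp add: has_torus_moments_def)
    qed (use \<nu> assms in \<open>simp_all add: has_torus_moments_def\<close>)
  qed (use \<nu> assms in \<open>auto simp: has_torus_moments_def\<close>)
qed (use assms in \<open>simp add: has_torus_moments_def\<close>)

text \<open>The orbit of \<open>u\<close> under the two commuting unitaries is stationary.\<close>

lemma torus_moments_exist:
  assumes A: "unitary_op A" and B: "unitary_op B" and comm: "A o\<^sub>L B = B o\<^sub>L A"
  shows "has_torus_moments (torus_measure (\<lambda>n m. cinner ((op_powi A n o\<^sub>L op_powi B m) u) u)) (\<lambda>n m. cinner ((op_powi A n o\<^sub>L op_powi B m) u) u)"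
proof -
  let ?x = "\<lambda>a b. (op_powi A a o\<^sub>L op_powi B b) u"
  have c1: "A o\<^sub>L op_powi B m = op_powi B m o\<^sub>L A" for m by (rule op_powi_commute[OF B comm])
  have c: "op_powi A n o\<^sub>L op_powi B m = op_powi B m o\<^sub>L op_powi A n" for n m
    using op_powi_commute[OF A c1[symmetric], of m n] by simp
  have "cinner (?x a b) (?x a' b') = cinner (?x (a - a') (b - b')) u" for a b a' b'
  proof -
    let ?W = "op_powi A a' o\<^sub>L op_powi B b'"
    have W: "unitary_op ?W" using unitary_op_mult op_powi_unitary A B by blast
    have "op_powi A a o\<^sub>L op_powi B b = (op_powi A a' o\<^sub>L op_powi A (a - a')) o\<^sub>L (op_powi B b' o\<^sub>L op_powi B (b - b'))"
      by (simp add: op_powi_add[OF A, symmetric] op_powi_add[OF B, symmetric])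
    also have "\<dots> = op_powi A a' o\<^sub>L ((op_powi A (a - a') o\<^sub>L op_powi B b') o\<^sub>L op_powi B (b - b'))"
      by (simp only: compose_assoc)
    also have "\<dots> = ?W o\<^sub>L (op_powi A (a - a') o\<^sub>L op_powi B (b - b'))"
      by (subst c) (simp only: compose_assoc)
    finally have "?x a b = ?W (?x (a - a') (b - b'))" by simp
    then show ?thesis by (simp only: unitary_op_apply(3)[OF W])
  qed
  then have st: "stationary ?x (\<lambda>n m. cinner (?x n m) u)" by (simp only: stationary_def) blast
  show ?thesis
  proof (rule stationary_measure_exists[OF st])
    fix \<mu> :: "(complex \<times> complex) measure"
    assume "sets \<mu> = sets (restrict_space borel torus)" "finite_measure \<mu>"
      "\<And>n m. (\<integral>p. fst p powi n * snd p powi m \<partial>\<mu>) = cinner (?x n m) u"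
    then have "has_torus_moments \<mu> (\<lambda>n m. cinner (?x n m) u)" by (simp add: has_torus_moments_def)
    then show ?thesis by (simp only: torus_measure_eq)
  qed
qed

lemma measurable_torus_coordinates:
  assumes "sets \<mu> = sets (restrict_space borel torus)"
  shows "fst \<in> measurable \<mu> (restrict_space borel circle)" "snd \<in> measurable \<mu> (restrict_space borel circle)"
proof -
  have b: "fst \<in> borel_measurable (borel :: (complex \<times> complex) measure)"
    "snd \<in> borel_measurable (borel :: (complex \<times> complex) measure)"
    by (intro borel_measurable_continuous_onI continuous_intros)+
  have "fst \<in> torus \<rightarrow> circle" "snd \<in> torus \<rightarrow> circle" by (rule Pi_I, erule SigmaE, simp)+
  then have "fst \<in> measurable (restrict_space borel torus) (restrict_space borel circle)"
    and "snd \<in> measurable (restrict_space borel torus) (restrict_space borel circle)"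
    by (auto simp only: intro!: measurable_restrict_space3 b)
  then show "fst \<in> measurable \<mu> (restrict_space borel circle)" "snd \<in> measurable \<mu> (restrict_space borel circle)"
    by (simp_all only: measurable_cong_sets[OF assms refl])
qed

text \<open>The one-dimensional case is the two-dimensional one for the pair of \<open>A\<close> and the identity,
  projected to the first coordinate.\<close>

lemma circle_moments_exist:
  assumes A: "unitary_op A"
  shows "has_circle_moments (circle_measure (\<lambda>n. cinner (op_powi A n u) u)) (\<lambda>n. cinner (op_powi A n u) u)"
proof -
  have p: "op_powi (id_blinfun :: 'a \<Rightarrow>\<^sub>L 'a) m = id_blinfun" for m
    using op_powi_commute[OF unitary_op_id, of id_blinfun m]
    by (induction m rule: int_induct[of _ 0]) (auto simp: op_powi_succ[OF unitary_op_id] op_powi_pred[OF unitary_op_id] intro!: op_inv_eqI)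
  obtain \<mu> where \<mu>: "has_torus_moments \<mu> (\<lambda>n m. cinner (op_powi A n u) u)"
    using torus_moments_exist[OF A unitary_op_id, of u] by (auto simp: p)
  have m: "fst \<in> measurable \<mu> (restrict_space borel circle)"
    using \<mu> by (intro measurable_torus_coordinates) (simp add: has_torus_moments_def)
  have pm: "(\<lambda>s::complex. s powi n) \<in> borel_measurable (restrict_space borel circle)" for n
    by (rule trig1.P_measurable[OF trig1_mono])
  have "has_circle_moments (distr \<mu> (restrict_space borel circle) fst) (\<lambda>n. cinner (op_powi A n u) u)"
    unfolding has_circle_moments_def
  proof (intro conjI allI)
    show "finite_measure (distr \<mu> (restrict_space borel circle) fst)"
      using \<mu> by (intro finite_measure.finite_measure_distr[OF _ m]) (simp add: has_torus_moments_def)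
    fix n
    have "(\<integral>p. fst p powi n * snd p powi 0 \<partial>\<mu>) = cinner (op_powi A n u) u" using \<mu> by (simp only: has_torus_moments_def)
    then show "(\<integral>s. s powi n \<partial>distr \<mu> (restrict_space borel circle) fst) = cinner (op_powi A n u) u"
      by (subst integral_distr[OF m pm]) simp
  qed simp
  then show ?thesis by (simp only: circle_measure_eq)
qed

section \<open>The Borel calculus and normal functionals\<close>

text \<open>Pairs of a trigonometric polynomial \<open>g\<close> and the operator \<open>g(B)\<close>. A relation avoids
  recovering the coefficients from the function \<open>g\<close>.\<close>

inductive_set trig_op :: "('h::chilbert_space \<Rightarrow>\<^sub>L 'h) \<Rightarrow> ((complex \<Rightarrow> complex) \<times> ('h \<Rightarrow>\<^sub>L 'h)) set" for B where
  mono: "((\<lambda>s. s powi n), op_powi B n) \<in> trig_op B"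
| add: "(f, x) \<in> trig_op B \<Longrightarrow> (g, y) \<in> trig_op B \<Longrightarrow> ((\<lambda>s. f s + g s), x + y) \<in> trig_op B"
| scale: "(f, x) \<in> trig_op B \<Longrightarrow> ((\<lambda>s. c * f s), op_scale c x) \<in> trig_op B"

lemma trig_op_exists: "g \<in> trig1 \<Longrightarrow> \<exists>y. (g, y) \<in> trig_op B"
  by (induction g rule: trig1_induct) (blast intro: trig_op.intros)+

text \<open>Two linear functionals, one on functions and one on operators, that agree on the powers agree
  on all pairs \<open>(g, g(B))\<close>. This transports moments to polynomials in every situation below.\<close>

lemma trig_op_eval:
  assumes "(g, y) \<in> trig_op B" and N: "op_algebra N" "\<And>n. op_powi B n \<in> N"
    and F: "\<And>x y. x \<in> N \<Longrightarrow> y \<in> N \<Longrightarrow> F (x + y) = F x + F y" "\<And>c x. x \<in> N \<Longrightarrow> F (op_scale c x) = c * F x"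
    and \<Phi>: "\<And>f g. f \<in> trig1 \<Longrightarrow> g \<in> trig1 \<Longrightarrow> \<Phi> (\<lambda>s. f s + g s) = \<Phi> f + \<Phi> g" "\<And>f c. f \<in> trig1 \<Longrightarrow> \<Phi> (\<lambda>s. c * f s) = c * \<Phi> f"
    and eq: "\<And>n. \<Phi> (\<lambda>s. s powi n) = F (op_powi B n)"
  shows "g \<in> trig1 \<and> y \<in> N \<and> \<Phi> g = (F y :: complex)"
  using assms(1)
proof (induction rule: trig_op.induct)
  case (mono n)
  show ?case using N eq trig1_mono by simp
next
  case (add f x g y)
  then show ?case using F \<Phi> op_algebra.add_in[OF N(1)] trig1.P_add by simp
next
  case (scale f x c)
  have "(\<lambda>s. c * f s) \<in> trig1" using scale unfolding trig1_def by (blast intro: fspan.scale)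
  then show ?case using scale F \<Phi> op_algebra.scale_in[OF N(1)] by simp
qed

abbreviation spectral_measure :: "('h::chilbert_space \<Rightarrow>\<^sub>L 'h) \<Rightarrow> 'h \<Rightarrow> complex measure" where
  "spectral_measure B u \<equiv> circle_measure (\<lambda>n. cinner (op_powi B n u) u)"

lemma spectral_measure_props:
  assumes "unitary_op B"
  shows "sets (spectral_measure B u) = sets (restrict_space borel circle)" "finite_measure (spectral_measure B u)"
    "(\<integral>s. s powi n \<partial>spectral_measure B u) = cinner (op_powi B n u) u" "emeasure (spectral_measure B u) circle = ennreal ((norm u)\<^sup>2)"
proof -
  show s: "sets (spectral_measure B u) = sets (restrict_space borel circle)" and f: "finite_measure (spectral_measure B u)"
    and m: "(\<integral>s. s powi n \<partial>spectral_measure B u) = cinner (op_powi B n u) u" for n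
    using circle_moments_exist[OF assms, of u] by (auto simp: has_circle_moments_def)
  interpret finite_measure "spectral_measure B u" by (rule f)
  have sp: "space (spectral_measure B u) = circle" using sets_eq_imp_space_eq[OF s] by (simp add: space_restrict_space)
  have "complex_of_real (measure (spectral_measure B u) circle) = complex_of_real ((norm u)\<^sup>2)"
    using m[of 0] by (simp add: cinner_self sp scaleR_conv_of_real)
  then have "measure (spectral_measure B u) circle = (norm u)\<^sup>2" by (simp only: of_real_eq_iff)
  then show "emeasure (spectral_measure B u) circle = ennreal ((norm u)\<^sup>2)" by (simp add: emeasure_eq_measure)
qed

lemma trig_op_spectral:
  assumes B: "unitary_op B" and gy: "(g, y) \<in> trig_op B"
  shows "g \<in> trig1" "y \<in> bops" "cinner (y u) u = (\<integral>s. g s \<partial>spectral_measure B u)"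
proof -
  have "g \<in> trig1 \<and> y \<in> bops \<and> (\<integral>s. g s \<partial>spectral_measure B u) = cinner (y u) u"
  proof (rule trig_op_eval[OF gy bops_algebra, where \<Phi> = "\<lambda>g. \<integral>s. g s \<partial>spectral_measure B u" and F = "\<lambda>y. cinner (y u) u"])
    show "op_powi B n \<in> bops" for n by (rule unitary_op_inv(4)[OF op_powi_unitary[OF B]])
  qed (use trig1.integrable_P[OF spectral_measure_props(1,2)[OF B]] spectral_measure_props(3)[OF B] in \<open>auto simp: cinner_simps blinfun.bilinear_simps\<close>)
  then show "g \<in> trig1" "y \<in> bops" "cinner (y u) u = (\<integral>s. g s \<partial>spectral_measure B u)" by auto
qed

text \<open>A Borel calculus is only specified by its quadratic form; polarization recovers the sesquilinear
  form.\<close>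

lemma polarization:
  assumes "D \<in> bops"
  shows "4 * cinner (D p) q = (\<Sum>k<4. \<i> ^ k * cinner (D (p + scaleC (\<i> ^ k) q)) (p + scaleC (\<i> ^ k) q))"
  using bops_apply[OF assms]
  by (simp add: eval_nat_numeral cinner_simps blinfun.bilinear_simps algebra_simps)

lemma Linf_measurable: "h \<in> Linf \<Longrightarrow> h \<in> borel_measurable (restrict_space borel circle)"
  by (simp add: Linf_def)

lemma Linf_bounded: "h \<in> Linf \<Longrightarrow> \<exists>C. \<forall>s\<in>circle. norm (h s) \<le> C"
  by (auto simp: Linf_def bounded_iff)

lemma Linf_trig1: "g \<in> trig1 \<Longrightarrow> g \<in> Linf"
  unfolding Linf_def by (auto intro: trig1.P_measurable compact_imp_bounded[OF compact_continuous_image[OF trig1.P_cont]])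

lemma Linf_diff:
  assumes "h \<in> Linf" "g \<in> Linf" shows "(\<lambda>s. h s - g s) \<in> Linf"
proof -
  obtain C C' where C: "\<forall>s\<in>circle. norm (h s) \<le> C" "\<forall>s\<in>circle. norm (g s) \<le> C'"
    using Linf_bounded assms by meson
  have "\<forall>s\<in>circle. norm (h s - g s) \<le> C + C'"
  proof
    fix s :: complex assume "s \<in> circle"
    then have "norm (h s) \<le> C" "norm (g s) \<le> C'" using C by auto
    then show "norm (h s - g s) \<le> C + C'" using norm_triangle_ineq4[of "h s" "g s"] by simp
  qed
  then have "bounded ((\<lambda>s. h s - g s) ` circle)" unfolding bounded_iff by blast
  moreover have "(\<lambda>s. h s - g s) \<in> borel_measurable (restrict_space borel circle)"
    using assms by (intro borel_measurable_diff Linf_measurable)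
  ultimately show ?thesis by (simp add: Linf_def)
qed

lemma Linf_integrable:
  assumes "h \<in> Linf" "sets \<nu> = sets (restrict_space borel circle)" "finite_measure \<nu>"
  shows "integrable \<nu> h"
proof -
  obtain C where C: "\<forall>s\<in>circle. norm (h s) \<le> C" using Linf_bounded[OF assms(1)] by blast
  have sp: "space \<nu> = circle" using sets_eq_imp_space_eq[OF assms(2)] by (simp add: space_restrict_space)
  show ?thesis
    using C Linf_measurable[OF assms(1)]
    by (intro finite_measure.integrable_const_bound[OF assms(3), of _ C]) (auto simp: sp measurable_cong_sets[OF assms(2) refl])
qed


lemma calculus_bound:
  assumes B: "unitary_op B" and D: "is_borel_calculus B h D" and h: "h \<in> Linf"
  shows "norm (cinner (D p) q) \<le> (\<Sum>k<4. \<integral>s. norm (h s) \<partial>spectral_measure B (p + scaleC (\<i> ^ k) q))"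
proof -
  have Db: "D \<in> bops" and Du: "cinner (D u) u = (\<integral>s. h s \<partial>spectral_measure B u)" for u
    using D by (auto simp: is_borel_calculus_def)
  have "4 * norm (cinner (D p) q) = norm (4 * cinner (D p) q)" by (simp add: norm_mult)
  also have "\<dots> \<le> (\<Sum>k<4. norm (\<i> ^ k * cinner (D (p + scaleC (\<i> ^ k) q)) (p + scaleC (\<i> ^ k) q)))"
    unfolding polarization[OF Db] by (rule norm_sum)
  also have "\<dots> \<le> (\<Sum>k<4. \<integral>s. norm (h s) \<partial>spectral_measure B (p + scaleC (\<i> ^ k) q))"
    by (intro sum_mono) (simp add: norm_mult norm_power Du)
  finally have "4 * norm (cinner (D p) q) \<le> (\<Sum>k<4. \<integral>s. norm (h s) \<partial>spectral_measure B (p + scaleC (\<i> ^ k) q))" .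
  then show ?thesis using norm_ge_zero[of "cinner (D p) q"] by linarith
qed

lemma calculus_diff:
  assumes B: "unitary_op B" and x: "is_borel_calculus B h x" "h \<in> Linf" and gy: "(g, y) \<in> trig_op B"
  shows "is_borel_calculus B (\<lambda>s. h s - g s) (x - y)"
proof -
  note t = trig_op_spectral[OF B gy]
  have "x - y \<in> bops" using x t(2) op_algebra.diff_in[OF bops_algebra] by (auto simp: is_borel_calculus_def)
  moreover have "cinner ((x - y) u) u = (\<integral>s. h s - g s \<partial>spectral_measure B u)" for u
    using x(1) t(3)[of u] Linf_integrable[OF x(2) spectral_measure_props(1,2)[OF B]] trig1.integrable_P[OF spectral_measure_props(1,2)[OF B] t(1)]
    by (simp add: is_borel_calculus_def blinfun.bilinear_simps cinner_simps)
  ultimately show ?thesis by (simp add: is_borel_calculus_def)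
qed

lemma norm_cinner_op_le:
  fixes x :: "'h::chilbert_space \<Rightarrow>\<^sub>L 'h"
  shows "norm (cinner (x p) q) \<le> norm x * ((norm p)\<^sup>2 + (norm q)\<^sup>2)"
proof -
  have "norm (cinner (x p) q) \<le> norm (x p) * norm q" by (rule norm_cinner_le)
  also have "\<dots> \<le> (norm x * norm p) * norm q" by (intro mult_right_mono norm_blinfun) auto
  also have "\<dots> = norm x * (norm p * norm q)" by simp
  also have "\<dots> \<le> norm x * ((norm p)\<^sup>2 + (norm q)\<^sup>2)"
  proof (rule mult_left_mono)
    have "0 \<le> norm p * norm q" by simp
    then show "norm p * norm q \<le> (norm p)\<^sup>2 + (norm q)\<^sup>2"
      using sum_squares_bound[of "norm p" "norm q"] by linarith
  qed simp
  finally show ?thesis .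
qed

lemma ultraweak_summable:
  fixes x :: "'h::chilbert_space \<Rightarrow>\<^sub>L 'h"
  assumes "summable (\<lambda>n. (norm (p n))\<^sup>2)" "summable (\<lambda>n. (norm (q n))\<^sup>2)"
  shows "summable (\<lambda>n. cinner (x (p n)) (q n))"
proof (rule summable_comparison_test')
  show "summable (\<lambda>n. norm x * ((norm (p n))\<^sup>2 + (norm (q n))\<^sup>2))"
    by (intro summable_mult summable_add assms)
qed (rule norm_cinner_op_le)

lemma ultraweak_diff:
  assumes "f \<in> ultraweak_functionals" shows "f (x - y) = f x - f y"
proof -
  obtain p q where f: "f = (\<lambda>x. \<Sum>n. cinner (blinfun_apply x (p n)) (q n))"
    and s: "summable (\<lambda>n. (norm (p n))\<^sup>2)" "summable (\<lambda>n. (norm (q n))\<^sup>2)"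
    using assms unfolding ultraweak_functionals_def by blast
  show ?thesis unfolding f
    by (subst suminf_diff[OF ultraweak_summable[OF s] ultraweak_summable[OF s]]) (simp add: blinfun.bilinear_simps cinner_simps)
qed

text \<open>On the Borel calculus of \<open>B\<close> an ultraweakly continuous functional is dominated by a single finite
  measure on the circle: the sum of the spectral measures of the countably many vectors that
  polarization produces.\<close>

lemma ultraweak_bound:
  assumes f: "f \<in> ultraweak_functionals" and B: "unitary_op B" and a: "unitary_op a"
  obtains \<nu> where "sets \<nu> = sets (restrict_space borel circle)" "finite_measure \<nu>"
    "\<And>D h. is_borel_calculus B h D \<Longrightarrow> h \<in> Linf \<Longrightarrow> norm (f (a o\<^sub>L D)) \<le> (\<integral>s. norm (h s) \<partial>\<nu>)"
proof -
  obtain p q where fe: "f = (\<lambda>x. \<Sum>n. cinner (blinfun_apply x (p n)) (q n))"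
    and s: "summable (\<lambda>n. (norm (p n))\<^sup>2)" "summable (\<lambda>n. (norm (q n))\<^sup>2)"
    using f unfolding ultraweak_functionals_def by blast
  define R where "R = (restrict_space borel circle :: complex measure)"
  define r where "r n = op_inv a (q n)" for n
  have nr: "norm (r n) = norm (q n)" for n unfolding r_def using a by (simp add: unitary_op_inv unitary_op_apply)
  define u where "u n k = p n + scaleC (\<i> ^ k) (r n)" for n k
  define \<rho> where "\<rho> n = sum_measure {..<4::nat} (\<lambda>k. spectral_measure B (u n k)) R" for n
  define \<nu> where "\<nu> = sum_measure UNIV \<rho> R"
  have sR: "sets (spectral_measure B v) = sets R" "space R = circle" for v using spectral_measure_props(1)[OF B] by (auto simp: R_def space_restrict_space)
  have s\<rho>: "sets (\<rho> n) = sets R" for n by (simp add: \<rho>_def)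
  have f\<rho>: "finite_measure (\<rho> n)" for n unfolding \<rho>_def
    by (rule finite_sum_measure_finite) (use spectral_measure_props[OF B] sR in auto)
  have un: "(norm (u n k))\<^sup>2 \<le> 2 * ((norm (p n))\<^sup>2 + (norm (q n))\<^sup>2)" for n k
  proof -
    have "norm (u n k) \<le> norm (p n) + norm (q n)"
      unfolding u_def using norm_triangle_ineq[of "p n" "scaleC (\<i> ^ k) (r n)"] by (simp add: norm_scaleC nr norm_power)
    then have "(norm (u n k))\<^sup>2 \<le> (norm (p n) + norm (q n))\<^sup>2" by (intro power_mono) auto
    also have "\<dots> \<le> 2 * ((norm (p n))\<^sup>2 + (norm (q n))\<^sup>2)"
      using sum_squares_bound[of "norm (p n)" "norm (q n)"] by (simp add: power2_sum)
    finally show ?thesis .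
  qed
  have e\<rho>: "emeasure (\<rho> n) circle \<le> ennreal (8 * ((norm (p n))\<^sup>2 + (norm (q n))\<^sup>2))" for n
  proof -
    have "emeasure (\<rho> n) circle = (\<Sum>k<4. ennreal ((norm (u n k))\<^sup>2))"
      unfolding \<rho>_def using sR sets.top[of R]
      by (subst emeasure_sum_measure) (auto simp: nn_integral_count_space_finite spectral_measure_props(4)[OF B])
    also have "\<dots> = ennreal (\<Sum>k<4. (norm (u n k))\<^sup>2)" by (simp add: sum_ennreal)
    also have "(\<Sum>k<4::nat. (norm (u n k))\<^sup>2) \<le> (\<Sum>k<4::nat. 2 * ((norm (p n))\<^sup>2 + (norm (q n))\<^sup>2))"
      by (intro sum_mono un)
    finally show ?thesis by (simp add: ennreal_leI)
  qed
  have f\<nu>: "finite_measure \<nu>" unfolding \<nu>_def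
  proof (rule finite_sum_measure)
    have "(\<integral>\<^sup>+n. emeasure (\<rho> n) (space R) \<partial>count_space UNIV) \<le> (\<integral>\<^sup>+n. ennreal (8 * ((norm (p n))\<^sup>2 + (norm (q n))\<^sup>2)) \<partial>count_space UNIV)"
      by (intro nn_integral_mono) (use e\<rho> sR in auto)
    also have "\<dots> = (\<Sum>n. ennreal (8 * ((norm (p n))\<^sup>2 + (norm (q n))\<^sup>2)))" by (rule nn_integral_count_space_nat)
    also have "\<dots> < top"
      using s by (subst suminf_ennreal2) (auto intro!: summable_mult summable_add)
    finally show "(\<integral>\<^sup>+n. emeasure (\<rho> n) (space R) \<partial>count_space UNIV) < top" .
  qed (rule s\<rho>)
  show ?thesis
  proof (rule that)
    show "sets \<nu> = sets (restrict_space borel circle)" by (simp add: \<nu>_def R_def)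
    show "finite_measure \<nu>" by (rule f\<nu>)
    fix D h assume D: "is_borel_calculus B h D" and h: "h \<in> Linf"
    obtain C where "\<forall>s\<in>circle. norm (h s) \<le> C" using Linf_bounded[OF h] by blast
    then have C: "h \<in> borel_measurable R" "\<And>s. s \<in> space R \<Longrightarrow> norm (h s) \<le> C"
      using Linf_measurable[OF h] by (simp_all add: R_def space_restrict_space)
    have each: "norm (cinner ((a o\<^sub>L D) (p n)) (q n)) \<le> (\<integral>s. norm (h s) \<partial>\<rho> n)" for n
    proof -
      have "cinner ((a o\<^sub>L D) (p n)) (q n) = cinner (D (p n)) (r n)"
        using unitary_op_inv(6)[OF a] by (simp add: is_adjoint_def r_def)
      then have "norm (cinner ((a o\<^sub>L D) (p n)) (q n)) \<le> (\<Sum>k<4. \<integral>s. norm (h s) \<partial>spectral_measure B (u n k))"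
        using calculus_bound[OF B D h, of "p n" "r n"] by (simp add: u_def)
      also have "\<dots> \<le> (\<integral>s. norm (h s) \<partial>\<rho> n)"
        unfolding \<rho>_def by (rule integral_le_sum_measure[OF sR(1) _ C]) (use f\<rho>[of n] in \<open>auto simp: \<rho>_def\<close>)
      finally show ?thesis .
    qed
    have "norm (\<Sum>n<m. cinner ((a o\<^sub>L D) (p n)) (q n)) \<le> (\<integral>s. norm (h s) \<partial>\<nu>)" for m
    proof -
      have "norm (\<Sum>n<m. cinner ((a o\<^sub>L D) (p n)) (q n)) \<le> (\<Sum>n<m. \<integral>s. norm (h s) \<partial>\<rho> n)"
        by (intro order_trans[OF norm_sum] sum_mono each)
      also have "\<dots> \<le> (\<integral>s. norm (h s) \<partial>\<nu>)"
        unfolding \<nu>_def by (rule integral_le_sum_measure[OF s\<rho> _ C]) (use f\<nu> in \<open>auto simp: \<nu>_def\<close>)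
      finally show ?thesis .
    qed
    moreover have "(\<lambda>m. norm (\<Sum>n<m. cinner ((a o\<^sub>L D) (p n)) (q n))) \<longlonglongrightarrow> norm (f (a o\<^sub>L D))"
      unfolding fe by (intro tendsto_norm summable_LIMSEQ ultraweak_summable s)
    ultimately show "norm (f (a o\<^sub>L D)) \<le> (\<integral>s. norm (h s) \<partial>\<nu>)"
      by (intro LIMSEQ_le_const2) auto
  qed
qed

text \<open>The ultraweak topology is defined by a subbasis of preimages; induction over the generated
  topology produces basic neighbourhoods given by finitely many functionals.\<close>

lemma ultraweak_neighbourhood:
  fixes x :: "'h::chilbert_space \<Rightarrow>\<^sub>L 'h"
  assumes "openin ultraweak_topology T" "x \<in> T"
  obtains F \<delta> where "finite F" "F \<subseteq> ultraweak_functionals" "\<delta> > 0" "\<And>y. (\<forall>f\<in>F. norm (f y - f x) < \<delta>) \<Longrightarrow> y \<in> T"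
proof -
  have "generate_topology_on {f -` W | f W. f \<in> ultraweak_functionals \<and> open W} T"
    using assms(1) unfolding ultraweak_topology_def openin_topology_generated_by_iff .
  then have "x \<in> T \<longrightarrow> (\<exists>F \<delta>. finite F \<and> F \<subseteq> ultraweak_functionals \<and> \<delta> > 0 \<and> (\<forall>y. (\<forall>f\<in>F. norm (f y - f x) < \<delta>) \<longrightarrow> y \<in> T))"
  proof induction
    case (Int S T)
    show ?case
    proof
      assume "x \<in> S \<inter> T"
      then obtain F \<delta> F' \<delta>' where 1: "finite F" "F \<subseteq> ultraweak_functionals" "\<delta> > 0" "\<And>y. (\<forall>f\<in>F. norm (f y - f x) < \<delta>) \<Longrightarrow> y \<in> S"
        and 2: "finite F'" "F' \<subseteq> ultraweak_functionals" "\<delta>' > 0" "\<And>y. (\<forall>f\<in>F'. norm (f y - f x) < \<delta>') \<Longrightarrow> y \<in> T"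
        using Int by auto
      show "\<exists>F \<delta>. finite F \<and> F \<subseteq> ultraweak_functionals \<and> \<delta> > 0 \<and> (\<forall>y. (\<forall>f\<in>F. norm (f y - f x) < \<delta>) \<longrightarrow> y \<in> S \<inter> T)"
        using 1 2 by (intro exI[of _ "F \<union> F'"] exI[of _ "min \<delta> \<delta>'"]) auto
    qed
  next
    case (UN K)
    show ?case
    proof
      assume "x \<in> \<Union>K"
      then obtain k where k: "k \<in> K" "x \<in> k" by blast
      with UN(2)[OF k(1)] obtain F \<delta> where "finite F" "F \<subseteq> ultraweak_functionals" "\<delta> > 0" "\<And>y. (\<forall>f\<in>F. norm (f y - f x) < \<delta>) \<Longrightarrow> y \<in> k"
        by auto
      then show "\<exists>F \<delta>. finite F \<and> F \<subseteq> ultraweak_functionals \<and> \<delta> > 0 \<and> (\<forall>y. (\<forall>f\<in>F. norm (f y - f x) < \<delta>) \<longrightarrow> y \<in> \<Union>K)"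
        using k(1) by (intro exI[of _ F] exI[of _ \<delta>]) auto
    qed
  next
    case (Basis S)
    then obtain f W where S: "S = f -` W" "f \<in> ultraweak_functionals" "open W" by auto
    show ?case
    proof
      assume "x \<in> S"
      then obtain \<delta> where "\<delta> > 0" "\<And>z. dist z (f x) < \<delta> \<Longrightarrow> z \<in> W"
        using S(3) unfolding S(1) open_dist by auto
      then show "\<exists>F \<delta>. finite F \<and> F \<subseteq> ultraweak_functionals \<and> \<delta> > 0 \<and> (\<forall>y. (\<forall>f\<in>F. norm (f y - f x) < \<delta>) \<longrightarrow> y \<in> S)"
        using S(1,2) by (intro exI[of _ "{f}"] exI[of _ \<delta>]) (auto simp: dist_norm)
    qed
  qed auto
  then show ?thesis using assms(2) that by blast
qed

lemma ultraweak_imp_norm_tendsto: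
  assumes "f \<in> ultraweak_functionals" "X \<longlonglongrightarrow> x"
  shows "(\<lambda>n. f (X n)) \<longlonglongrightarrow> f x"
proof -
  obtain p q where fe: "f = (\<lambda>x. \<Sum>n. cinner (blinfun_apply x (p n)) (q n))"
    and s: "summable (\<lambda>n. (norm (p n))\<^sup>2)" "summable (\<lambda>n. (norm (q n))\<^sup>2)"
    using assms(1) unfolding ultraweak_functionals_def by blast
  define C where "C = (\<Sum>n. (norm (p n))\<^sup>2 + (norm (q n))\<^sup>2)"
  have sum: "summable (\<lambda>n. (norm (p n))\<^sup>2 + (norm (q n))\<^sup>2)" by (intro summable_add s)
  have bound: "norm (f z) \<le> norm z * C" for z
    unfolding fe C_def suminf_mult[OF sum, symmetric]
  proof (rule norm_suminf_le)
    show "summable (\<lambda>n. norm z * ((norm (p n))\<^sup>2 + (norm (q n))\<^sup>2))" by (intro summable_mult sum)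
  qed (rule norm_cinner_op_le)
  have "(\<lambda>n. norm (X n - x) * C) \<longlonglongrightarrow> 0 * C"
    using assms(2) by (intro tendsto_intros) (simp add: LIM_zero_iff tendsto_norm_zero_iff)
  then have "(\<lambda>n. f (X n) - f x) \<longlonglongrightarrow> 0"
    by (rule_tac Lim_null_comparison[where g = "\<lambda>n. norm (X n - x) * C"])
       (use bound in \<open>auto simp: ultraweak_diff[OF assms(1), symmetric]\<close>)
  then show ?thesis by (simp add: LIM_zero_iff)
qed

context tracial_vna
begin

sublocale M: op_algebra M
  by (rule von_neumann_op_algebra[OF vna])

text \<open>All elements of a von Neumann algebra have adjoints by definition, and a unitary element is a
  unitary operator in the sense above whose inverse, hence every integer power, stays in \<open>M\<close>.\<close>

lemma unitary_in_op:
  assumes "unitary_in M x"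
  shows "unitary_op x" "x \<in> M" "op_inv x \<in> M" "adj x = op_inv x" "op_powi x n \<in> M"
proof -
  have x: "x \<in> M" "adj x o\<^sub>L x = id_blinfun" "x o\<^sub>L adj x = id_blinfun"
    using assms by (auto simp: unitary_in_def)
  note a = von_neumann_adj[OF vna x(1)]
  have ab: "adj x \<in> bops" "x \<in> bops" using a x M.sub_bops by auto
  have "cinner (x u) (x v) = cinner u v" for u v
  proof -
    have "cinner (x u) (x v) = cinner u (adj x (x v))" using a(2) by (simp add: is_adjoint_def)
    also have "adj x (x v) = v" using x(2) by (metis blinfun_apply_blinfun_compose blinfun_apply_id_blinfun id_apply)
    finally show ?thesis .
  qed
  then show u: "unitary_op x" unfolding unitary_op_def using ab x by auto
  show "x \<in> M" by (rule x)
  show e: "adj x = op_inv x" by (rule unitary_op_inv(8)[OF u])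
  then show i: "op_inv x \<in> M" using a by simp
  show "op_powi x n \<in> M" by (rule M.op_powi_in[OF u x(1) i])
qed

lemma unitary_in_iff: "unitary_in M x \<longleftrightarrow> unitary_op x \<and> x \<in> M"
proof
  assume "unitary_op x \<and> x \<in> M"
  then show "unitary_in M x" using unitary_op_inv(1,2,8)[of x] by (simp add: unitary_in_def)
qed (simp add: unitary_in_op)

lemma unitary_in_mult: "unitary_in M x \<Longrightarrow> unitary_in M y \<Longrightarrow> unitary_in M (x o\<^sub>L y)"
  by (simp add: unitary_in_iff unitary_op_mult M.mult_in)

lemma unitary_in_inv: "unitary_in M x \<Longrightarrow> unitary_in M (op_inv x)"
  unfolding unitary_in_iff[of "op_inv x"] by (blast intro: unitary_in_op(1,3) unitary_op_inv(7))

lemma tr_minus: "x \<in> M \<Longrightarrow> \<tau> (- x) = - \<tau> x"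
  using tr_scale[of x "-1"] by (simp add: op_scale_minus1)

lemma tr_diff: "x \<in> M \<Longrightarrow> y \<in> M \<Longrightarrow> \<tau> (x - y) = \<tau> x - \<tau> y"
  using tr_add[of x "-y"] tr_minus[of y] M.minus_in[of y] by simp

lemma tr_neighbourhood:
  assumes "x \<in> M" "e > 0"
  obtains F \<delta> where "finite F" "F \<subseteq> ultraweak_functionals" "\<delta> > 0"
    "\<And>y. y \<in> M \<Longrightarrow> (\<forall>f\<in>F. norm (f y - f x) < \<delta>) \<Longrightarrow> norm (\<tau> y - \<tau> x) < e"
proof -
  have "openin (subtopology ultraweak_topology M) {y \<in> topspace (subtopology ultraweak_topology M). \<tau> y \<in> ball (\<tau> x) e}"
    using tr_normal by (rule openin_continuous_map_preimage) simp
  then obtain T where T: "openin ultraweak_topology T"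
    and eq: "{y \<in> topspace (subtopology ultraweak_topology M). \<tau> y \<in> ball (\<tau> x) e} = T \<inter> M"
    unfolding openin_subtopology by blast
  have top: "topspace ultraweak_topology = (UNIV :: ('h \<Rightarrow>\<^sub>L 'h) set)"
  proof -
    have "(\<lambda>x::'h \<Rightarrow>\<^sub>L 'h. \<Sum>n. cinner (x 0) 0) \<in> ultraweak_functionals"
      unfolding ultraweak_functionals_def by (auto intro!: exI[of _ "\<lambda>_. 0"])
    then show ?thesis unfolding ultraweak_topology_def by (auto intro!: exI[of _ UNIV])
  qed
  have "x \<in> T" using eq assms top by auto
  from ultraweak_neighbourhood[OF T this] obtain F \<delta> where F: "finite F" "F \<subseteq> ultraweak_functionals" "\<delta> > 0"
    "\<And>y. (\<forall>f\<in>F. norm (f y - f x) < \<delta>) \<Longrightarrow> y \<in> T" by metis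
  show ?thesis
  proof (rule that[OF F(1-3)])
    fix y assume y: "y \<in> M" "\<forall>f\<in>F. norm (f y - f x) < \<delta>"
    then have "y \<in> T \<inter> M" using F(4) by blast
    then show "norm (\<tau> y - \<tau> x) < e" unfolding eq[symmetric] by (simp add: dist_norm norm_minus_commute)
  qed
qed

text \<open>Normality implies norm continuity, since ultraweakly continuous functionals are norm continuous
  and a basic neighbourhood involves only finitely many of them.\<close>

lemma tr_tendsto:
  assumes "\<And>n. X n \<in> M" "X \<longlonglongrightarrow> x"
  shows "(\<lambda>n. \<tau> (X n)) \<longlonglongrightarrow> \<tau> x"
proof (rule LIMSEQ_I)
  fix e :: real assume e: "e > 0"
  have x: "x \<in> M" using M.lim_in assms by blast
  from tr_neighbourhood[OF x e] obtain F \<delta> where F: "finite F" "F \<subseteq> ultraweak_functionals" "\<delta> > 0"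
    "\<And>y. y \<in> M \<Longrightarrow> (\<forall>f\<in>F. norm (f y - f x) < \<delta>) \<Longrightarrow> norm (\<tau> y - \<tau> x) < e" by metis
  have "\<forall>\<^sub>F n in sequentially. norm (f (X n) - f x) < \<delta>" if "f \<in> F" for f
    using tendstoD[OF ultraweak_imp_norm_tendsto[OF _ assms(2)], of f \<delta>] F that by (auto simp: dist_norm)
  then have "\<forall>\<^sub>F n in sequentially. \<forall>f\<in>F. norm (f (X n) - f x) < \<delta>"
    using F(1) by (simp add: eventually_ball_finite)
  then show "\<exists>no. \<forall>n\<ge>no. norm (\<tau> (X n) - \<tau> x) < e"
    unfolding eventually_sequentially using F(4) assms(1) by meson
qed

text \<open>Normality of the trace enters through this approximation: the trigonometric polynomial \<open>g\<close>
  approximates \<open>h\<close> with respect to all the measures that control a basic ultraweak neighbourhood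
  and with respect to \<open>\<nu>0\<close>.\<close>

lemma normal_approximation:
  assumes B: "unitary_in M B" and a: "unitary_in M a" and x: "x \<in> M" "is_borel_calculus B h x" and h: "h \<in> Linf"
    and \<nu>0: "sets \<nu>0 = sets (restrict_space borel circle)" "finite_measure \<nu>0" and e: "e > 0"
  obtains g y where "(g, y) \<in> trig_op B" "(\<integral>s. norm (h s - g s) \<partial>\<nu>0) < e" "norm (\<tau> (a o\<^sub>L y) - \<tau> (a o\<^sub>L x)) < e"
proof -
  note Bu = unitary_in_op[OF B] note au = unitary_in_op[OF a]
  have ax: "a o\<^sub>L x \<in> M" using M.mult_in au x by blast
  from tr_neighbourhood[OF ax e] obtain F \<delta> where F: "finite F" "F \<subseteq> ultraweak_functionals" "\<delta> > 0"
    "\<And>y. y \<in> M \<Longrightarrow> (\<forall>f\<in>F. norm (f y - f (a o\<^sub>L x)) < \<delta>) \<Longrightarrow> norm (\<tau> y - \<tau> (a o\<^sub>L x)) < e" by metis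
  have "\<forall>f\<in>F. \<exists>\<nu>. sets \<nu> = sets (restrict_space borel circle) \<and> finite_measure \<nu> \<and>
      (\<forall>D h. is_borel_calculus B h D \<longrightarrow> h \<in> Linf \<longrightarrow> norm (f (a o\<^sub>L D)) \<le> (\<integral>s. norm (h s) \<partial>\<nu>))"
  proof
    fix f assume "f \<in> F"
    then have "f \<in> ultraweak_functionals" using F by blast
    from ultraweak_bound[OF this Bu(1) au(1)] show "\<exists>\<nu>. sets \<nu> = sets (restrict_space borel circle) \<and> finite_measure \<nu> \<and>
      (\<forall>D h. is_borel_calculus B h D \<longrightarrow> h \<in> Linf \<longrightarrow> norm (f (a o\<^sub>L D)) \<le> (\<integral>s. norm (h s) \<partial>\<nu>))" by metis
  qed
  then obtain \<nu> where \<nu>: "\<And>f. f \<in> F \<Longrightarrow> sets (\<nu> f) = sets (restrict_space borel circle)" "\<And>f. f \<in> F \<Longrightarrow> finite_measure (\<nu> f)"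
      "\<And>f D h. f \<in> F \<Longrightarrow> is_borel_calculus B h D \<Longrightarrow> h \<in> Linf \<Longrightarrow> norm (f (a o\<^sub>L D)) \<le> (\<integral>s. norm (h s) \<partial>(\<nu> f))"
    by metis
  define R where "R = (restrict_space borel circle :: complex measure)"
  define I where "I = insert \<nu>0 (\<nu> ` F)"
  define \<rho> where "\<rho> = sum_measure I (\<lambda>\<mu>. \<mu>) R"
  have I: "finite I" "\<And>\<mu>. \<mu> \<in> I \<Longrightarrow> sets \<mu> = sets R" "\<And>\<mu>. \<mu> \<in> I \<Longrightarrow> finite_measure \<mu>"
    using F(1) \<nu> \<nu>0 by (auto simp: I_def R_def)
  have s\<rho>: "sets \<rho> = sets (restrict_space borel circle)" by (simp add: \<rho>_def R_def)
  have f\<rho>: "finite_measure \<rho>" unfolding \<rho>_def by (rule finite_sum_measure_finite[OF I])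
  have m: "min e \<delta> > 0" using e F(3) by simp
  obtain g where g: "g \<in> trig1" "(\<integral>s. norm (h s - g s) \<partial>\<rho>) < min e \<delta>"
    using trig1.P_dense[OF s\<rho> f\<rho> Linf_integrable[OF h s\<rho> f\<rho>] m] by blast
  obtain y where y: "(g, y) \<in> trig_op B" using trig_op_exists[OF g(1)] by blast
  have hg: "(\<lambda>s. h s - g s) \<in> Linf" by (rule Linf_diff[OF h Linf_trig1[OF g(1)]])
  obtain C where "\<forall>s\<in>circle. norm (h s - g s) \<le> C" using Linf_bounded[OF hg] by blast
  then have C: "(\<lambda>s. h s - g s) \<in> borel_measurable R" "\<And>s. s \<in> space R \<Longrightarrow> norm (h s - g s) \<le> C"
    using Linf_measurable[OF hg] by (simp_all add: R_def space_restrict_space)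
  have le: "(\<integral>s. norm (h s - g s) \<partial>\<mu>) < min e \<delta>" if "\<mu> \<in> I" for \<mu>
  proof -
    have "(\<Sum>\<mu>\<in>{\<mu>}. \<integral>s. norm (h s - g s) \<partial>\<mu>) \<le> (\<integral>s. norm (h s - g s) \<partial>\<rho>)"
      unfolding \<rho>_def by (rule integral_le_sum_measure[OF I(2) _ C]) (use f\<rho> that in \<open>auto simp: \<rho>_def\<close>)
    then show ?thesis using g(2) by simp
  qed
  have yM: "y \<in> M"
    using trig_op_eval[OF y M.op_algebra_axioms Bu(5), where F = "\<lambda>_. 0" and \<Phi> = "\<lambda>_. 0"] by simp
  have ay: "a o\<^sub>L y \<in> M" using M.mult_in au yM by blast
  have "norm (\<tau> (a o\<^sub>L y) - \<tau> (a o\<^sub>L x)) < e"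
  proof (rule F(4)[OF ay], rule ballI)
    fix f assume f: "f \<in> F"
    then have fu: "f \<in> ultraweak_functionals" using F by blast
    have "norm (f (a o\<^sub>L y) - f (a o\<^sub>L x)) = norm (f (a o\<^sub>L (x - y)))"
      by (simp add: compose_simps ultraweak_diff[OF fu] norm_minus_commute)
    also have "\<dots> \<le> (\<integral>s. norm (h s - g s) \<partial>(\<nu> f))"
      by (rule \<nu>(3)[OF f calculus_diff[OF Bu(1) x(2) h y] hg])
    also have "\<dots> < \<delta>" using le[of "\<nu> f"] f by (auto simp: I_def)
    finally show "norm (f (a o\<^sub>L y) - f (a o\<^sub>L x)) < \<delta>" .
  qed
  moreover have "(\<integral>s. norm (h s - g s) \<partial>\<nu>0) < e" using le[of \<nu>0] by (auto simp: I_def)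
  ultimately show ?thesis using that y by blast
qed

text \<open>For \<open>h\<close> a trigonometric polynomial this is the definition of the joint moments. In general the
  difference of the two sides is smaller than every \<open>2e\<close>, by approximation of \<open>h\<close> with respect to the
  second marginal of \<open>\<mu>\<close> and to the measures controlling the trace.\<close>

lemma trace_borel_calculus:
  assumes A: "unitary_in M A" and B: "unitary_in M B" and x: "x \<in> M" "is_borel_calculus B h x" and h: "h \<in> Linf"
    and \<mu>: "has_torus_moments \<mu> (\<lambda>n m. \<tau> (op_powi A n o\<^sub>L op_powi B m))"
  shows "\<tau> (op_powi A n o\<^sub>L x) = (\<integral>p. fst p powi n * h (snd p) \<partial>\<mu>)"
proof (rule ccontr)
  note Bu = unitary_in_op[OF B]
  have a: "unitary_in M (op_powi A n)"
    unfolding unitary_in_iff[of "op_powi A n"] using unitary_in_op(1,5)[OF A] op_powi_unitary[of A n] by simp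
  note au = unitary_in_op[OF a]
  assume ne: "\<not> ?thesis"
  define e where "e = norm (\<tau> (op_powi A n o\<^sub>L x) - (\<integral>p. fst p powi n * h (snd p) \<partial>\<mu>)) / 2"
  have e: "e > 0" using ne by (simp add: e_def)
  have s\<mu>: "sets \<mu> = sets (restrict_space borel torus)" and f\<mu>: "finite_measure \<mu>" using \<mu> by (auto simp: has_torus_moments_def)
  have sp: "space \<mu> = torus" using sets_eq_imp_space_eq[OF s\<mu>] by (simp add: space_restrict_space)
  interpret \<mu>: finite_measure \<mu> by (rule f\<mu>)
  note sm = measurable_torus_coordinates(2)[OF s\<mu>]
  define \<nu>0 where "\<nu>0 = distr \<mu> (restrict_space borel circle) snd"
  have \<nu>0: "sets \<nu>0 = sets (restrict_space borel circle)" "finite_measure \<nu>0"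
    unfolding \<nu>0_def by (simp_all add: \<mu>.finite_measure_distr[OF sm])
  obtain g y where gy: "(g, y) \<in> trig_op B" "(\<integral>s. norm (h s - g s) \<partial>\<nu>0) < e" "norm (\<tau> (op_powi A n o\<^sub>L y) - \<tau> (op_powi A n o\<^sub>L x)) < e"
    by (rule normal_approximation[OF B a x h \<nu>0 e])
  have i: "integrable \<mu> (\<lambda>p. fst p powi n * k (snd p))" if k: "k \<in> Linf" for k
  proof -
    obtain C where C: "\<forall>s\<in>circle. norm (k s) \<le> C" using Linf_bounded[OF k] by blast
    have "(\<lambda>p. k (snd p)) \<in> borel_measurable \<mu>"
      using measurable_comp[OF sm Linf_measurable[OF k]] by (simp add: comp_def)
    moreover have "(\<lambda>p. fst p powi n) \<in> borel_measurable \<mu>"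
      using measurable_comp[OF measurable_torus_coordinates(1)[OF s\<mu>] trig1.P_measurable[OF trig1_mono]] by (simp add: comp_def)
    moreover have "norm (fst p powi n * k (snd p)) \<le> C" if "p \<in> space \<mu>" for p
      using that C by (auto simp: sp norm_mult norm_power_int)
    ultimately show ?thesis by (intro \<mu>.integrable_const_bound[of _ C]) auto
  qed
  have gt: "g \<in> trig1" by (rule trig_op_spectral(1)[OF Bu(1) gy(1)])
  have "g \<in> trig1 \<and> y \<in> M \<and> (\<integral>p. fst p powi n * g (snd p) \<partial>\<mu>) = \<tau> (op_powi A n o\<^sub>L y)"
  proof (rule trig_op_eval[OF gy(1) M.op_algebra_axioms Bu(5), where F = "\<lambda>y. \<tau> (op_powi A n o\<^sub>L y)" and \<Phi> = "\<lambda>g. \<integral>p. fst p powi n * g (snd p) \<partial>\<mu>"])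
    show "\<tau> (op_powi A n o\<^sub>L (x + y)) = \<tau> (op_powi A n o\<^sub>L x) + \<tau> (op_powi A n o\<^sub>L y)" if "x \<in> M" "y \<in> M" for x y
      using that au by (simp add: compose_simps tr_add M.mult_in)
    show "\<tau> (op_powi A n o\<^sub>L op_scale c x) = c * \<tau> (op_powi A n o\<^sub>L x)" if "x \<in> M" for c x
      using that au by (simp add: M.compose_scale tr_scale M.mult_in)
    show "(\<integral>p. fst p powi n * (f (snd p) + g (snd p)) \<partial>\<mu>) = (\<integral>p. fst p powi n * f (snd p) \<partial>\<mu>) + (\<integral>p. fst p powi n * g (snd p) \<partial>\<mu>)"
      if "f \<in> trig1" "g \<in> trig1" for f g
      using i[OF Linf_trig1[OF that(1)]] i[OF Linf_trig1[OF that(2)]] by (simp add: distrib_left)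
    show "(\<integral>p. fst p powi n * (c * f (snd p)) \<partial>\<mu>) = c * (\<integral>p. fst p powi n * f (snd p) \<partial>\<mu>)" for f c
      by (simp add: mult.left_commute)
    show "(\<integral>p. fst p powi n * snd p powi m \<partial>\<mu>) = \<tau> (op_powi A n o\<^sub>L op_powi B m)" for m
      using \<mu> by (simp add: has_torus_moments_def)
  qed
  then have gyi: "(\<integral>p. fst p powi n * g (snd p) \<partial>\<mu>) = \<tau> (op_powi A n o\<^sub>L y)" by simp
  have hg: "(\<lambda>s. h s - g s) \<in> Linf" by (rule Linf_diff[OF h Linf_trig1[OF gt]])
  have nm: "(\<lambda>s. norm (h s - g s)) \<in> borel_measurable (restrict_space borel circle)"
    using Linf_measurable[OF hg] by measurable
  have "norm (\<tau> (op_powi A n o\<^sub>L y) - (\<integral>p. fst p powi n * h (snd p) \<partial>\<mu>)) = norm (\<integral>p. fst p powi n * (h (snd p) - g (snd p)) \<partial>\<mu>)"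
    unfolding gyi[symmetric] using i[OF h] i[OF Linf_trig1[OF gt]] by (simp add: right_diff_distrib norm_minus_commute)
  also have "\<dots> \<le> (\<integral>p. norm (fst p powi n * (h (snd p) - g (snd p))) \<partial>\<mu>)" by (rule integral_norm_bound)
  also have "\<dots> = (\<integral>p. norm (h (snd p) - g (snd p)) \<partial>\<mu>)"
    by (intro Bochner_Integration.integral_cong) (auto simp: sp norm_mult norm_power_int)
  also have "\<dots> = (\<integral>s. norm (h s - g s) \<partial>\<nu>0)" unfolding \<nu>0_def by (rule integral_distr[OF sm nm, symmetric])
  finally have "norm (\<tau> (op_powi A n o\<^sub>L y) - (\<integral>p. fst p powi n * h (snd p) \<partial>\<mu>)) < e" using gy(2) by simp
  then have "norm (\<tau> (op_powi A n o\<^sub>L x) - (\<integral>p. fst p powi n * h (snd p) \<partial>\<mu>)) < 2 * e"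
    using gy(3) norm_triangle_ineq4[of "\<tau> (op_powi A n o\<^sub>L y) - (\<integral>p. fst p powi n * h (snd p) \<partial>\<mu>)" "\<tau> (op_powi A n o\<^sub>L y) - \<tau> (op_powi A n o\<^sub>L x)"]
    by simp
  then show False by (simp add: e_def)
qed

end

section \<open>The transform \<open>\<psi>\<close> and its compositional inverse\<close>

text \<open>What the power series of \<open>\<psi>\<close> needs from a state. The locale is used for the trace on \<open>M\<close>, for the
  trace on the norm-closed algebra generated by one unitary, and for the vector state on the bounded
  operators of the GNS space.\<close>

locale op_state = op_algebra N
  for N :: "('h::chilbert_space \<Rightarrow>\<^sub>L 'h) set" +
  fixes \<phi> :: "('h \<Rightarrow>\<^sub>L 'h) \<Rightarrow> complex"
  assumes \<phi>_add: "x \<in> N \<Longrightarrow> y \<in> N \<Longrightarrow> \<phi> (x + y) = \<phi> x + \<phi> y"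
    and \<phi>_scale: "x \<in> N \<Longrightarrow> \<phi> (op_scale c x) = c * \<phi> x"
    and \<phi>_tendsto: "(\<And>n. X n \<in> N) \<Longrightarrow> X \<longlonglongrightarrow> x \<Longrightarrow> (\<lambda>n. \<phi> (X n)) \<longlonglongrightarrow> \<phi> x"

lemma vec_op_state: "op_state bops (\<lambda>X. cinner (blinfun_apply X v) v)"
proof -
  interpret op_algebra "bops :: ('a \<Rightarrow>\<^sub>L 'a) set" by (rule bops_algebra)
  show ?thesis
    by unfold_locales (auto simp: blinfun.bilinear_simps cinner_simps intro!: tendsto_cinner blinfun.tendsto)
qed

context tracial_vna
begin

sublocale M: op_state M \<tau>
  by unfold_locales (auto simp: tr_add tr_scale intro: tr_tendsto)

end

abbreviation res :: "complex \<Rightarrow> ('h::chilbert_space \<Rightarrow>\<^sub>L 'h) \<Rightarrow> 'h \<Rightarrow>\<^sub>L 'h" where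
  "res z A \<equiv> op_inv (id_blinfun - op_scale z A)"

lemma norm_scaled_unitary:
  assumes "unitary_op A" "norm z < 1" shows "norm (op_scale z A) < 1"
proof -
  have "norm (op_scale z A) \<le> norm z * norm A" by (rule norm_op_scale)
  also have "\<dots> \<le> norm z * 1" using unitary_op_norm_le[OF assms(1)] by (intro mult_left_mono) auto
  finally show ?thesis using assms(2) by simp
qed

lemma res_inverse:
  assumes "unitary_op A" "norm z < 1"
  shows "(id_blinfun - op_scale z A) o\<^sub>L res z A = id_blinfun" "res z A o\<^sub>L (id_blinfun - op_scale z A) = id_blinfun"
  using neumann(2,3)[OF norm_scaled_unitary[OF assms]] .

lemma res_sums:
  assumes "unitary_op A" "norm z < 1"
  shows "(\<lambda>n. op_scale (z ^ n) (op_powi A (int n))) sums res z A"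
proof -
  have "opow (op_scale z A) = (\<lambda>n. op_scale (z ^ n) (opow A n))"
    by (rule ext) (rule opow_scale[OF unitary_op_inv(4)[OF assms(1)]])
  then show ?thesis using neumann(1)[OF norm_scaled_unitary[OF assms]] by simp
qed

lemma res_eqs:
  assumes "unitary_op A" "norm z < 1"
  shows "op_scale z A o\<^sub>L res z A = res z A - id_blinfun" "res z A o\<^sub>L op_scale z A = res z A - id_blinfun"
  using res_inverse[OF assms] by (simp_all add: compose_simps algebra_simps)

context op_state
begin

lemma \<phi>_zero: "\<phi> 0 = 0"
  using \<phi>_scale[OF one_in, of 0] by simp

lemma \<phi>_minus: "x \<in> N \<Longrightarrow> \<phi> (- x) = - \<phi> x"
  using \<phi>_scale[of x "-1"] by (simp add: op_scale_minus1)

lemma \<phi>_diff: "x \<in> N \<Longrightarrow> y \<in> N \<Longrightarrow> \<phi> (x - y) = \<phi> x - \<phi> y"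
  using \<phi>_add[of x "-y"] \<phi>_minus[of y] minus_in[of y] by simp

lemma \<phi>_sum: "(\<And>i. i \<in> I \<Longrightarrow> f i \<in> N) \<Longrightarrow> \<phi> (sum f I) = (\<Sum>i\<in>I. \<phi> (f i))"
  by (induction I rule: infinite_finite_induct) (auto simp: \<phi>_zero \<phi>_add sum_in)

lemma \<phi>_sums:
  assumes "\<And>n. f n \<in> N" "f sums x" shows "(\<lambda>n. \<phi> (f n)) sums \<phi> x" "x \<in> N"
proof -
  have "(\<lambda>n. \<phi> (sum f {..<n})) \<longlonglongrightarrow> \<phi> x"
    using assms by (intro \<phi>_tendsto sum_in) (auto simp: sums_def)
  then show "(\<lambda>n. \<phi> (f n)) sums \<phi> x" using assms(1) by (simp add: \<phi>_sum sums_def)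
  show "x \<in> N"
  proof (rule lim_in)
    show "sum f {..<n} \<in> N" for n by (rule sum_in) (rule assms(1))
    show "(\<lambda>n. sum f {..<n}) \<longlonglongrightarrow> x" using assms(2) by (simp add: sums_def)
  qed
qed

context
  fixes A assumes A: "unitary_op A" and AN: "\<And>n. op_powi A n \<in> N"
begin

lemma A_in: "A \<in> N" "op_inv A \<in> N"
  using AN[of 1] AN[of "-1"] by (simp_all add: op_powi_minus_1[OF A])

lemma res_in:
  assumes "norm z < 1" shows "res z A \<in> N"
  by (rule \<phi>_sums(2)[OF _ res_sums[OF A assms]]) (rule scale_in[OF AN])

lemma \<phi>_res_sums:
  assumes "norm z < 1" shows "(\<lambda>n. \<phi> (op_powi A (int n)) * z ^ n) sums \<phi> (res z A)"
  using \<phi>_sums(1)[OF scale_in[OF AN] res_sums[OF A assms]] by (simp add: \<phi>_scale[OF AN] mult.commute del: op_powi_int)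

lemma psi_res:
  assumes "norm z < 1" shows "psi \<phi> A z = \<phi> (res z A) - \<phi> id_blinfun"
  unfolding psi_def res_eqs[OF A assms] using res_in[OF assms] one_in by (simp add: \<phi>_diff)

text \<open>Outside the unit disc \<open>1 - zA = -zA (1 - z\<^sup>-\<^sup>1 A\<^sup>-\<^sup>1)\<close>; with \<open>W = (1 - z\<^sup>-\<^sup>1 A\<^sup>-\<^sup>1)\<^sup>-\<^sup>1\<close> the inverse of
  \<open>1 - zA\<close> is \<open>1 - W\<close>, and \<open>zA (1 - W) = -W\<close>.\<close>

lemma psi_outside:
  assumes z: "norm z > 1" shows "psi \<phi> A z = - \<phi> (res (1 / z) (op_inv A))"
proof -
  have z1: "norm (1 / z) < 1" "z \<noteq> 0" using z by (auto simp: norm_divide divide_less_eq)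
  define W where "W = res (1 / z) (op_inv A)"
  note Ai = unitary_op_inv(7)[OF A]
  note W = res_eqs[OF Ai z1(1), folded W_def]
  note AA = unitary_op_inv(1,2)[OF A]
  have Wb: "W \<in> bops"
  proof -
    interpret b: op_state bops "\<lambda>X. cinner (blinfun_apply X v) v" for v by (rule vec_op_state)
    show ?thesis unfolding W_def
      by (rule b.res_in[OF Ai unitary_op_inv(4)[OF op_powi_unitary[OF Ai]] z1(1)])
  qed
  note Ab = unitary_op_inv(4)[OF A]
  have 1: "op_scale z A o\<^sub>L W = op_scale z A + W"
  proof -
    have "op_scale z A o\<^sub>L (op_scale (1 / z) (op_inv A) o\<^sub>L W) = op_scale z A o\<^sub>L (W - id_blinfun)" by (simp only: W(1))
    moreover have "op_scale z A o\<^sub>L (op_scale (1 / z) (op_inv A) o\<^sub>L W) = W"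
      using z1(2) by (simp add: op_scale_compose_left op_scale_compose_right[OF Ab] op_scale_scale compose_cancel[OF AA(1)])
    ultimately show ?thesis by (simp add: compose_simps algebra_simps)
  qed
  have 2: "W o\<^sub>L op_scale z A = op_scale z A + W"
  proof -
    have "(W o\<^sub>L op_scale (1 / z) (op_inv A)) o\<^sub>L op_scale z A = (W - id_blinfun) o\<^sub>L op_scale z A" by (simp only: W(2))
    moreover have "(W o\<^sub>L op_scale (1 / z) (op_inv A)) o\<^sub>L op_scale z A = W"
      using z1(2) by (simp add: compose_assoc op_scale_compose_left op_scale_compose_right[OF unitary_op_inv(3)[OF A]] op_scale_scale AA(2))
    ultimately show ?thesis by (simp add: compose_simps algebra_simps)
  qed
  have "res z A = id_blinfun - W"
    by (rule op_inv_eqI) (simp_all add: compose_simps 1 2)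
  then have "op_scale z A o\<^sub>L res z A = - W" by (simp add: compose_simps 1)
  moreover have "W \<in> N"
  proof -
    have "op_powi (op_inv A) n \<in> N" for n
      by (rule op_powi_in) (use Ai A_in unitary_op_inv(5)[OF A] in auto)
    from \<phi>_sums(2)[OF scale_in[OF this] res_sums[OF Ai z1(1)]] show ?thesis unfolding W_def .
  qed
  ultimately show ?thesis unfolding psi_def W_def[symmetric] by (simp add: \<phi>_minus)
qed

lemma psi_holomorphic: "psi \<phi> A holomorphic_on ball 0 1"
proof -
  have "(\<lambda>z. \<phi> (res z A)) holomorphic_on ball 0 1"
    by (rule power_series_holomorphic[where a = "\<lambda>n. \<phi> (op_powi A (int n))"])
       (use \<phi>_res_sums in \<open>simp del: op_powi_int\<close>)
  then have "(\<lambda>z. \<phi> (res z A) - \<phi> id_blinfun) holomorphic_on ball 0 1" by (intro holomorphic_intros)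
  then show ?thesis by (rule holomorphic_transform) (simp add: psi_res)
qed

lemma psi_0: "psi \<phi> A 0 = 0"
  by (simp add: psi_def \<phi>_zero)

text \<open>The quotient \<open>\<psi>(z) / z\<close> is again a power series, with value \<open>\<phi>(A)\<close> at \<open>0\<close>.\<close>

lemma deriv_psi_0: "deriv (psi \<phi> A) 0 = \<phi> A"
proof -
  let ?a = "\<lambda>n. \<phi> (op_powi A (int n))"
  have s: "(\<lambda>n. ?a (Suc n) * z ^ n) sums (if z = 0 then \<phi> A else psi \<phi> A z / z)" if z: "norm z < 1" for z
  proof (cases "z = 0")
    case True
    have "(\<lambda>n. ?a (Suc n) * 0 ^ n) sums ?a (Suc 0)"
      using sums_If_finite_set[of "{0::nat}" "\<lambda>n. ?a (Suc n) * 0 ^ n"] powser_sums_zero[of "\<lambda>n. ?a (Suc n)"] by simp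
    then show ?thesis using True by simp
  next
    case False
    have "(\<lambda>n. ?a (Suc n) * z ^ Suc n) sums (\<phi> (res z A) - ?a 0 * z ^ 0)"
      using \<phi>_res_sums[OF z] sums_Suc_iff[of "\<lambda>n. ?a n * z ^ n"] by simp
    then have "(\<lambda>n. ?a (Suc n) * z ^ Suc n / z) sums (psi \<phi> A z / z)"
      using psi_res[OF z] by (intro sums_divide) simp
    then show ?thesis using False by simp
  qed
  define k where "k z = (if z = 0 then \<phi> A else psi \<phi> A z / z)" for z
  have "k holomorphic_on ball 0 1"
    by (rule power_series_holomorphic[where a = "\<lambda>n. ?a (Suc n)"]) (use s in \<open>simp add: k_def del: op_powi_int\<close>)
  then have "(k has_field_derivative deriv k 0) (at 0)" by (rule holomorphic_derivI) auto
  from DERIV_mult[OF DERIV_ident this] have "((\<lambda>z. z * k z) has_field_derivative k 0) (at 0)" by simp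
  then have "((\<lambda>z. z * k z) has_field_derivative \<phi> A) (at 0)" by (simp add: k_def[of 0])
  moreover have "(\<lambda>z. z * k z) = psi \<phi> A" by (auto simp: k_def psi_0)
  ultimately show ?thesis by (simp add: DERIV_imp_deriv)
qed

end
end

text \<open>The function \<open>\<psi>\<close> is the power series of the positive moments inside the disc and of the negative
  moments outside of it.\<close>

lemma psi_cong:
  assumes 1: "op_state N \<phi>" "unitary_op A" "\<And>n. op_powi A n \<in> N"
    and 2: "op_state N' \<phi>'" "unitary_op A'" "\<And>n. op_powi A' n \<in> N'"
    and eq: "\<And>n. \<phi> (op_powi A n) = \<phi>' (op_powi A' n)" and z: "norm z \<noteq> 1"
  shows "psi \<phi> A z = psi \<phi>' A' z"
proof -
  interpret a: op_state N \<phi> by fact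
  interpret b: op_state N' \<phi>' by fact
  show ?thesis
  proof (cases "norm z < 1")
    case True
    have "\<phi> (res z A) = \<phi>' (res z A')"
      using a.\<phi>_res_sums[OF 1(2,3) True] b.\<phi>_res_sums[OF 2(2,3) True] unfolding eq by (rule sums_unique2)
    moreover have "\<phi> id_blinfun = \<phi>' id_blinfun" using eq[of 0] by simp
    ultimately show ?thesis by (simp add: a.psi_res[OF 1(2,3) True] b.psi_res[OF 2(2,3) True])
  next
    case False
    then have z: "norm z > 1" using z by simp
    then have z: "norm z > 1" "norm (1 / z) < 1" by (auto simp: norm_divide divide_less_eq)
    have p: "op_powi (op_inv A) (int n) = op_powi A (- int n)" if "unitary_op A" for A :: "'x::chilbert_space \<Rightarrow>\<^sub>L 'x" and n
    proof (induction n)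
      case (Suc n)
      have "- int (Suc n) = - int n - 1" by simp
      then have "op_powi A (- int (Suc n)) = op_inv A o\<^sub>L op_powi A (- int n)"
        using op_powi_pred[OF that, of "- int n"] by (simp only:)
      then show ?case using Suc by (simp del: of_nat_Suc)
    qed simp
    have "\<phi> (res (1 / z) (op_inv A)) = \<phi>' (res (1 / z) (op_inv A'))"
    proof (rule sums_unique2)
      have i: "op_powi (op_inv A) n \<in> N" for n
        by (rule a.op_powi_in) (use a.A_in[OF 1(2,3)] unitary_op_inv(5,7)[OF 1(2)] in auto)
      have i': "op_powi (op_inv A') n \<in> N'" for n
        by (rule b.op_powi_in) (use b.A_in[OF 2(2,3)] unitary_op_inv(5,7)[OF 2(2)] in auto)
      show "(\<lambda>n. \<phi> (op_powi (op_inv A) (int n)) * (1 / z) ^ n) sums \<phi> (res (1 / z) (op_inv A))"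
        by (rule a.\<phi>_res_sums[OF unitary_op_inv(7)[OF 1(2)] i z(2)])
      show "(\<lambda>n. \<phi> (op_powi (op_inv A) (int n)) * (1 / z) ^ n) sums \<phi>' (res (1 / z) (op_inv A'))"
        using b.\<phi>_res_sums[OF unitary_op_inv(7)[OF 2(2)] i' z(2)] by (simp only: p[OF 1(2)] p[OF 2(2)] eq)
    qed
    then show ?thesis by (simp add: a.psi_outside[OF 1(2,3) z(1)] b.psi_outside[OF 2(2,3) z(1)])
  qed
qed

text \<open>A nonzero derivative makes \<open>f\<close> injective on a disc, and the inverse is holomorphic on the open image.\<close>

lemma local_inverse_exists:
  assumes f: "f holomorphic_on ball 0 r" "r > 0" and f0: "f 0 = 0" and d: "deriv f 0 \<noteq> 0"
  shows "is_local_inverse f (local_inverse f)"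
proof -
  obtain \<rho> where \<rho>: "\<rho> > 0" "ball 0 \<rho> \<subseteq> ball (0::complex) r" "inj_on f (ball 0 \<rho>)"
    by (rule has_complex_derivative_locally_injective[OF f(1) _ open_ball d]) (use f(2) in auto)
  have hol: "f holomorphic_on ball 0 \<rho>" using f(1) \<rho>(2) holomorphic_on_subset by blast
  obtain h where h: "h holomorphic_on (f ` ball 0 \<rho>)" "\<And>z. z \<in> ball 0 \<rho> \<Longrightarrow> h (f z) = z"
    by (rule holomorphic_has_inverse[OF hol open_ball \<rho>(3)]) blast
  have op: "open (f ` ball 0 \<rho>)" by (rule open_mapping_thm3[OF hol open_ball \<rho>(3)])
  have z0: "0 \<in> f ` ball 0 \<rho>" using f0 \<rho>(1) by (intro image_eqI[of _ _ 0]) auto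
  have "is_local_inverse f h"
    unfolding is_local_inverse_def
  proof (intro conjI)
    show "h analytic_on {0}"
      using h(1) op z0 analytic_on_open analytic_on_subset by (metis empty_subsetI insert_subset)
    show "h 0 = 0" using h(2)[of 0] f0 \<rho>(1) by simp
    show "\<forall>\<^sub>F w in nhds 0. f (h w) = w"
      using eventually_nhds_in_open[OF op z0] by eventually_elim (use h(2) in auto)
    show "\<forall>\<^sub>F z in nhds 0. h (f z) = z"
      using eventually_nhds_in_open[OF open_ball, of 0 0 \<rho>] \<rho>(1)
      by (auto elim!: eventually_mono simp: h(2))
  qed
  then show ?thesis unfolding local_inverse_def by (rule someI[of "is_local_inverse f"])
qed

lemma local_inverse_tendsto:
  assumes "is_local_inverse f h" shows "(h \<longlongrightarrow> 0) (nhds 0)"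
proof -
  have "isCont h 0" using assms unfolding is_local_inverse_def
    by (meson analytic_at_imp_isCont)
  then show ?thesis using assms by (simp add: isCont_def tendsto_at_iff_tendsto_nhds is_local_inverse_def)
qed

text \<open>Apply \<open>h\<close> to \<open>f (k w) = w\<close>: near \<open>0\<close> a right inverse is the compositional inverse.\<close>

lemma local_inverse_unique:
  assumes "is_local_inverse f h" and k: "(k \<longlongrightarrow> 0) (nhds 0)" "\<forall>\<^sub>F w in nhds 0. f (k w) = w"
  shows "\<forall>\<^sub>F w in nhds 0. h w = k w"
proof -
  have "\<forall>\<^sub>F z in nhds 0. h (f z) = z" using assms(1) by (simp add: is_local_inverse_def)
  then have "\<forall>\<^sub>F w in nhds 0. h (f (k w)) = k w" using k(1) by (rule eventually_compose_filterlim)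
  with k(2) show ?thesis by eventually_elim simp
qed

section \<open>Free independence: products of alternating centred elements\<close>

text \<open>The products of centred elements that freeness annihilates, in a form suited to induction: the
  index records to which algebra the leftmost factor belongs.\<close>

inductive alternating :: "('i \<Rightarrow> ('h::chilbert_space \<Rightarrow>\<^sub>L 'h) set) \<Rightarrow> (('h \<Rightarrow>\<^sub>L 'h) \<Rightarrow> complex) \<Rightarrow> 'i \<Rightarrow> ('h \<Rightarrow>\<^sub>L 'h) \<Rightarrow> bool"
  for S \<tau> where
  single: "x \<in> S i \<Longrightarrow> \<tau> x = 0 \<Longrightarrow> alternating S \<tau> i x"
| cons: "x \<in> S i \<Longrightarrow> \<tau> x = 0 \<Longrightarrow> i \<noteq> j \<Longrightarrow> alternating S \<tau> j y \<Longrightarrow> alternating S \<tau> i (x o\<^sub>L y)"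

definition gen_alg :: "('h::chilbert_space \<Rightarrow>\<^sub>L 'h) \<Rightarrow> ('h \<Rightarrow>\<^sub>L 'h) \<Rightarrow> bool \<Rightarrow> ('h \<Rightarrow>\<^sub>L 'h) set" where
  "gen_alg U V b = (if b then star_alg V else star_alg U)"

text \<open>This translates between the inductive description and the words in the definition of freeness.\<close>

lemma alternating_word:
  assumes "alternating (gen_alg U V) \<tau> b x"
  shows "\<exists>ws. ws \<noteq> [] \<and> fst (hd ws) = (if b then 1 else 0) \<and>
    (\<forall>(i, x) \<in> set ws. i < 2 \<and> x \<in> star_alg ([U, V] ! i) \<and> \<tau> x = 0) \<and>
    (\<forall>j. Suc j < length ws \<longrightarrow> fst (ws ! j) \<noteq> fst (ws ! Suc j)) \<and>
    foldr (o\<^sub>L) (map snd ws) id_blinfun = x"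
  using assms
proof (induction rule: alternating.induct)
  case (single x b)
  then show ?case by (intro exI[of _ "[(if b then 1 else 0, x)]"]) (auto simp: gen_alg_def)
next
  case (cons x b b' y)
  then obtain ws where ws: "ws \<noteq> []" "fst (hd ws) = (if b' then 1 else 0)"
    "\<forall>(i, x) \<in> set ws. i < 2 \<and> x \<in> star_alg ([U, V] ! i) \<and> \<tau> x = 0"
    "\<And>j. Suc j < length ws \<Longrightarrow> fst (ws ! j) \<noteq> fst (ws ! Suc j)"
    "foldr (o\<^sub>L) (map snd ws) id_blinfun = y" by auto
  let ?ws = "(if b then 1 else 0, x) # ws"
  have alt: "fst (?ws ! j) \<noteq> fst (?ws ! Suc j)" if "Suc j < length ?ws" for j
  proof (cases j)
    case 0
    have "ws ! 0 = hd ws" using ws(1) by (simp add: hd_conv_nth)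
    then show ?thesis using 0 ws(2) \<open>b \<noteq> b'\<close> by auto
  next
    case (Suc k)
    then show ?thesis using ws(4)[of k] that by simp
  qed
  show ?case
  proof (intro exI[of _ ?ws] conjI allI impI)
    show "\<forall>(i, x)\<in>set ?ws. i < 2 \<and> x \<in> star_alg ([U, V] ! i) \<and> \<tau> x = 0"
      using ws(3) cons(1,2) by (auto simp: gen_alg_def split: if_splits)
    show "foldr (o\<^sub>L) (map snd ?ws) id_blinfun = x o\<^sub>L y" using ws(5) by simp
  qed (use alt in auto)
qed

lemma alternating_trace_zero:
  assumes free: "freely_independent \<tau> [U, V]" and "alternating (gen_alg U V) \<tau> b x"
  shows "\<tau> x = 0"
proof -
  obtain ws where ws: "ws \<noteq> []" "\<forall>(i, x) \<in> set ws. i < 2 \<and> x \<in> star_alg ([U, V] ! i) \<and> \<tau> x = 0"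
    "\<forall>j. Suc j < length ws \<longrightarrow> fst (ws ! j) \<noteq> fst (ws ! Suc j)"
    "foldr (o\<^sub>L) (map snd ws) id_blinfun = x" using alternating_word[OF assms(2)] by (elim exE conjE) (rule that)
  have "(\<forall>(i, x) \<in> set ws. i < length [U, V] \<and> x \<in> star_alg ([U, V] ! i) \<and> \<tau> x = 0)"
    using ws(2) by (simp add: numeral_2_eq_2)
  then have "\<tau> (foldr (o\<^sub>L) (map snd ws) id_blinfun) = 0"
    by (rule free[unfolded freely_independent_def, THEN HOL.spec, THEN mp, THEN mp, THEN mp, OF ws(1) _ ws(3)])
  then show ?thesis using ws(4) by simp
qed

context tracial_vna
begin

lemma star_alg_sub:
  assumes "a \<in> M" "x \<in> star_alg a" shows "x \<in> M"
  using assms(2)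
  by (induction rule: star_alg.induct)
     (auto intro: M.one_in M.add_in M.scale_in M.mult_in assms(1) von_neumann_adj(1)[OF vna assms(1)])

lemma closure_star_alg_sub: "a \<in> M \<Longrightarrow> closure (star_alg a) \<subseteq> M"
  by (intro closure_minimal M.closed_in subsetI) (rule star_alg_sub)

definition cl_alg :: "('h \<Rightarrow>\<^sub>L 'h) \<Rightarrow> ('h \<Rightarrow>\<^sub>L 'h) \<Rightarrow> bool \<Rightarrow> ('h \<Rightarrow>\<^sub>L 'h) set" where
  "cl_alg U V b = closure (gen_alg U V b)"

lemma star_alg_diff: "x \<in> star_alg a \<Longrightarrow> y \<in> star_alg a \<Longrightarrow> x - y \<in> star_alg a"
  using star_alg.add[of x a "op_scale (-1) y"] star_alg.scale[of y a "-1"] by (simp add: op_scale_minus1)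

text \<open>Subtracting the trace from an approximating sequence centres it, and the correction tends to zero
  by continuity of the trace.\<close>

lemma centred_approx:
  assumes a: "a \<in> M" and x: "x \<in> closure (star_alg a)" "\<tau> x = 0"
  shows "\<exists>X. (\<forall>n::nat. X n \<in> star_alg a \<and> \<tau> (X n) = 0) \<and> X \<longlonglongrightarrow> x"
proof -
  obtain Y where Y: "\<And>n. Y n \<in> star_alg a" "Y \<longlonglongrightarrow> x" using x(1) unfolding closure_sequential by blast
  have YM: "Y n \<in> M" for n using star_alg_sub[OF a Y(1)] .
  let ?X = "\<lambda>n. Y n - op_scale (\<tau> (Y n)) id_blinfun"
  have "(\<lambda>n. \<tau> (Y n)) \<longlonglongrightarrow> 0" using tr_tendsto[OF YM Y(2)] x(2) by simp
  then have "(\<lambda>n. op_scale (\<tau> (Y n)) id_blinfun) \<longlonglongrightarrow> (0 :: 'h \<Rightarrow>\<^sub>L 'h)"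
  proof (rule_tac Lim_null_comparison[where g = "\<lambda>n. norm (\<tau> (Y n))"])
    have "norm (op_scale c (id_blinfun :: 'h \<Rightarrow>\<^sub>L 'h)) \<le> norm c" for c
      using order_trans[OF norm_op_scale[of c id_blinfun] mult_left_mono[OF norm_id_blinfun_le norm_ge_zero]] by simp
    then show "\<forall>\<^sub>F n in sequentially. norm (op_scale (\<tau> (Y n)) (id_blinfun :: 'h \<Rightarrow>\<^sub>L 'h)) \<le> norm (\<tau> (Y n))" by simp
  qed (rule tendsto_norm_zero)
  then have "?X \<longlonglongrightarrow> x - 0" by (intro tendsto_diff Y(2))
  moreover have "?X n \<in> star_alg a" for n by (intro star_alg_diff Y star_alg.scale star_alg.one)
  moreover have "\<tau> (?X n) = 0" for n
    using YM by (simp add: tr_diff M.scale_in M.one_in tr_scale tr_one)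
  ultimately show ?thesis by (intro exI[of _ ?X]) auto
qed

lemma alternating_closure_approx:
  assumes "alternating (cl_alg U V) \<tau> b x" and "U \<in> M" "V \<in> M"
  shows "\<exists>X. (\<forall>n::nat. alternating (gen_alg U V) \<tau> b (X n)) \<and> X \<longlonglongrightarrow> x"
  using assms(1)
proof (induction rule: alternating.induct)
  case (single x b)
  then have "\<exists>X. (\<forall>n::nat. X n \<in> gen_alg U V b \<and> \<tau> (X n) = 0) \<and> X \<longlonglongrightarrow> x"
    using centred_approx[OF assms(2)] centred_approx[OF assms(3)] by (cases b) (auto simp: gen_alg_def cl_alg_def)
  then show ?case by (meson alternating.single)
next
  case (cons x b b' y)
  then have "\<exists>X. (\<forall>n::nat. X n \<in> gen_alg U V b \<and> \<tau> (X n) = 0) \<and> X \<longlonglongrightarrow> x"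
    using centred_approx[OF assms(2)] centred_approx[OF assms(3)] by (cases b) (auto simp: gen_alg_def cl_alg_def)
  then obtain X where X: "\<And>n::nat. X n \<in> gen_alg U V b" "\<And>n. \<tau> (X n) = 0" "X \<longlonglongrightarrow> x" by blast
  from cons obtain Y where Y: "\<And>n::nat. alternating (gen_alg U V) \<tau> b' (Y n)" "Y \<longlonglongrightarrow> y" by blast
  have "(\<lambda>n. X n o\<^sub>L Y n) \<longlonglongrightarrow> (x o\<^sub>L y)" by (intro tendsto_blinfun_compose X Y)
  moreover have "alternating (gen_alg U V) \<tau> b (X n o\<^sub>L Y n)" for n
    by (rule alternating.cons[OF X(1,2) \<open>b \<noteq> b'\<close> Y(1)])
  ultimately show ?case by (intro exI[of _ "\<lambda>n. X n o\<^sub>L Y n"] conjI allI)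
qed

lemma gen_alg_sub: "U \<in> M \<Longrightarrow> V \<in> M \<Longrightarrow> gen_alg U V b \<subseteq> M"
  using star_alg_sub by (auto simp: gen_alg_def)

lemma alternating_in:
  assumes "alternating S \<tau> b x" "\<And>b. S b \<subseteq> M" shows "x \<in> M"
  using assms(1)
proof (induction rule: alternating.induct)
  case (single x b)
  show ?case by (rule subsetD[OF assms(2) single(1)])
next
  case (cons x b b' y)
  show ?case by (rule M.mult_in[OF subsetD[OF assms(2) cons(1)] cons.IH])
qed

text \<open>Freeness passes to the norm closures of the two algebras, which contain the resolvents.\<close>

lemma alternating_closure_trace_zero:
  assumes free: "freely_independent \<tau> [U, V]" and UV: "U \<in> M" "V \<in> M"
    and x: "alternating (cl_alg U V) \<tau> b x"
  shows "\<tau> x = 0"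
proof -
  obtain X where X: "\<And>n::nat. alternating (gen_alg U V) \<tau> b (X n)" "X \<longlonglongrightarrow> x"
    using alternating_closure_approx[OF x UV] by blast
  have "X n \<in> M" for n by (rule alternating_in[OF X(1) gen_alg_sub[OF UV]])
  from tr_tendsto[OF this X(2)] have "(\<lambda>n. \<tau> (X n)) \<longlonglongrightarrow> \<tau> x" .
  then have "(\<lambda>n::nat. 0) \<longlonglongrightarrow> \<tau> x" by (simp only: alternating_trace_zero[OF free X(1)])
  then show ?thesis by (simp add: LIMSEQ_const_iff)
qed

text \<open>Hence the resolvents of a unitary lie in the norm closure of the algebra that it generates.\<close>

lemma closure_star_alg_state:
  assumes a: "a \<in> M" shows "op_state (closure (star_alg a)) \<tau>"
proof -
  let ?C = "closure (star_alg a)"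
  have sub: "?C \<subseteq> M" by (rule closure_star_alg_sub[OF a])
  show ?thesis
  proof
    show "?C \<subseteq> bops" using sub M.sub_bops by (rule subset_trans)
    show "id_blinfun \<in> ?C" by (rule subsetD[OF closure_subset star_alg.one])
    show "closed ?C" by simp
    fix x y c assume x: "x \<in> ?C"
    obtain X where X: "\<And>n. X n \<in> star_alg a" "X \<longlonglongrightarrow> x" using x unfolding closure_sequential by blast
    have "(\<lambda>n. op_scale c (X n)) \<longlonglongrightarrow> op_scale c x" by (intro tendsto_op_scale X)
    then show "op_scale c x \<in> ?C"
      unfolding closure_sequential by (intro exI[of _ "\<lambda>n. op_scale c (X n)"] conjI allI star_alg.scale X)
    show "\<tau> (op_scale c x) = c * \<tau> x" by (rule tr_scale[OF subsetD[OF sub x]])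
    assume y: "y \<in> ?C"
    obtain Y where Y: "\<And>n. Y n \<in> star_alg a" "Y \<longlonglongrightarrow> y" using y unfolding closure_sequential by blast
    have "(\<lambda>n. X n + Y n) \<longlonglongrightarrow> x + y" by (intro tendsto_add X Y)
    then show "x + y \<in> ?C"
      unfolding closure_sequential by (intro exI[of _ "\<lambda>n. X n + Y n"] conjI allI star_alg.add X Y)
    have "(\<lambda>n. X n o\<^sub>L Y n) \<longlonglongrightarrow> (x o\<^sub>L y)" by (intro tendsto_blinfun_compose X Y)
    then show "x o\<^sub>L y \<in> ?C"
      unfolding closure_sequential by (intro exI[of _ "\<lambda>n. X n o\<^sub>L Y n"] conjI allI star_alg.mult X Y)
    show "\<tau> (x + y) = \<tau> x + \<tau> y" by (rule tr_add[OF subsetD[OF sub x] subsetD[OF sub y]])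
  next
    fix X x assume "\<And>n. X n \<in> ?C" "X \<longlonglongrightarrow> x"
    then show "(\<lambda>n. \<tau> (X n)) \<longlonglongrightarrow> \<tau> x" using sub by (intro tr_tendsto) (auto)
  qed
qed

lemma op_powi_star_alg:
  assumes "unitary_in M a" shows "op_powi a n \<in> star_alg a"
proof -
  note a = unitary_in_op[OF assms]
  show ?thesis
  proof (induction n rule: int_induct[of _ 0])
    case base show ?case by (simp add: star_alg.one)
  next
    case (step1 i)
    show ?case unfolding op_powi_succ[OF a(1)] by (rule star_alg.mult[OF star_alg.gen step1(2)])
  next
    case (step2 i)
    show ?case unfolding op_powi_pred[OF a(1)] a(4)[symmetric] by (rule star_alg.mult[OF star_alg.gen_adj step2(2)])
  qed
qed

text \<open>With \<open>P = (1 - \<alpha>U)\<^sup>-\<^sup>1 = (1 + s) + p\<close> and \<open>Q = (1 - \<beta>V)\<^sup>-\<^sup>1 = (1 + s) + q\<close> the choice of \<open>w\<close> cancels the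
  terms that are linear in \<open>p\<close> and \<open>q\<close>, and
  \<open>(1 - wVU)\<^sup>-\<^sup>1 = (1 + s)\<^sup>-\<^sup>1 P (1 - qp / (s (1 + s)))\<^sup>-\<^sup>1 Q\<close>. In the Neumann series of the middle factor
  all terms but the first are alternating products of centred elements, so only the first one
  contributes to the trace.\<close>

lemma subordination:
  assumes U: "unitary_in M U" and V: "unitary_in M V" and free: "freely_independent \<tau> [U, V]"
    and s: "s \<noteq> 0" "1 + s \<noteq> 0" and ab: "norm \<alpha> < 1" "norm \<beta> < 1" and w: "norm w < 1"
    and psi: "psi \<tau> U \<alpha> = s" "psi \<tau> V \<beta> = s" and ws: "w = \<alpha> * \<beta> * (1 + s) / s"
    and small: "norm ((res \<beta> V - op_scale (1 + s) id_blinfun) o\<^sub>L (res \<alpha> U - op_scale (1 + s) id_blinfun)) < norm (s * (1 + s))"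
    and X: "X \<in> closure (star_alg U)"
  shows "\<tau> (X o\<^sub>L res w (V o\<^sub>L U)) = \<tau> (X o\<^sub>L res \<alpha> U)"
proof -
  note Uo = unitary_in_op[OF U] note Vo = unitary_in_op[OF V]
  interpret CU: op_state "closure (star_alg U)" \<tau> by (rule closure_star_alg_state[OF Uo(2)])
  interpret CV: op_state "closure (star_alg V)" \<tau> by (rule closure_star_alg_state[OF Vo(2)])
  have UC: "op_powi U n \<in> closure (star_alg U)" and VC: "op_powi V n \<in> closure (star_alg V)" for n
    by (rule subsetD[OF closure_subset op_powi_star_alg], fact)+
  define P where "P = res \<alpha> U"
  define Q where "Q = res \<beta> V"
  define p where "p = P - op_scale (1 + s) id_blinfun"
  define q where "q = Q - op_scale (1 + s) id_blinfun"
  define c where "c = 1 / (s * (1 + s))"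
  define K where "K = op_scale c (q o\<^sub>L p)"
  define R where "R = res w (V o\<^sub>L U)"
  have PC: "P \<in> closure (star_alg U)" unfolding P_def by (rule CU.res_in[OF Uo(1) UC ab(1)])
  have QC: "Q \<in> closure (star_alg V)" unfolding Q_def by (rule CV.res_in[OF Vo(1) VC ab(2)])
  have pC: "p \<in> closure (star_alg U)" unfolding p_def by (intro CU.diff_in PC CU.scale_in CU.one_in)
  have qC: "q \<in> closure (star_alg V)" unfolding q_def by (intro CV.diff_in QC CV.scale_in CV.one_in)
  have tP: "\<tau> P = 1 + s" using M.psi_res[OF Uo(1,5) ab(1)] psi(1) by (simp add: P_def tr_one)
  have tQ: "\<tau> Q = 1 + s" using M.psi_res[OF Vo(1,5) ab(2)] psi(2) by (simp add: Q_def tr_one)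
  have subU: "closure (star_alg U) \<subseteq> M" and subV: "closure (star_alg V) \<subseteq> M"
    using closure_star_alg_sub Uo(2) Vo(2) by auto
  have PM: "P \<in> M" "p \<in> M" and QM: "Q \<in> M" "q \<in> M" and XM: "X \<in> M"
    using PC pC subU QC qC subV X by auto
  have tp: "\<tau> p = 0" unfolding p_def using PM by (simp add: tr_diff M.scale_in M.one_in tr_scale tr_one tP)
  have tq: "\<tau> q = 0" unfolding q_def using QM by (simp add: tr_diff M.scale_in M.one_in tr_scale tr_one tQ)
  have Qb: "Q \<in> bops" and qb: "q \<in> bops" and Vb: "V \<in> bops" and pb: "p \<in> bops"
    using QM PM Vo M.sub_bops by auto
  have cs: "c * (s * (1 + s)) = 1" using s by (simp add: c_def)
  have nK: "norm K < 1"
  proof -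
    have "norm K \<le> norm c * norm (q o\<^sub>L p)" unfolding K_def by (rule norm_op_scale)
    also have "\<dots> < norm c * norm (s * (1 + s))"
      using small s by (intro mult_strict_left_mono) (auto simp: p_def q_def P_def Q_def c_def)
    also have "\<dots> = 1" using cs by (metis norm_mult norm_one)
    finally show ?thesis .
  qed
  define Z where "Z = op_inv (id_blinfun - K)"
  note Z = neumann[OF nK, folded Z_def]
  define A1 where "A1 = op_scale \<alpha> U"
  define B1 where "B1 = op_scale \<beta> V"
  note PA = res_inverse[OF Uo(1) ab(1), folded P_def A1_def] res_eqs[OF Uo(1) ab(1), folded P_def A1_def]
  note QB = res_inverse[OF Vo(1) ab(2), folded Q_def B1_def] res_eqs[OF Vo(1) ab(2), folded Q_def B1_def]
  define G where "G = id_blinfun - op_scale w (V o\<^sub>L U)"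
  \<comment> \<open>The value of \<open>w\<close> is chosen such that \<open>wVU = ((1 + s) / s) (\<beta>V) (\<alpha>U)\<close>.\<close>
  have wVU: "op_scale w (V o\<^sub>L U) = op_scale ((1 + s) / s) (B1 o\<^sub>L A1)"
    unfolding A1_def B1_def ws
    by (simp add: op_scale_compose_left op_scale_compose_right[OF Vb] op_scale_scale mult_ac)
  have "Q o\<^sub>L (G o\<^sub>L P) = (Q o\<^sub>L P) - op_scale ((1 + s) / s) ((Q o\<^sub>L B1) o\<^sub>L (A1 o\<^sub>L P))"
    unfolding G_def wVU by (simp add: compose_simps op_scale_compose_left op_scale_compose_right[OF Qb] compose_assoc)
  also have "\<dots> = (Q o\<^sub>L P) - op_scale ((1 + s) / s) ((Q - id_blinfun) o\<^sub>L (P - id_blinfun))"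
    unfolding PA(3) QB(4) ..
  also have "\<dots> = op_scale (1 + s) (id_blinfun - K)"
  proof (rule op_eqI)
    fix u v
    have "x - (1 + s) / s * (x - a - b + e) = (1 + s) * (e - c * (x - (1 + s) * a - (1 + s) * b + (1 + s) * ((1 + s) * e)))" for x a b e :: complex
    proof -
      have "(1 + s) * c = 1 / s" using s by (simp add: c_def)
      then have eq: "(1 + s) * (e - c * t) = (1 + s) * e - (1 / s) * t" for t
        by (metis mult.assoc right_diff_distrib)
      show ?thesis unfolding eq using s(1) by (simp add: field_simps)
    qed
    from this[of "cinner (Q (P u)) v" "cinner (Q u) v" "cinner (P u) v" "cinner u v"]
    show "cinner (((Q o\<^sub>L P) - op_scale ((1 + s) / s) ((Q - id_blinfun) o\<^sub>L (P - id_blinfun))) u) v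
        = cinner ((op_scale (1 + s) (id_blinfun - K)) u) v"
      by (simp add: K_def p_def q_def blinfun.bilinear_simps bops_apply[OF Qb] cinner_simps scaleC_add_right algebra_simps)
  qed
  finally have QGP: "Q o\<^sub>L (G o\<^sub>L P) = op_scale (1 + s) (id_blinfun - K)" .
  define T where "T = P o\<^sub>L (Z o\<^sub>L Q)"
  have "Q o\<^sub>L (G o\<^sub>L T) = (Q o\<^sub>L (G o\<^sub>L P)) o\<^sub>L (Z o\<^sub>L Q)" by (simp only: T_def compose_assoc)
  also have "\<dots> = op_scale (1 + s) Q"
    unfolding QGP by (simp add: op_scale_compose_left compose_cancel[OF Z(2)])
  finally have "(id_blinfun - B1) o\<^sub>L (Q o\<^sub>L (G o\<^sub>L T)) = (id_blinfun - B1) o\<^sub>L op_scale (1 + s) Q" by (simp only:)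
  moreover have "id_blinfun - B1 \<in> bops"
    unfolding B1_def using Vb by (intro op_algebra.diff_in[OF bops_algebra] op_algebra.scale_in[OF bops_algebra] op_algebra.one_in[OF bops_algebra])
  ultimately have GT: "G o\<^sub>L T = op_scale (1 + s) id_blinfun"
    by (simp add: compose_cancel[OF QB(1)] op_scale_compose_right QB(1))
  have VU: "unitary_in M (V o\<^sub>L U)" by (rule unitary_in_mult[OF V U])
  note VUo = unitary_in_op[OF VU]
  have RM: "R \<in> M" unfolding R_def by (rule M.res_in[OF VUo(1,5) w])
  have RG: "R o\<^sub>L G = id_blinfun" unfolding R_def G_def by (rule res_inverse(2)[OF VUo(1) w])
  have "R o\<^sub>L (G o\<^sub>L T) = R o\<^sub>L op_scale (1 + s) id_blinfun" by (simp only: GT)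
  then have TR: "T = op_scale (1 + s) R"
    using RM by (simp add: compose_cancel[OF RG] M.compose_scale)
  define Y where "Y = X o\<^sub>L P"
  have YC: "Y \<in> closure (star_alg U)" unfolding Y_def by (rule CU.mult_in[OF X PC])
  have YM: "Y \<in> M" using YC subU by blast
  define y where "y = Y - op_scale (\<tau> Y) id_blinfun"
  have yC: "y \<in> closure (star_alg U)" unfolding y_def by (intro CU.diff_in YC CU.scale_in CU.one_in)
  have yM: "y \<in> M" using yC subU by blast
  have ty: "\<tau> y = 0" unfolding y_def using YM by (simp add: tr_diff M.scale_in M.one_in tr_scale tr_one)
  have cl: "y \<in> cl_alg U V False" "p \<in> cl_alg U V False" "q \<in> cl_alg U V True"
    using yC pC qC by (simp_all add: cl_alg_def gen_alg_def)
  define W where "W = opow (q o\<^sub>L p)"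
  have WM: "W n \<in> M" for n unfolding W_def by (induction n) (use QM PM in \<open>auto intro: M.one_in M.mult_in\<close>)
  let ?alt = "alternating (cl_alg U V) \<tau>"
  have zero: "?alt b x \<Longrightarrow> \<tau> x = 0" for b x by (rule alternating_closure_trace_zero[OF free Uo(2) Vo(2)])
  have qp: "?alt True ((q o\<^sub>L p) o\<^sub>L x)" if "?alt True x" for x
    unfolding compose_assoc
    by (rule alternating.cons[OF cl(3) tq _ alternating.cons[OF cl(2) tp _ that]]) auto
  have a1: "?alt True (W (Suc n))" for n
  proof (induction n)
    case 0
    have "?alt False p" using cl(2) tp by (rule alternating.single)
    from alternating.cons[of q "cl_alg U V" True \<tau>, OF cl(3) tq _ this] have "?alt True (q o\<^sub>L p)" by simp
    then show ?case by (simp add: W_def)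
  next
    case (Suc n)
    then show ?case using qp[OF Suc] by (simp add: W_def)
  qed
  have a2: "?alt True (W n o\<^sub>L q)" for n
  proof (induction n)
    case 0
    show ?case using alternating.single[of q "cl_alg U V" True \<tau>, OF cl(3) tq] by (simp add: W_def)
  next
    case (Suc n)
    then show ?case using qp[OF Suc] by (simp add: W_def compose_assoc)
  qed
  have a3: "?alt False (y o\<^sub>L W (Suc n))" for n by (rule alternating.cons[OF cl(1) ty _ a1]) auto
  have a4: "?alt False (y o\<^sub>L (W n o\<^sub>L q))" for n by (rule alternating.cons[OF cl(1) ty _ a2]) auto
  have Yd: "Y = y + op_scale (\<tau> Y) id_blinfun" by (simp add: y_def)
  have Qd: "Q = q + op_scale (1 + s) id_blinfun" by (simp add: q_def)
  have expand: "\<tau> (Y o\<^sub>L (W n o\<^sub>L Q)) = \<tau> Y * (1 + s) * \<tau> (W n) + \<tau> Y * \<tau> (W n o\<^sub>L q) + (1 + s) * \<tau> (y o\<^sub>L W n) + \<tau> (y o\<^sub>L (W n o\<^sub>L q))" for n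
  proof -
    have WQ: "W n o\<^sub>L Q = (W n o\<^sub>L q) + op_scale (1 + s) (W n)"
      unfolding Qd using WM by (simp add: compose_simps M.compose_scale)
    have "Y o\<^sub>L (W n o\<^sub>L Q) = (y o\<^sub>L (W n o\<^sub>L Q)) + op_scale (\<tau> Y) (W n o\<^sub>L Q)"
      by (subst Yd) (simp add: compose_simps op_scale_compose_left)
    also have "\<dots> = (y o\<^sub>L (W n o\<^sub>L q)) + op_scale (1 + s) (y o\<^sub>L W n) + (op_scale (\<tau> Y) (W n o\<^sub>L q) + op_scale (\<tau> Y) (op_scale (1 + s) (W n)))"
      unfolding WQ using yM by (simp add: compose_simps M.compose_scale op_scale_add)
    finally show ?thesis
      using yM QM(2) WM[of n]
      by (simp add: tr_add tr_scale M.add_in M.scale_in M.mult_in)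
  qed
  \<comment> \<open>Each term of the Neumann series is expanded by splitting \<open>Y\<close> and \<open>Q\<close> into scalar and centred parts.\<close>
  have val: "\<tau> (Y o\<^sub>L (opow K n o\<^sub>L Q)) = (if n = 0 then \<tau> Y * (1 + s) else 0)" for n
  proof -
    have qpb: "q o\<^sub>L p \<in> bops" using qb pb op_algebra.mult_in[OF bops_algebra] by blast
    have "opow K n = op_scale (c ^ n) (W n)" unfolding K_def W_def by (rule opow_scale[OF qpb])
    then have e: "\<tau> (Y o\<^sub>L (opow K n o\<^sub>L Q)) = c ^ n * \<tau> (Y o\<^sub>L (W n o\<^sub>L Q))"
      using YM WM[of n] QM(1) by (simp add: op_scale_compose_left M.compose_scale tr_scale M.mult_in)
    show ?thesis
    proof (cases n)
      case 0
      have "\<tau> (y o\<^sub>L q) = 0" using zero[OF a4[of 0]] by (simp add: W_def)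
      then show ?thesis using 0 unfolding e expand by (simp add: W_def tr_one tq ty)
    next
      case (Suc m)
      then show ?thesis unfolding e expand using zero[OF a1] zero[OF a2] zero[OF a3] zero[OF a4] by simp
    qed
  qed
  have KM: "opow K n \<in> M" for n
    unfolding K_def by (induction n) (use QM PM in \<open>auto intro: M.one_in M.mult_in M.scale_in\<close>)
  have "(\<lambda>n. Y o\<^sub>L (opow K n o\<^sub>L Q)) sums (Y o\<^sub>L (Z o\<^sub>L Q))"
    by (intro bounded_linear.sums[OF bounded_bilinear.bounded_linear_right[OF bounded_bilinear_blinfun_compose]]
        bounded_linear.sums[OF bounded_bilinear.bounded_linear_left[OF bounded_bilinear_blinfun_compose]] Z(1))
  then have "(\<lambda>n. \<tau> (Y o\<^sub>L (opow K n o\<^sub>L Q))) sums \<tau> (Y o\<^sub>L (Z o\<^sub>L Q))"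
    by (intro M.\<phi>_sums(1)) (use YM KM QM in \<open>auto intro: M.mult_in\<close>)
  then have "(\<lambda>n. if n = 0 then \<tau> Y * (1 + s) else 0) sums \<tau> (Y o\<^sub>L (Z o\<^sub>L Q))" by (simp only: val)
  moreover have "(\<lambda>n. if n = 0 then \<tau> Y * (1 + s) else 0) sums (\<tau> Y * (1 + s))"
    using sums_If_finite_set[of "{0::nat}" "\<lambda>_. \<tau> Y * (1 + s)"] by simp
  ultimately have "\<tau> (Y o\<^sub>L (Z o\<^sub>L Q)) = \<tau> Y * (1 + s)" by (rule sums_unique2)
  moreover have "Y o\<^sub>L (Z o\<^sub>L Q) = X o\<^sub>L T" by (simp only: Y_def T_def compose_assoc)
  moreover have "\<tau> (X o\<^sub>L T) = (1 + s) * \<tau> (X o\<^sub>L R)"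
    unfolding TR using XM RM by (simp add: M.compose_scale tr_scale M.mult_in)
  ultimately have "(1 + s) * \<tau> (X o\<^sub>L R) = (1 + s) * \<tau> Y" by (simp add: mult.commute)
  then have "\<tau> (X o\<^sub>L R) = \<tau> Y" using s(2) by simp
  then show ?thesis by (simp only: R_def Y_def P_def)
qed

end

section \<open>The compositional inverses and the S-transform\<close>

text \<open>Differentiability at \<open>0\<close> together with \<open>h(0) = 0\<close>.\<close>

lemma local_inverse_linear_bound:
  assumes "is_local_inverse f h"
  shows "\<exists>C>0. \<forall>\<^sub>F s in nhds 0. norm (h s) \<le> C * norm s"
proof -
  have an: "h analytic_on {0}" and h0: "h 0 = 0" using assms by (auto simp: is_local_inverse_def)
  obtain D where D: "(h has_field_derivative D) (at 0)"
    using an by (meson analytic_on_imp_differentiable_at field_differentiable_def insertI1)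
  then have "((\<lambda>s. h s / s) \<longlongrightarrow> D) (at 0)" by (simp add: has_field_derivative_iff h0)
  then have "((\<lambda>s. norm (h s / s)) \<longlongrightarrow> norm D) (at 0)" by (rule tendsto_norm)
  then have "\<forall>\<^sub>F s in at 0. norm (h s / s) < norm D + 1" by (rule order_tendstoD) simp
  then have "\<forall>\<^sub>F s in at 0. norm (h s) \<le> (norm D + 1) * norm s"
  proof (rule eventually_rev_mp)
    show "\<forall>\<^sub>F s in at 0. norm (h s / s) < norm D + 1 \<longrightarrow> norm (h s) \<le> (norm D + 1) * norm s"
      unfolding eventually_at_filter
      by (rule always_eventually) (auto simp: norm_divide divide_less_eq)
  qed
  then have "\<forall>\<^sub>F s in nhds 0. norm (h s) \<le> (norm D + 1) * norm s"
    unfolding eventually_at_filter by eventually_elim (use h0 in auto)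
  then show ?thesis by (intro exI[of _ "norm D + 1"]) (auto intro: add_nonneg_pos)
qed

text \<open>The centred resolvent is \<open>zA (1 - zA)\<^sup>-\<^sup>1 - s\<close>, and the resolvent has norm at most \<open>2\<close> for
  \<open>|z| \<le> 1/2\<close>.\<close>

lemma norm_res_centred:
  fixes A :: "'h::chilbert_space \<Rightarrow>\<^sub>L 'h"
  assumes A: "unitary_op A" and z: "norm z \<le> 1 / 2"
  shows "norm (res z A - op_scale (1 + s) id_blinfun) \<le> 2 * norm z + norm s"
proof -
  have z1: "norm z < 1" using z by simp
  let ?P = "res z A"
  have n1: "norm (?P - id_blinfun) \<le> norm z * norm ?P"
  proof -
    have "norm (op_scale z A o\<^sub>L ?P) \<le> norm (op_scale z A) * norm ?P" by (rule norm_blinfun_compose)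
    also have "\<dots> \<le> (norm z * 1) * norm ?P"
      by (intro mult_right_mono order_trans[OF norm_op_scale] mult_left_mono unitary_op_norm_le A) auto
    finally show ?thesis by (simp add: res_eqs(1)[OF A z1])
  qed
  have "norm ?P \<le> norm (?P - id_blinfun) + norm (id_blinfun :: 'h \<Rightarrow>\<^sub>L 'h)"
    using norm_triangle_ineq[of "?P - id_blinfun" id_blinfun] by simp
  also have "\<dots> \<le> norm z * norm ?P + 1" using n1 norm_id_blinfun_le[where 'h = 'h] by simp
  also have "\<dots> \<le> (1 / 2) * norm ?P + 1" using z by (intro add_right_mono mult_right_mono) auto
  finally have "norm ?P \<le> 2" by simp
  then have n2: "norm (?P - id_blinfun) \<le> 2 * norm z"
    using n1 mult_left_mono[of "norm ?P" 2 "norm z"] by simp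
  have "?P - op_scale (1 + s) id_blinfun = (?P - id_blinfun) - op_scale s id_blinfun"
    by (simp add: op_scale_add_left)
  then have "norm (?P - op_scale (1 + s) id_blinfun) \<le> norm (?P - id_blinfun) + norm (op_scale s (id_blinfun :: 'h \<Rightarrow>\<^sub>L 'h))"
    by (metis norm_triangle_ineq4)
  also have "norm (op_scale s (id_blinfun :: 'h \<Rightarrow>\<^sub>L 'h)) \<le> norm s"
    using order_trans[OF norm_op_scale[of s id_blinfun] mult_left_mono[OF norm_id_blinfun_le norm_ge_zero]] by simp
  finally show ?thesis using n2 by simp
qed

context tracial_vna
begin

lemma psi_inv_local_inverse:
  assumes "unitary_in M A" "\<tau> A \<noteq> 0"
  shows "is_local_inverse (psi \<tau> A) (psi_inv \<tau> A)"
  unfolding psi_inv_def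
  using unitary_in_op[OF assms(1)] assms(2)
  by (intro local_inverse_exists[where r = 1])
     (simp_all add: M.psi_holomorphic M.psi_0 M.deriv_psi_0)

lemma psi_tendsto_0:
  assumes "unitary_in M A" shows "(psi \<tau> A \<longlongrightarrow> 0) (nhds 0)"
proof -
  have "isCont (psi \<tau> A) 0"
    using M.psi_holomorphic[OF unitary_in_op(1,5)[OF assms]] holomorphic_on_imp_continuous_on
    by (metis centre_in_ball continuous_on_eq_continuous_at open_ball zero_less_one)
  then show ?thesis
    using M.psi_0[OF unitary_in_op(1,5)[OF assms]] tendsto_at_iff_tendsto_nhds[of "psi \<tau> A" 0] by (simp add: isCont_def)
qed

text \<open>The product of the two centred unitaries has trace zero.\<close>

lemma tr_free_mult:
  assumes U: "unitary_in M U" and V: "unitary_in M V" and free: "freely_independent \<tau> [U, V]"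
  shows "\<tau> (V o\<^sub>L U) = \<tau> V * \<tau> U"
proof -
  note Uo = unitary_in_op[OF U] note Vo = unitary_in_op[OF V]
  let ?u = "U - op_scale (\<tau> U) id_blinfun" and ?v = "V - op_scale (\<tau> V) id_blinfun"
  have u: "?u \<in> gen_alg U V False" "\<tau> ?u = 0" and v: "?v \<in> gen_alg U V True" "\<tau> ?v = 0"
    using Uo Vo by (auto simp: gen_alg_def tr_diff M.scale_in M.one_in tr_scale tr_one
        intro!: star_alg_diff star_alg.gen star_alg.scale star_alg.one)
  have uM: "?u \<in> M" and vM: "?v \<in> M" using Uo Vo by (auto intro!: M.diff_in M.scale_in M.one_in)
  have "alternating (gen_alg U V) \<tau> False ?u" using u by (rule alternating.single)
  from alternating.cons[of ?v "gen_alg U V" True \<tau>, OF v _ this]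
  have "alternating (gen_alg U V) \<tau> True (?v o\<^sub>L ?u)" by simp
  then have z: "\<tau> (?v o\<^sub>L ?u) = 0" by (rule alternating_trace_zero[OF free])
  have "V o\<^sub>L U = (?v o\<^sub>L ?u) + op_scale (\<tau> U) V + op_scale (\<tau> V) ?u"
    using Vo by (simp add: compose_simps op_scale_compose_left M.compose_scale op_scale_diff op_scale_scale mult.commute)
  then show ?thesis
    using uM vM Vo by (simp add: tr_add M.add_in M.mult_in M.scale_in tr_scale z u(2))
qed

text \<open>The function \<open>\<psi>\<^sub>U\<^sup>-\<^sup>1(s) \<psi>\<^sub>V\<^sup>-\<^sup>1(s) (1 + s) / s\<close> turns out to be \<open>\<psi>\<^sub>V\<^sub>U\<^sup>-\<^sup>1(s)\<close>; its value \<open>0\<close>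
  at \<open>0\<close> is the limit.\<close>

definition psi_prod_inv :: "('h \<Rightarrow>\<^sub>L 'h) \<Rightarrow> ('h \<Rightarrow>\<^sub>L 'h) \<Rightarrow> complex \<Rightarrow> complex" where
  "psi_prod_inv U V s = (if s = 0 then 0 else psi_inv \<tau> U s * psi_inv \<tau> V s * (1 + s) / s)"

context
  fixes U V
  assumes U: "unitary_in M U" and V: "unitary_in M V" and free: "freely_independent \<tau> [U, V]"
    and U0: "\<tau> U \<noteq> 0" and V0: "\<tau> V \<noteq> 0"
begin

lemma VU_unitary_nonzero: "unitary_in M (V o\<^sub>L U)" "\<tau> (V o\<^sub>L U) \<noteq> 0"
  using unitary_in_mult[OF V U] tr_free_mult[OF U V free] U0 V0 by auto

lemma psi_prod_inv_tendsto: "(psi_prod_inv U V \<longlongrightarrow> 0) (nhds 0)"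
proof -
  obtain C where C: "C > 0" "\<forall>\<^sub>F s in nhds 0. norm (psi_inv \<tau> U s) \<le> C * norm s"
    using local_inverse_linear_bound[OF psi_inv_local_inverse[OF U U0]] by blast
  have tV: "(psi_inv \<tau> V \<longlongrightarrow> 0) (nhds 0)" by (rule local_inverse_tendsto[OF psi_inv_local_inverse[OF V V0]])
  have "((\<lambda>s. C * norm (psi_inv \<tau> V s) * norm (1 + s)) \<longlongrightarrow> C * norm (0::complex) * norm (1 + (0::complex))) (nhds 0)"
    by (intro tendsto_intros tV) (simp add: filterlim_ident)
  then have lim: "((\<lambda>s. C * norm (psi_inv \<tau> V s) * norm (1 + s)) \<longlongrightarrow> 0) (nhds 0)" by simp
  have "\<forall>\<^sub>F s in nhds 0. norm (psi_prod_inv U V s) \<le> C * norm (psi_inv \<tau> V s) * norm (1 + s)"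
    using C(2)
  proof eventually_elim
    case (elim s)
    show ?case
    proof (cases "s = 0")
      case True
      then show ?thesis using C(1) by (simp add: psi_prod_inv_def)
    next
      case False
      have "norm (psi_prod_inv U V s) = (norm (psi_inv \<tau> U s) / norm s) * (norm (psi_inv \<tau> V s) * norm (1 + s))"
        using False by (simp add: psi_prod_inv_def norm_mult norm_divide)
      also have "\<dots> \<le> C * (norm (psi_inv \<tau> V s) * norm (1 + s))"
        using elim False by (intro mult_right_mono) (auto simp: divide_le_eq)
      finally show ?thesis by simp
    qed
  qed
  then show ?thesis using lim by (rule Lim_null_comparison)
qed

text \<open>For \<open>\<alpha> = \<psi>\<^sub>U\<^sup>-\<^sup>1(s)\<close> and \<open>\<beta> = \<psi>\<^sub>V\<^sup>-\<^sup>1(s)\<close> both centred resolvents \<open>p\<close> and \<open>q\<close> are of size \<open>O(s)\<close>. Hence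
  \<open>qp\<close> is of size \<open>O(s\<^sup>2)\<close>, which beats \<open>|s (1 + s)|\<close> near \<open>0\<close> and makes the Neumann series converge.\<close>

lemma subordination_eventually:
  "\<forall>\<^sub>F s in nhds 0. s \<noteq> 0 \<longrightarrow> (norm (psi_prod_inv U V s) < 1 \<and> norm (psi_inv \<tau> U s) < 1 \<and>
     (\<forall>X\<in>closure (star_alg U). \<tau> (X o\<^sub>L res (psi_prod_inv U V s) (V o\<^sub>L U)) = \<tau> (X o\<^sub>L res (psi_inv \<tau> U s) U)))"
proof -
  note liU = psi_inv_local_inverse[OF U U0] note liV = psi_inv_local_inverse[OF V V0]
  obtain C where C: "C > 0" "\<forall>\<^sub>F s in nhds 0. norm (psi_inv \<tau> U s) \<le> C * norm s"
    using local_inverse_linear_bound[OF liU] by blast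
  obtain D where D: "D > 0" "\<forall>\<^sub>F s in nhds 0. norm (psi_inv \<tau> V s) \<le> D * norm s"
    using local_inverse_linear_bound[OF liV] by blast
  have half: "\<forall>\<^sub>F s in nhds 0. norm (k s) < 1 / 2" if "(k \<longlongrightarrow> 0) (nhds 0)" for k :: "complex \<Rightarrow> complex"
    using order_tendstoD(2)[OF tendsto_norm[OF that], of "1/2"] by simp
  have "((\<lambda>s::complex. (2 * D + 1) * (2 * C + 1) * norm s) \<longlongrightarrow> (2 * D + 1) * (2 * C + 1) * norm (0::complex)) (nhds 0)"
    by (intro tendsto_intros) (simp add: filterlim_ident)
  then have small: "\<forall>\<^sub>F s in nhds (0::complex). (2 * D + 1) * (2 * C + 1) * norm s < 1 / 2"
    by (intro order_tendstoD(2)) auto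
  have psU: "\<forall>\<^sub>F s in nhds 0. psi \<tau> U (psi_inv \<tau> U s) = s" and psV: "\<forall>\<^sub>F s in nhds 0. psi \<tau> V (psi_inv \<tau> V s) = s"
    using liU liV by (auto simp: is_local_inverse_def)
  show ?thesis
    using C(2) D(2) half[OF local_inverse_tendsto[OF liU]] half[OF local_inverse_tendsto[OF liV]]
      half[OF psi_prod_inv_tendsto] half[OF filterlim_ident] small psU psV
  proof eventually_elim
    case (elim s)
    show ?case
    proof (intro impI conjI ballI)
      assume s: "s \<noteq> 0"
      let ?a = "psi_inv \<tau> U s" and ?b = "psi_inv \<tau> V s"
      show "norm (psi_prod_inv U V s) < 1" "norm ?a < 1" using elim by auto
      have n1s: "norm (1 + s) \<ge> 1 / 2"
        using norm_triangle_ineq2[of 1 "-s"] elim(6) by simp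
      fix X assume X: "X \<in> closure (star_alg U)"
      show "\<tau> (X o\<^sub>L res (psi_prod_inv U V s) (V o\<^sub>L U)) = \<tau> (X o\<^sub>L res ?a U)"
      proof (rule subordination[OF U V free s])
        show "1 + s \<noteq> 0" using n1s by auto
        show "norm ?a < 1" "norm ?b < 1" "norm (psi_prod_inv U V s) < 1" using elim by auto
        show "psi \<tau> U ?a = s" "psi \<tau> V ?b = s" using elim by auto
        show "psi_prod_inv U V s = ?a * ?b * (1 + s) / s" using s by (simp add: psi_prod_inv_def)
        let ?p = "res ?a U - op_scale (1 + s) id_blinfun" and ?q = "res ?b V - op_scale (1 + s) id_blinfun"
        have p: "norm ?p \<le> (2 * C + 1) * norm s"
          using norm_res_centred[OF unitary_in_op(1)[OF U], of ?a s] elim(1,3) by (simp add: algebra_simps)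
        have q: "norm ?q \<le> (2 * D + 1) * norm s"
          using norm_res_centred[OF unitary_in_op(1)[OF V], of ?b s] elim(2,4) by (simp add: algebra_simps)
        have "norm (?q o\<^sub>L ?p) \<le> norm ?q * norm ?p" by (rule norm_blinfun_compose)
        also have "\<dots> \<le> ((2 * D + 1) * norm s) * ((2 * C + 1) * norm s)"
          using C(1) D(1) by (intro mult_mono p q) auto
        also have "\<dots> = ((2 * D + 1) * (2 * C + 1) * norm s) * norm s" by (simp add: mult_ac)
        also have "\<dots> < (1 / 2) * norm s" using elim(7) s by (intro mult_strict_right_mono) auto
        also have "\<dots> \<le> norm (1 + s) * norm s" using n1s by (intro mult_right_mono) auto
        finally show "norm (?q o\<^sub>L ?p) < norm (s * (1 + s))" by (simp add: norm_mult mult.commute)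
        show "X \<in> closure (star_alg U)" by (rule X)
      qed
    qed
  qed
qed

text \<open>Subordination with \<open>X = 1\<close> says that \<open>\<psi>\<^sub>V\<^sub>U\<close> takes the value \<open>s\<close> at \<open>psi_prod_inv U V s\<close>, so this
  function is a right inverse of \<open>\<psi>\<^sub>V\<^sub>U\<close> near \<open>0\<close>.\<close>

lemma psi_prod_inv: "\<forall>\<^sub>F s in nhds 0. psi_inv \<tau> (V o\<^sub>L U) s = psi_prod_inv U V s"
proof -
  note VU = VU_unitary_nonzero
  note VUo = unitary_in_op[OF VU(1)] note Uo = unitary_in_op[OF U]
  have psU: "\<forall>\<^sub>F s in nhds 0. psi \<tau> U (psi_inv \<tau> U s) = s"
    using psi_inv_local_inverse[OF U U0] by (auto simp: is_local_inverse_def)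
  have "\<forall>\<^sub>F s in nhds 0. psi \<tau> (V o\<^sub>L U) (psi_prod_inv U V s) = s"
    using subordination_eventually psU
  proof eventually_elim
    case (elim s)
    show ?case
    proof (cases "s = 0")
      case True
      then show ?thesis using M.psi_0[OF VUo(1,5)] by (simp add: psi_prod_inv_def)
    next
      case False
      have one: "id_blinfun \<in> closure (star_alg U)" by (rule subsetD[OF closure_subset star_alg.one])
      have e: "\<tau> (res (psi_prod_inv U V s) (V o\<^sub>L U)) = \<tau> (res (psi_inv \<tau> U s) U)"
        using bspec[OF conjunct2[OF conjunct2[OF elim(1)[rule_format, OF False]]] one] by simp
      note n = conjunct1[OF elim(1)[rule_format, OF False]] conjunct1[OF conjunct2[OF elim(1)[rule_format, OF False]]]
      show ?thesis using M.psi_res[OF VUo(1,5) n(1)] M.psi_res[OF Uo(1,5) n(2)] e elim(2) by simp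
    qed
  qed
  then show ?thesis by (rule local_inverse_unique[OF psi_inv_local_inverse[OF VU] psi_prod_inv_tendsto])
qed

end

text \<open>The relation \<open>\<eta> = \<psi> / (1 + \<psi>)\<close> is inverted by \<open>\<psi> = \<eta> / (1 - \<eta>)\<close>.\<close>

lemma eta_inverse:
  assumes A: "unitary_in M A" "\<tau> A \<noteq> 0"
  shows "\<forall>\<^sub>F z in nhds 0. local_inverse (eta \<tau> A) z = psi_inv \<tau> A (z / (1 - z))"
proof -
  let ?k = "\<lambda>z. psi_inv \<tau> A (z / (1 - z))"
  note li = psi_inv_local_inverse[OF A]
  have m: "((\<lambda>z::complex. z / (1 - z)) \<longlongrightarrow> 0 / (1 - 0)) (nhds 0)"
    by (intro tendsto_intros) (auto simp: filterlim_ident)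
  then have m: "filterlim (\<lambda>z::complex. z / (1 - z)) (nhds 0) (nhds 0)" by simp
  have ne: "\<forall>\<^sub>F z in nhds (0::complex). z \<noteq> 1"
    using t1_space_nhds[of "0::complex" 1] by simp
  note cont = psi_tendsto_0[OF A(1)]
  have neg: "\<forall>\<^sub>F z in nhds 0. psi \<tau> A z \<noteq> -1"
    using tendsto_imp_eventually_ne[OF cont, of "-1"] by simp
  have "is_local_inverse (eta \<tau> A) ?k"
    unfolding is_local_inverse_def
  proof (intro conjI)
    have "(\<lambda>z::complex. z / (1 - z)) analytic_on {0}" by (intro analytic_intros) auto
    moreover have "psi_inv \<tau> A analytic_on {0}" using li by (simp add: is_local_inverse_def)
    ultimately have "psi_inv \<tau> A \<circ> (\<lambda>z. z / (1 - z)) analytic_on {0}"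
      by (intro analytic_on_compose) auto
    then show "?k analytic_on {0}" by (simp add: comp_def)
    show "?k 0 = 0" using li by (simp add: is_local_inverse_def)
    have "\<forall>\<^sub>F z in nhds 0. psi \<tau> A (?k z) = z / (1 - z)"
      using eventually_compose_filterlim[OF _ m, of "\<lambda>w. psi \<tau> A (psi_inv \<tau> A w) = w"] li by (simp add: is_local_inverse_def)
    then show "\<forall>\<^sub>F w in nhds 0. eta \<tau> A (?k w) = w"
      using ne
    proof eventually_elim
      case (elim z)
      then have "1 - z \<noteq> 0" by simp
      then have "z / (1 - z) / (1 + z / (1 - z)) = z" by (simp add: field_simps)
      then show ?case unfolding eta_def elim(1) .
    qed
    have "\<forall>\<^sub>F z in nhds 0. psi_inv \<tau> A (psi \<tau> A z) = z" using li by (simp add: is_local_inverse_def)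
    then show "\<forall>\<^sub>F z in nhds 0. ?k (eta \<tau> A z) = z"
      using neg
    proof eventually_elim
      case (elim z)
      then have "1 + psi \<tau> A z \<noteq> 0" by (metis add_eq_0_iff)
      then have "eta \<tau> A z / (1 - eta \<tau> A z) = psi \<tau> A z" by (simp add: eta_def field_simps)
      then show ?case using elim by simp
    qed
  qed
  then have "is_local_inverse (eta \<tau> A) (local_inverse (eta \<tau> A))" and k: "is_local_inverse (eta \<tau> A) ?k"
    unfolding local_inverse_def by (auto intro: someI[of "is_local_inverse (eta \<tau> A)"])
  then show ?thesis
    by (intro local_inverse_unique[OF _ local_inverse_tendsto[OF k]]) (auto simp: is_local_inverse_def)
qed

text \<open>At \<open>s = z / (1 - z)\<close> one has \<open>(1 + s) / s = 1 / z\<close>, so the product formula for \<open>\<psi>\<^sub>V\<^sub>U\<^sup>-\<^sup>1\<close> becomes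
  multiplicativity of \<open>S\<close>.\<close>

theorem S_transform_mult:
  assumes U: "unitary_in M U" and V: "unitary_in M V" and free: "freely_independent \<tau> [U, V]"
    and U0: "\<tau> U \<noteq> 0" and V0: "\<tau> V \<noteq> 0"
  shows "\<forall>\<^sub>F z in at 0. S_transform \<tau> (V o\<^sub>L U) z = S_transform \<tau> V z * S_transform \<tau> U z"
proof -
  note VU = VU_unitary_nonzero[OF U V free U0 V0]
  have m: "((\<lambda>z::complex. z / (1 - z)) \<longlongrightarrow> 0 / (1 - 0)) (nhds 0)"
    by (intro tendsto_intros) (auto simp: filterlim_ident)
  then have m: "filterlim (\<lambda>z::complex. z / (1 - z)) (nhds 0) (nhds 0)" by simp
  have ne: "\<forall>\<^sub>F z in nhds (0::complex). z \<noteq> 1"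
    using t1_space_nhds[of "0::complex" 1] by simp
  show ?thesis
    unfolding eventually_at_filter
    using eta_inverse[OF U U0] eta_inverse[OF V V0] eta_inverse[OF VU]
      eventually_compose_filterlim[OF psi_prod_inv[OF U V free U0 V0] m] ne
  proof eventually_elim
    case (elim z)
    show ?case
    proof (intro impI)
      assume z: "z \<noteq> 0"
      have z1: "1 - z \<noteq> 0" using elim(5) by simp
      let ?s = "z / (1 - z)"
      have s: "?s \<noteq> 0" "(1 + ?s) / ?s = 1 / z" using z z1 by (auto simp: field_simps)
      have "psi_inv \<tau> (V o\<^sub>L U) ?s = psi_inv \<tau> U ?s * psi_inv \<tau> V ?s * ((1 + ?s) / ?s)"
        using elim(4) s(1) by (simp add: psi_prod_inv_def)
      then show "S_transform \<tau> (V o\<^sub>L U) z = S_transform \<tau> V z * S_transform \<tau> U z"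
        unfolding S_transform_def elim(1-3) s(2) by (simp add: mult.commute)
    qed
  qed
qed

text \<open>The trace of a product of two resolvents is a divided difference by the resolvent identity.\<close>

lemma tr_res_res:
  assumes U: "unitary_in M U" and z: "norm z < 1" "norm \<alpha> < 1" "z \<noteq> \<alpha>"
  shows "\<tau> (res z U o\<^sub>L res \<alpha> U) = 1 + (z * psi \<tau> U z - \<alpha> * psi \<tau> U \<alpha>) / (z - \<alpha>)"
proof -
  note Uo = unitary_in_op[OF U]
  have in1: "res z U \<in> M" "res \<alpha> U \<in> M" using M.res_in[OF Uo(1,5)] z by auto
  note e1 = res_eqs[OF Uo(1) z(1)] note e2 = res_eqs[OF Uo(1) z(2)]
  let ?G = "res z U" and ?P = "res \<alpha> U"
  have "op_scale \<alpha> ((?G o\<^sub>L op_scale z U) o\<^sub>L ?P) = op_scale z (?G o\<^sub>L (op_scale \<alpha> U o\<^sub>L ?P))"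
    using in1 Uo by (simp add: op_scale_compose_left M.compose_scale op_scale_scale compose_assoc mult.commute)
  then have "op_scale \<alpha> ((?G - id_blinfun) o\<^sub>L ?P) = op_scale z (?G o\<^sub>L (?P - id_blinfun))"
    by (simp only: e1(2) e2(1))
  then have "\<tau> (op_scale \<alpha> ((?G - id_blinfun) o\<^sub>L ?P)) = \<tau> (op_scale z (?G o\<^sub>L (?P - id_blinfun)))" by simp
  then have "\<alpha> * (\<tau> (?G o\<^sub>L ?P) - \<tau> ?P) = z * (\<tau> (?G o\<^sub>L ?P) - \<tau> ?G)"
    using in1 by (simp add: compose_simps tr_scale tr_diff M.diff_in M.mult_in)
  moreover have "\<tau> ?G = 1 + psi \<tau> U z" "\<tau> ?P = 1 + psi \<tau> U \<alpha>"
    using M.psi_res[OF Uo(1,5)] z by (simp_all add: tr_one)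
  ultimately have "(z - \<alpha>) * \<tau> (?G o\<^sub>L ?P) = (z - \<alpha>) + (z * psi \<tau> U z - \<alpha> * psi \<tau> U \<alpha>)"
    by (simp add: algebra_simps)
  then show ?thesis using z(3) by (simp add: field_simps)
qed

text \<open>Subordination with \<open>X = (1 - zU)\<^sup>-\<^sup>1\<close> replaces the resolvent of \<open>VU\<close> at \<open>w\<close> by the resolvent of \<open>U\<close> at
  \<open>\<psi>\<^sub>U\<^sup>-\<^sup>1(\<psi>\<^sub>V\<^sub>U(w))\<close>.\<close>

lemma resolvent_trace_formula:
  assumes U: "unitary_in M U" and V: "unitary_in M V" and free: "freely_independent \<tau> [U, V]"
    and U0: "\<tau> U \<noteq> 0" and V0: "\<tau> V \<noteq> 0"
  shows "\<forall>\<^sub>F w in nhds 0. norm w < 1 \<and> (\<forall>z. norm z < 1 \<longrightarrow> z \<noteq> psi_inv \<tau> U (psi \<tau> (V o\<^sub>L U) w) \<longrightarrow>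
     \<tau> (res z U o\<^sub>L res w (V o\<^sub>L U)) =
       1 + (z * psi \<tau> U z - psi_inv \<tau> U (psi \<tau> (V o\<^sub>L U) w) * psi \<tau> (V o\<^sub>L U) w) / (z - psi_inv \<tau> U (psi \<tau> (V o\<^sub>L U) w)))"
proof -
  note VU = VU_unitary_nonzero[OF U V free U0 V0]
  note Uo = unitary_in_op[OF U] note VUo = unitary_in_op[OF VU(1)]
  note liU = psi_inv_local_inverse[OF U U0] note liVU = psi_inv_local_inverse[OF VU]
  interpret CU: op_state "closure (star_alg U)" \<tau> by (rule closure_star_alg_state[OF Uo(2)])
  have UC: "op_powi U n \<in> closure (star_alg U)" for n
    by (rule subsetD[OF closure_subset op_powi_star_alg[OF U]])
  note cont = psi_tendsto_0[OF VU(1)]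
  have w1: "\<forall>\<^sub>F w in nhds (0::complex). norm w < 1"
    using eventually_nhds_in_open[OF open_ball, of 0 "0::complex" 1] by (auto elim!: eventually_mono)
  have l1: "\<forall>\<^sub>F w in nhds 0. psi_inv \<tau> (V o\<^sub>L U) (psi \<tau> (V o\<^sub>L U) w) = w" using liVU by (simp add: is_local_inverse_def)
  have l2: "\<forall>\<^sub>F s in nhds 0. psi \<tau> U (psi_inv \<tau> U s) = s" using liU by (simp add: is_local_inverse_def)
  have u0: "psi_inv \<tau> U 0 = 0" using liU by (simp add: is_local_inverse_def)
  show ?thesis
    using w1 l1 eventually_compose_filterlim[OF l2 cont]
      eventually_compose_filterlim[OF psi_prod_inv[OF U V free U0 V0] cont]
      eventually_compose_filterlim[OF subordination_eventually[OF U V free U0 V0] cont]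
  proof eventually_elim
    case (elim w)
    let ?s = "psi \<tau> (V o\<^sub>L U) w"
    let ?a = "psi_inv \<tau> U ?s"
    have w: "w = psi_prod_inv U V ?s" using elim(2,4) by simp
    show ?case
    proof (intro conjI allI impI)
      show "norm w < 1" by (rule elim(1))
      fix z assume z: "norm z < 1" "z \<noteq> ?a"
      have zC: "res z U \<in> closure (star_alg U)" by (rule CU.res_in[OF Uo(1) UC z(1)])
      have key: "norm ?a < 1 \<and> \<tau> (res z U o\<^sub>L res w (V o\<^sub>L U)) = \<tau> (res z U o\<^sub>L res ?a U)"
      \<comment> \<open>Subordination was derived for \<open>s \<noteq> 0\<close>; here \<open>s = 0\<close> forces \<open>w = 0\<close>, and both resolvents are the identity.\<close>
      proof (cases "?s = 0")
        case True
        then have "w = 0" using w by (simp add: psi_prod_inv_def)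
        then show ?thesis using True u0 by simp
      next
        case False
        then show ?thesis using elim(5) zC w[symmetric] by simp
      qed
      then have "\<tau> (res z U o\<^sub>L res w (V o\<^sub>L U)) = 1 + (z * psi \<tau> U z - ?a * psi \<tau> U ?a) / (z - ?a)"
        using tr_res_res[OF U z(1) _ z(2)] by simp
      then show "\<tau> (res z U o\<^sub>L res w (V o\<^sub>L U)) = 1 + (z * psi \<tau> U z - ?a * ?s) / (z - ?a)"
        using elim(3) by simp
    qed
  qed
qed

end

section \<open>Mixed moments of free unitaries are determined by the marginals\<close>

text \<open>Pairs \<open>(p(a), p(a'))\<close> of the values of one Laurent polynomial at two unitaries.\<close>

inductive_set laurent_pairs :: "('h::chilbert_space \<Rightarrow>\<^sub>L 'h) \<Rightarrow> ('k::chilbert_space \<Rightarrow>\<^sub>L 'k) \<Rightarrow> (('h \<Rightarrow>\<^sub>L 'h) \<times> ('k \<Rightarrow>\<^sub>L 'k)) set"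
  for a a' where
  power: "(op_powi a n, op_powi a' n) \<in> laurent_pairs a a'"
| add: "(x, x') \<in> laurent_pairs a a' \<Longrightarrow> (y, y') \<in> laurent_pairs a a' \<Longrightarrow> (x + y, x' + y') \<in> laurent_pairs a a'"
| scale: "(x, x') \<in> laurent_pairs a a' \<Longrightarrow> (op_scale c x, op_scale c x') \<in> laurent_pairs a a'"

locale two_free_pairs = A: tracial_vna M \<tau> + B: tracial_vna M' \<tau>'
  for M :: "('h::chilbert_space \<Rightarrow>\<^sub>L 'h) set" and \<tau> and M' :: "('k::chilbert_space \<Rightarrow>\<^sub>L 'k) set" and \<tau>' +
  fixes U V U' V'
  assumes U: "unitary_in M U" and V: "unitary_in M V" and free: "freely_independent \<tau> [U, V]"
    and U': "unitary_in M' U'" and V': "unitary_in M' V'" and free': "freely_independent \<tau>' [U', V']"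
    and momU: "\<And>n. \<tau> (op_powi U n) = \<tau>' (op_powi U' n)" and momV: "\<And>n. \<tau> (op_powi V n) = \<tau>' (op_powi V' n)"
begin

definition gens :: "nat \<Rightarrow> ('h \<Rightarrow>\<^sub>L 'h)" where "gens i = [U, V] ! i"
definition gens' :: "nat \<Rightarrow> ('k \<Rightarrow>\<^sub>L 'k)" where "gens' i = [U', V'] ! i"

lemma gens_props: "i < 2 \<Longrightarrow> unitary_in M (gens i)" "i < 2 \<Longrightarrow> unitary_in M' (gens' i)"
    "i < 2 \<Longrightarrow> \<tau> (op_powi (gens i) n) = \<tau>' (op_powi (gens' i) n)"
  using U V U' V' momU momV by (auto simp: gens_def gens'_def less_2_cases_iff)

text \<open>The traces of corresponding Laurent polynomials agree by linearity.\<close>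

lemma laurent_star:
  assumes "(x, x') \<in> laurent_pairs (gens i) (gens' i)" "i < 2"
  shows "x \<in> star_alg (gens i) \<and> x' \<in> star_alg (gens' i) \<and> \<tau> x = \<tau>' x'"
  using assms(1)
proof (induction rule: laurent_pairs.induct)
  case (power n)
  show ?case using A.op_powi_star_alg[OF gens_props(1)[OF assms(2)]] B.op_powi_star_alg[OF gens_props(2)[OF assms(2)]] gens_props(3)[OF assms(2)] by simp
next
  case (add x x' y y')
  then have "x \<in> M" "y \<in> M" "x' \<in> M'" "y' \<in> M'"
    using A.star_alg_sub B.star_alg_sub A.unitary_in_op(2)[OF gens_props(1)[OF assms(2)]] B.unitary_in_op(2)[OF gens_props(2)[OF assms(2)]] by blast+
  then show ?case using add by (simp add: star_alg.add A.tr_add B.tr_add)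
next
  case (scale x x' c)
  then have "x \<in> M" "x' \<in> M'"
    using A.star_alg_sub B.star_alg_sub A.unitary_in_op(2)[OF gens_props(1)[OF assms(2)]] B.unitary_in_op(2)[OF gens_props(2)[OF assms(2)]] by blast+
  then show ?case using scale by (simp add: star_alg.scale A.tr_scale B.tr_scale)
qed

lemma laurent_in:
  assumes "(x, x') \<in> laurent_pairs (gens i) (gens' i)" "i < 2" shows "x \<in> M" "x' \<in> M'"
  using laurent_star[OF assms] A.star_alg_sub[OF A.unitary_in_op(2)[OF gens_props(1)[OF assms(2)]]]
    B.star_alg_sub[OF B.unitary_in_op(2)[OF gens_props(2)[OF assms(2)]]] by auto

lemma laurent_mult:
  assumes xx: "(x, x') \<in> laurent_pairs (gens i) (gens' i)" and yy: "(y, y') \<in> laurent_pairs (gens i) (gens' i)" and i: "i < 2"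
  shows "(x o\<^sub>L y, x' o\<^sub>L y') \<in> laurent_pairs (gens i) (gens' i)"
  using xx
proof (induction rule: laurent_pairs.induct)
  case (power n)
  note g = A.unitary_in_op[OF gens_props(1)[OF i]] and g' = B.unitary_in_op[OF gens_props(2)[OF i]]
  show ?case using yy
  proof (induction rule: laurent_pairs.induct)
    case (power m)
    show ?case using laurent_pairs.power[of "gens i" "n + m" "gens' i"] by (simp add: op_powi_add[OF g(1)] op_powi_add[OF g'(1)])
  next
    case (add x x' y y')
    then show ?case by (simp add: compose_simps laurent_pairs.add)
  next
    case (scale x x' c)
    then show ?case using g(5) g'(5) by (simp add: A.M.compose_scale B.M.compose_scale laurent_pairs.scale)
  qed
next
  case (add x x' y y')
  then show ?case by (simp add: compose_simps laurent_pairs.add)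
next
  case (scale x x' c)
  then show ?case by (simp add: op_scale_compose_left laurent_pairs.scale)
qed

lemma laurent_one: "(id_blinfun, id_blinfun) \<in> laurent_pairs (gens i) (gens' i)"
  using laurent_pairs.power[of "gens i" 0 "gens' i"] by simp

lemma laurent_centre:
  assumes "(x, x') \<in> laurent_pairs (gens i) (gens' i)"
  shows "(x - op_scale c id_blinfun, x' - op_scale c id_blinfun) \<in> laurent_pairs (gens i) (gens' i)"
  using laurent_pairs.add[OF assms laurent_pairs.scale[OF laurent_pairs.scale[OF laurent_one, of c], of "-1"]]
  by (simp add: op_scale_minus1)


text \<open>In a letter \<open>(i, (x, x'))\<close> the pair \<open>(x, x')\<close> consists of the values of one Laurent
  polynomial at the \<open>i\<close>-th generators of the two systems, so that a word can be multiplied out in both.\<close>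

definition valid :: "(nat \<times> (('h \<Rightarrow>\<^sub>L 'h) \<times> ('k \<Rightarrow>\<^sub>L 'k))) list \<Rightarrow> bool" where
  "valid ws \<longleftrightarrow> (\<forall>w\<in>set ws. fst w < 2 \<and> snd w \<in> laurent_pairs (gens (fst w)) (gens' (fst w)))"

definition prod1 :: "(nat \<times> (('h \<Rightarrow>\<^sub>L 'h) \<times> ('k \<Rightarrow>\<^sub>L 'k))) list \<Rightarrow> 'h \<Rightarrow>\<^sub>L 'h" where
  "prod1 ws = foldr (\<lambda>w x. fst (snd w) o\<^sub>L x) ws id_blinfun"

definition prod2 :: "(nat \<times> (('h \<Rightarrow>\<^sub>L 'h) \<times> ('k \<Rightarrow>\<^sub>L 'k))) list \<Rightarrow> 'k \<Rightarrow>\<^sub>L 'k" where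
  "prod2 ws = foldr (\<lambda>w x. snd (snd w) o\<^sub>L x) ws id_blinfun"

lemma prod_simps [simp]:
  "prod1 [] = id_blinfun" "prod2 [] = id_blinfun"
  "prod1 (w # ws) = fst (snd w) o\<^sub>L prod1 ws" "prod2 (w # ws) = snd (snd w) o\<^sub>L prod2 ws"
  by (simp_all add: prod1_def prod2_def)

lemma prod_append [simp]:
  "prod1 (ws @ vs) = prod1 ws o\<^sub>L prod1 vs" "prod2 (ws @ vs) = prod2 ws o\<^sub>L prod2 vs"
  by (induction ws) (simp_all add: compose_assoc)

lemma prod_in: "valid ws \<Longrightarrow> prod1 ws \<in> M \<and> prod2 ws \<in> M'"
proof (induction ws)
  case (Cons w ws)
  then have "fst (snd w) \<in> M" "snd (snd w) \<in> M'"
    using laurent_in[of "fst (snd w)" "snd (snd w)" "fst w"] by (auto simp: valid_def)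
  then show ?case using Cons by (simp add: valid_def A.M.mult_in B.M.mult_in)
qed (simp add: A.M.one_in B.M.one_in)

definition centred :: "(nat \<times> (('h \<Rightarrow>\<^sub>L 'h) \<times> ('k \<Rightarrow>\<^sub>L 'k))) \<Rightarrow> bool" where
  "centred w \<longleftrightarrow> \<tau> (fst (snd w)) = 0"

lemma alternating_centred_zero:
  assumes ws: "ws \<noteq> []" "valid ws" "\<forall>w\<in>set ws. centred w" "\<And>j. Suc j < length ws \<Longrightarrow> fst (ws ! j) \<noteq> fst (ws ! Suc j)"
  shows "\<tau> (prod1 ws) = 0" "\<tau>' (prod2 ws) = 0"
proof -
  have v: "fst w < 2" "fst (snd w) \<in> star_alg (gens (fst w))" "snd (snd w) \<in> star_alg (gens' (fst w))"
      "\<tau> (fst (snd w)) = 0" "\<tau>' (snd (snd w)) = 0" if "w \<in> set ws" for w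
    using laurent_star[of "fst (snd w)" "snd (snd w)" "fst w"] ws(2,3) that by (auto simp: valid_def centred_def)
  let ?ws = "map (\<lambda>w. (fst w, fst (snd w))) ws" and ?ws' = "map (\<lambda>w. (fst w, snd (snd w))) ws"
  have "prod1 ws = foldr (o\<^sub>L) (map snd ?ws) id_blinfun" by (induction ws) simp_all
  moreover have "\<tau> (foldr (o\<^sub>L) (map snd ?ws) id_blinfun) = 0"
  proof (rule free[unfolded freely_independent_def, THEN HOL.spec, THEN mp, THEN mp, THEN mp])
    show "?ws \<noteq> []" using ws(1) by simp
    show "\<forall>(i, x)\<in>set ?ws. i < length [U, V] \<and> x \<in> star_alg ([U, V] ! i) \<and> \<tau> x = 0"
      using v(1,2,4) by (auto simp: gens_def numeral_2_eq_2)
    show "\<forall>j. Suc j < length ?ws \<longrightarrow> fst (?ws ! j) \<noteq> fst (?ws ! Suc j)" using ws(4) by simp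
  qed
  ultimately show "\<tau> (prod1 ws) = 0" by simp
  have "prod2 ws = foldr (o\<^sub>L) (map snd ?ws') id_blinfun" by (induction ws) simp_all
  moreover have "\<tau>' (foldr (o\<^sub>L) (map snd ?ws') id_blinfun) = 0"
  proof (rule free'[unfolded freely_independent_def, THEN HOL.spec, THEN mp, THEN mp, THEN mp])
    show "?ws' \<noteq> []" using ws(1) by simp
    show "\<forall>(i, x)\<in>set ?ws'. i < length [U', V'] \<and> x \<in> star_alg ([U', V'] ! i) \<and> \<tau>' x = 0"
      using v(1,3,5) by (auto simp: gens'_def numeral_2_eq_2)
    show "\<forall>j. Suc j < length ?ws' \<longrightarrow> fst (?ws' ! j) \<noteq> fst (?ws' ! Suc j)" using ws(4) by simp
  qed
  ultimately show "\<tau>' (prod2 ws) = 0" by simp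
qed

text \<open>A word with two neighbouring letters from the same algebra is merged into a shorter one; in an
  alternating word each letter that is not centred is split into its centred part and a scalar,
  and the scalar leaves a shorter word. Hence the induction is on the length and, for fixed length, on
  the number of letters that are not centred; freeness settles words without such letters.\<close>

lemma words_agree: "valid ws \<Longrightarrow> \<tau> (prod1 ws) = \<tau>' (prod2 ws)"
proof (induction "length ws" arbitrary: ws rule: less_induct)
  case less
  show ?case
  proof (cases "\<exists>j. Suc j < length ws \<and> fst (ws ! j) = fst (ws ! Suc j)")
    case True
    then obtain j where j: "Suc j < length ws" "fst (ws ! j) = fst (ws ! Suc j)" by blast
    define l r w v where "l = take j ws" and "r = drop (Suc (Suc j)) ws" and "w = ws ! j" and "v = ws ! Suc j"
    have ws: "ws = l @ w # v # r"
      using j(1) by (simp add: l_def r_def w_def v_def Cons_nth_drop_Suc)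
    define u where "u = (fst w, (fst (snd w) o\<^sub>L fst (snd v), snd (snd w) o\<^sub>L snd (snd v)))"
    have e: "fst w = fst v" using j(2) by (simp add: w_def v_def)
    have "valid (l @ u # r)"
      using less(2) laurent_mult[of "fst (snd w)" "snd (snd w)" "fst w" "fst (snd v)" "snd (snd v)"] e
      unfolding ws by (auto simp: valid_def u_def)
    moreover have "length (l @ u # r) < length ws" unfolding ws by simp
    ultimately have "\<tau> (prod1 (l @ u # r)) = \<tau>' (prod2 (l @ u # r))" using less(1) by blast
    then show ?thesis unfolding ws by (simp add: u_def compose_assoc)
  next
    case False
    have "\<tau> (prod1 vs) = \<tau>' (prod2 vs)" if "valid vs" "length vs = length ws"
      "\<And>j. Suc j < length vs \<Longrightarrow> fst (vs ! j) \<noteq> fst (vs ! Suc j)" for vs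
      using that
    proof (induction "length (filter (\<lambda>w. \<not> centred w) vs)" arbitrary: vs rule: less_induct)
      case (less vs)
      note outer = less.hyps
      show ?case
      proof (cases "\<forall>w\<in>set vs. centred w")
        case True
        show ?thesis
        proof (cases "vs = []")
          case True
          then show ?thesis by (simp add: A.tr_one B.tr_one)
        next
          case False
          show ?thesis using alternating_centred_zero[OF False less.prems(1) True less.prems(3)] by simp
        qed
      next
        case False
        then obtain w where w: "w \<in> set vs" "\<not> centred w" by blast
        then obtain l r where vs: "vs = l @ w # r" by (meson split_list)
        define t where "t = \<tau> (fst (snd w))"
        have lw: "snd w \<in> laurent_pairs (gens (fst w)) (gens' (fst w))" "fst w < 2"
          using less.prems(1) w(1) by (auto simp: valid_def)
        have t': "\<tau>' (snd (snd w)) = t" using laurent_star[of "fst (snd w)" "snd (snd w)" "fst w"] lw by (simp add: t_def)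
        define w0 where "w0 = (fst w, (fst (snd w) - op_scale t id_blinfun, snd (snd w) - op_scale t id_blinfun))"
        have M: "fst (snd w) \<in> M" "snd (snd w) \<in> M'" using laurent_in[of "fst (snd w)" "snd (snd w)" "fst w"] lw by auto
        have val0: "valid (l @ w0 # r)"
          using less.prems(1) laurent_centre[of "fst (snd w)" "snd (snd w)" "fst w" t] lw unfolding vs by (auto simp: valid_def w0_def)
        have vlr: "valid (l @ r)" "valid l" "valid r" using less.prems(1) unfolding vs by (auto simp: valid_def)
        have c0: "centred w0" unfolding centred_def w0_def t_def using M
          by (simp add: A.tr_diff A.M.scale_in A.M.one_in A.tr_scale A.tr_one)
        have "length (filter (\<lambda>w. \<not> centred w) (l @ w0 # r)) < length (filter (\<lambda>w. \<not> centred w) vs)"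
          unfolding vs using c0 w(2) by simp
        moreover have "fst ((l @ w0 # r) ! j) \<noteq> fst ((l @ w0 # r) ! Suc j)" if "Suc j < length (l @ w0 # r)" for j
        proof -
          have "map fst (l @ w0 # r) = map fst vs" unfolding vs by (simp add: w0_def)
          then have "fst ((l @ w0 # r) ! k) = fst (vs ! k)" if "k < length vs" for k
            using that by (metis length_map nth_map)
          then show ?thesis using less.prems(3)[of j] that unfolding vs by simp
        qed
        moreover have "length (l @ w0 # r) = length ws" using less.prems(2) unfolding vs by simp
        ultimately have 1: "\<tau> (prod1 (l @ w0 # r)) = \<tau>' (prod2 (l @ w0 # r))"
          using less.hyps[of "l @ w0 # r"] val0 by blast
        have "length (l @ r) < length ws" using less.prems(2) unfolding vs by simp
        then have 2: "\<tau> (prod1 (l @ r)) = \<tau>' (prod2 (l @ r))"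
          using \<open>\<And>ws'. length ws' < length ws \<Longrightarrow> valid ws' \<Longrightarrow> \<tau> (prod1 ws') = \<tau>' (prod2 ws')\<close> vlr(1) by blast
        have lM: "prod1 l \<in> M" "prod2 l \<in> M'" "prod1 (l @ w0 # r) \<in> M" "prod2 (l @ w0 # r) \<in> M'" "prod1 (l @ r) \<in> M" "prod2 (l @ r) \<in> M'"
          using prod_in vlr val0 by blast+
        have "prod1 vs = prod1 (l @ w0 # r) + op_scale t (prod1 (l @ r))" "prod2 vs = prod2 (l @ w0 # r) + op_scale t (prod2 (l @ r))"
          using lM(1,2) unfolding vs
          by (simp_all add: w0_def compose_simps op_scale_compose_left A.M.compose_scale B.M.compose_scale)
        then show ?thesis
          using lM 1 2 by (simp add: A.tr_add B.tr_add A.tr_scale B.tr_scale A.M.scale_in B.M.scale_in del: prod_append prod_simps)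
      qed
    qed
    from this[OF less(2) refl] False show ?thesis by blast
  qed
qed

definition word_pairs :: "(('h \<Rightarrow>\<^sub>L 'h) \<times> ('k \<Rightarrow>\<^sub>L 'k)) set" where
  "word_pairs = {(prod1 ws, prod2 ws) | ws. valid ws}"

lemma word_pairs_trace: "(x, x') \<in> word_pairs \<Longrightarrow> \<tau> x = \<tau>' x'"
  using words_agree by (auto simp: word_pairs_def)

lemma word_pairs_mult:
  assumes "(x, x') \<in> word_pairs" "(y, y') \<in> word_pairs" shows "(x o\<^sub>L y, x' o\<^sub>L y') \<in> word_pairs"
proof -
  obtain ws vs where "valid ws" "x = prod1 ws" "x' = prod2 ws" "valid vs" "y = prod1 vs" "y' = prod2 vs"
    using assms by (auto simp: word_pairs_def)
  moreover have "valid (ws @ vs)" using calculation unfolding valid_def set_append ball_Un by blast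
  ultimately show ?thesis unfolding word_pairs_def by (intro CollectI exI[of _ "ws @ vs"]) simp
qed

lemma word_pairs_power:
  assumes "i < 2" shows "(op_powi (gens i) n, op_powi (gens' i) n) \<in> word_pairs"
proof -
  have "valid [(i, (op_powi (gens i) n, op_powi (gens' i) n))]" using assms by (simp add: valid_def laurent_pairs.power)
  then show ?thesis unfolding word_pairs_def
    by (auto intro!: exI[of _ "[(i, (op_powi (gens i) n, op_powi (gens' i) n))]"])
qed

lemma VU_power: "(op_powi (V o\<^sub>L U) n, op_powi (V' o\<^sub>L U') n) \<in> word_pairs"
proof -
  note u = A.unitary_in_op(1)[OF U] A.unitary_in_op(1)[OF V] B.unitary_in_op(1)[OF U'] B.unitary_in_op(1)[OF V']
  have g: "(op_powi U n, op_powi U' n) \<in> word_pairs" "(op_powi V n, op_powi V' n) \<in> word_pairs" for n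
    using word_pairs_power[of 0 n] word_pairs_power[of 1 n] by (simp_all add: gens_def gens'_def)
  have 1: "(V o\<^sub>L U, V' o\<^sub>L U') \<in> word_pairs" using word_pairs_mult[OF g(2)[of 1] g(1)[of 1]] by simp
  have 2: "(op_inv (V o\<^sub>L U), op_inv (V' o\<^sub>L U')) \<in> word_pairs"
    using word_pairs_mult[OF g(1)[of "-1"] g(2)[of "-1"]] u by (simp add: op_powi_minus_1 unitary_op_mult(2))
  note vu = unitary_op_mult(1)[OF u(2,1)] unitary_op_mult(1)[OF u(4,3)]
  show ?thesis
  proof (induction n rule: int_induct[of _ 0])
    case base
    show ?case using g(1)[of 0] by simp
  next
    case (step1 i)
    show ?case unfolding op_powi_succ[OF vu(1)] op_powi_succ[OF vu(2)] by (rule word_pairs_mult[OF 1 step1(2)])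
  next
    case (step2 i)
    show ?case unfolding op_powi_pred[OF vu(1)] op_powi_pred[OF vu(2)] by (rule word_pairs_mult[OF 2 step2(2)])
  qed
qed

theorem mixed_moments_agree:
  "\<tau> (op_powi U n o\<^sub>L op_powi (V o\<^sub>L U) m) = \<tau>' (op_powi U' n o\<^sub>L op_powi (V' o\<^sub>L U') m)"
  using word_pairs_trace[OF word_pairs_mult[OF word_pairs_power[of 0 n] VU_power[of m]]]
  by (simp add: gens_def gens'_def)

end

section \<open>The operators \<open>L(A)\<close> and \<open>R(B)\<close> and their joint transform\<close>

lemma blinfun_eq_on_dense:
  fixes X Y :: "'g::chilbert_space \<Rightarrow>\<^sub>L 'g"
  assumes "closure S = UNIV" "\<And>u. u \<in> S \<Longrightarrow> X u = Y u" shows "X = Y"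
proof (rule blinfun_eqI)
  fix u
  have "u \<in> closure S" using assms(1) by simp
  then obtain s where s: "\<And>n. s n \<in> S" "s \<longlonglongrightarrow> u" unfolding closure_sequential by blast
  have "(\<lambda>n. X (s n)) \<longlonglongrightarrow> X u" "(\<lambda>n. Y (s n)) \<longlonglongrightarrow> Y u" by (intro blinfun.tendsto tendsto_const s)+
  then show "X u = Y u" using assms(2)[OF s(1)] LIMSEQ_unique by simp
qed

text \<open>An isometric linear map on a dense subspace is uniformly continuous, so it extends continuously;
  all algebraic properties pass to the limit.\<close>

lemma isometry_extension:
  fixes F :: "'g::chilbert_space \<Rightarrow> 'g"
  assumes dense: "closure S = UNIV"
    and S: "\<And>u v. u \<in> S \<Longrightarrow> v \<in> S \<Longrightarrow> u + v \<in> S" "\<And>c u. u \<in> S \<Longrightarrow> scaleC c u \<in> S"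
    and F: "\<And>u v. u \<in> S \<Longrightarrow> v \<in> S \<Longrightarrow> F (u + v) = F u + F v" "\<And>c u. u \<in> S \<Longrightarrow> F (scaleC c u) = scaleC c (F u)"
    and iso: "\<And>u. u \<in> S \<Longrightarrow> norm (F u) = norm u"
  shows "\<exists>X\<in>bops. (\<forall>u\<in>S. blinfun_apply X u = F u) \<and> (\<forall>u. norm (X u) = norm u)"
proof -
  have diff: "F u - F v = F (u - v)" "u - v \<in> S" if "u \<in> S" "v \<in> S" for u v
    using F(1)[OF that(1) S(2)[OF that(2)], of "-1"] F(2)[OF that(2), of "-1"] S(1)[OF that(1) S(2)[OF that(2)], of "-1"]
    by (simp_all add: scaleC_minus1)
  have "uniformly_continuous_on S F"
    unfolding uniformly_continuous_on_def dist_norm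
    by (intro allI impI exI conjI ballI; assumption?) (simp add: diff iso)
  from uniformly_continuous_on_extension_on_closure[OF this]
  obtain g where g: "uniformly_continuous_on (closure S) g" "\<And>u. u \<in> S \<Longrightarrow> F u = g u" by metis
  have cont: "continuous_on UNIV g" using uniformly_continuous_imp_continuous[OF g(1)] dense by simp
  have lim: "(\<lambda>n. g (s n)) \<longlonglongrightarrow> g u" if "s \<longlonglongrightarrow> u" for s u
    using cont that by (simp add: continuous_on_eq_continuous_at isCont_tendsto_compose)
  have seq: "\<exists>s. (\<forall>n. s n \<in> S) \<and> s \<longlonglongrightarrow> u" for u
    using dense closure_sequential[of u S] by simp
  have add: "g (u + v) = g u + g v" for u v
  proof -
    obtain s t where s: "\<And>n. s n \<in> S" "s \<longlonglongrightarrow> u" and t: "\<And>n. t n \<in> S" "t \<longlonglongrightarrow> v" using seq by meson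
    have "(\<lambda>n. g (s n + t n)) \<longlonglongrightarrow> g (u + v)" by (intro lim tendsto_add s t)
    moreover have "(\<lambda>n. g (s n) + g (t n)) \<longlonglongrightarrow> g u + g v" by (intro lim tendsto_add s t)
    moreover have "g (s n + t n) = g (s n) + g (t n)" for n
      using F(1)[OF s(1) t(1)] g(2)[OF s(1)] g(2)[OF t(1)] g(2)[OF S(1)[OF s(1) t(1)]] by simp
    ultimately show ?thesis using LIMSEQ_unique by simp
  qed
  have scale: "g (scaleC c u) = scaleC c (g u)" for c u
  proof -
    obtain s where s: "\<And>n. s n \<in> S" "s \<longlonglongrightarrow> u" using seq by meson
    have "(\<lambda>n. g (scaleC c (s n))) \<longlonglongrightarrow> g (scaleC c u)"
      by (intro lim bounded_linear.tendsto[OF bounded_linear_scaleC] s)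
    moreover have "(\<lambda>n. scaleC c (g (s n))) \<longlonglongrightarrow> scaleC c (g u)"
      by (intro lim bounded_linear.tendsto[OF bounded_linear_scaleC] s)
    moreover have "g (scaleC c (s n)) = scaleC c (g (s n))" for n
      using F(2)[OF s(1)] g(2)[OF s(1)] g(2)[OF S(2)[OF s(1)]] by simp
    ultimately show ?thesis using LIMSEQ_unique by simp
  qed
  have norm: "norm (g u) = norm u" for u
  proof -
    obtain s where s: "\<And>n. s n \<in> S" "s \<longlonglongrightarrow> u" using seq by meson
    have "(\<lambda>n. norm (g (s n))) \<longlonglongrightarrow> norm (g u)" "(\<lambda>n. norm (s n)) \<longlonglongrightarrow> norm u"
      by (intro tendsto_norm lim s)+
    moreover have "norm (g (s n)) = norm (s n)" for n using iso[OF s(1)] g(2)[OF s(1)] by simp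
    ultimately show ?thesis using LIMSEQ_unique by simp
  qed
  have "bounded_linear g"
  proof
    show "g (r *\<^sub>R u) = r *\<^sub>R g u" for r u using scale[of "complex_of_real r" u] by (simp add: scaleC_of_real)
    show "\<exists>K. \<forall>u. norm (g u) \<le> norm u * K" by (intro exI[of _ 1]) (simp add: norm)
  qed (rule add)
  then have B: "blinfun_apply (Blinfun g) = g" by (rule bounded_linear_Blinfun_apply)
  show ?thesis
    by (intro bexI[of _ "Blinfun g"]) (auto simp: B bops_def scale norm g(2))
qed

text \<open>Polarization expresses the inner product by norms.\<close>

lemma isometry_cinner:
  assumes "X \<in> bops" "\<And>u. norm (blinfun_apply X u) = norm u"
  shows "cinner (X p) (X q) = cinner p (q :: 'g::chilbert_space)"
proof -
  have id: "(id_blinfun :: 'g \<Rightarrow>\<^sub>L 'g) \<in> bops" by (rule op_algebra.one_in[OF bops_algebra])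
  have "X (p + scaleC (\<i> ^ k) q) = X p + scaleC (\<i> ^ k) (X q)" for k
    using bops_apply[OF assms(1)] by (simp add: blinfun.bilinear_simps)
  then have "cinner (X p + scaleC (\<i> ^ k) (X q)) (X p + scaleC (\<i> ^ k) (X q)) = cinner (p + scaleC (\<i> ^ k) q) (p + scaleC (\<i> ^ k) q)" for k
    unfolding cinner_self by (metis assms(2))
  then have "4 * cinner (X p) (X q) = 4 * cinner p q"
    using polarization[OF id, of "X p" "X q"] polarization[OF id, of p q] by simp
  then show ?thesis by simp
qed

lemma is_adjoint_mult: "is_adjoint x x' \<Longrightarrow> is_adjoint y y' \<Longrightarrow> is_adjoint (x o\<^sub>L y) (y' o\<^sub>L x')"
  by (simp add: is_adjoint_def)

lemma adj_id: "adj id_blinfun = (id_blinfun :: 'h::chilbert_space \<Rightarrow>\<^sub>L 'h)"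
  by (rule adj_eqI) (simp add: is_adjoint_def)

context gns_space
begin

lemma adj_mult: "x \<in> M \<Longrightarrow> y \<in> M \<Longrightarrow> adj (x o\<^sub>L y) = adj y o\<^sub>L adj x"
  by (intro adj_eqI is_adjoint_mult von_neumann_adj(2)[OF vna])

lemma adj_in: "x \<in> M \<Longrightarrow> adj x \<in> M"
  by (rule von_neumann_adj(1)[OF vna])

text \<open>A linear map of \<open>M\<close> that preserves \<open>\<tau>(x\<^sup>* x)\<close> is implemented by an isometry of the GNS space.\<close>

lemma gns_extension:
  assumes f: "\<And>x. x \<in> M \<Longrightarrow> f x \<in> M" "\<And>x y. x \<in> M \<Longrightarrow> y \<in> M \<Longrightarrow> f (x + y) = f x + f y"
      "\<And>c x. x \<in> M \<Longrightarrow> f (op_scale c x) = op_scale c (f x)"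
    and iso: "\<And>x. x \<in> M \<Longrightarrow> \<tau> (adj (f x) o\<^sub>L f x) = \<tau> (adj x o\<^sub>L x)"
  shows "\<exists>X\<in>bops. (\<forall>x\<in>M. blinfun_apply X (Lam x) = Lam (f x)) \<and> (\<forall>u. norm (blinfun_apply X u) = norm u)"
proof -
  have n: "norm (Lam (f x)) = norm (Lam x)" if "x \<in> M" for x
  proof -
    have "complex_of_real ((norm (Lam (f x)))\<^sup>2) = complex_of_real ((norm (Lam x))\<^sup>2)"
      unfolding cinner_self[symmetric] using that f(1) iso by (simp add: Lam_cinner)
    then have "(norm (Lam (f x)))\<^sup>2 = (norm (Lam x))\<^sup>2" by (simp only: of_real_eq_iff)
    then show ?thesis by simp
  qed
  have minus: "Lam (- x) = - Lam x" "f (- x) = - f x" if "x \<in> M" for x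
    using Lam_scale[OF that, of "-1"] f(3)[OF that, of "-1"] by (simp_all add: op_scale_minus1 scaleC_minus1)
  have well: "Lam (f x) = Lam (f y)" if "x \<in> M" "y \<in> M" "Lam x = Lam y" for x y
  proof -
    have "Lam (x + - y) = 0" using that Lam_add[of x "- y"] minus(1)[of y] M.minus_in by simp
    then have "norm (Lam (f (x + - y))) = 0" using n[OF M.diff_in[OF that(1,2)]] by simp
    moreover have "Lam (f (x + - y)) = Lam (f x) - Lam (f y)"
      using that f(1) f(2)[of x "- y"] Lam_add[of "f x" "- f y"] minus(2)[of y] minus(1)[of "f y"] M.minus_in by simp
    ultimately show ?thesis by simp
  qed
  define F where "F u = Lam (f (SOME x. x \<in> M \<and> Lam x = u))" for u
  have F: "F (Lam x) = Lam (f x)" if "x \<in> M" for x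
  proof -
    have "(SOME y. y \<in> M \<and> Lam y = Lam x) \<in> M \<and> Lam (SOME y. y \<in> M \<and> Lam y = Lam x) = Lam x"
      by (rule someI[of "\<lambda>y. y \<in> M \<and> Lam y = Lam x" x]) (simp add: that)
    then show ?thesis unfolding F_def using well[OF _ that] by blast
  qed
  have "\<exists>X\<in>bops. (\<forall>u\<in>Lam ` M. blinfun_apply X u = F u) \<and> (\<forall>u. norm (X u) = norm u)"
  proof (rule isometry_extension[OF Lam_dense])
    fix u v c assume u: "u \<in> Lam ` M"
    then obtain x where x: "x \<in> M" "u = Lam x" by blast
    show "norm (F u) = norm u" using x n F by simp
    have cx: "scaleC c u = Lam (op_scale c x)" using x Lam_scale by simp
    show "scaleC c u \<in> Lam ` M" unfolding cx using M.scale_in x by blast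
    show "F (scaleC c u) = scaleC c (F u)" unfolding cx by (simp only: F[OF M.scale_in[OF x(1)]] f(3)[OF x(1)] Lam_scale[OF f(1)[OF x(1)]] x(2) F[OF x(1)])
    assume "v \<in> Lam ` M"
    then obtain y where y: "y \<in> M" "v = Lam y" by blast
    have xy: "u + v = Lam (x + y)" using x y Lam_add by simp
    show "u + v \<in> Lam ` M" unfolding xy using M.add_in x y by blast
    show "F (u + v) = F u + F v" unfolding xy
      by (simp only: F[OF M.add_in[OF x(1) y(1)]] f(2)[OF x(1) y(1)] Lam_add[OF f(1)[OF x(1)] f(1)[OF y(1)]] x(2) y(2) F[OF x(1)] F[OF y(1)])
  qed
  then show ?thesis using F by auto
qed

lemma gns_op_unique:
  "\<forall>x\<in>M. blinfun_apply X (Lam x) = G x \<Longrightarrow> \<forall>x\<in>M. blinfun_apply Y (Lam x) = G x \<Longrightarrow> X = (Y :: 'g \<Rightarrow>\<^sub>L 'g)"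
  by (rule blinfun_eq_on_dense[OF Lam_dense]) auto

text \<open>Left multiplication by a unitary does not change \<open>x\<^sup>* x\<close>.\<close>

lemma left_mult:
  assumes S: "unitary_in M S"
  shows "left_mult M Lam S \<in> bops" "\<And>x. x \<in> M \<Longrightarrow> left_mult M Lam S (Lam x) = Lam (S o\<^sub>L x)"
    "norm (left_mult M Lam S u) = norm u"
proof -
  note So = unitary_in_op[OF S]
  have "\<tau> (adj (S o\<^sub>L x) o\<^sub>L (S o\<^sub>L x)) = \<tau> (adj x o\<^sub>L x)" if "x \<in> M" for x
    using that So by (simp add: adj_mult compose_assoc compose_cancel[OF unitary_op_inv(2)[OF So(1)]])
  then obtain X where X: "X \<in> bops" "\<forall>x\<in>M. blinfun_apply X (Lam x) = Lam (S o\<^sub>L x)" "\<forall>u. norm (blinfun_apply X u) = norm u"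
    using gns_extension[of "\<lambda>x. S o\<^sub>L x"] So(2) by (auto simp: M.mult_in compose_simps M.compose_scale)
  have "left_mult M Lam S = X"
    unfolding left_mult_def using X by (intro the_equality) (auto intro: gns_op_unique)
  then show "left_mult M Lam S \<in> bops" "\<And>x. x \<in> M \<Longrightarrow> left_mult M Lam S (Lam x) = Lam (S o\<^sub>L x)"
    "norm (left_mult M Lam S u) = norm u" using X by auto
qed

text \<open>Here \<open>\<tau>(S\<^sup>* x\<^sup>* x S) = \<tau>(x\<^sup>* x)\<close> because \<open>\<tau>\<close> is a trace.\<close>

lemma right_mult:
  assumes S: "unitary_in M S"
  shows "right_mult M Lam S \<in> bops" "\<And>x. x \<in> M \<Longrightarrow> right_mult M Lam S (Lam x) = Lam (x o\<^sub>L S)"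
    "norm (right_mult M Lam S u) = norm u"
proof -
  note So = unitary_in_op[OF S]
  have "\<tau> (adj (x o\<^sub>L S) o\<^sub>L (x o\<^sub>L S)) = \<tau> (adj x o\<^sub>L x)" if x: "x \<in> M" for x
  proof -
    have "\<tau> (adj (x o\<^sub>L S) o\<^sub>L (x o\<^sub>L S)) = \<tau> (op_inv S o\<^sub>L (adj x o\<^sub>L (x o\<^sub>L S)))"
      using x So by (simp add: adj_mult compose_assoc)
    also have "\<dots> = \<tau> ((adj x o\<^sub>L (x o\<^sub>L S)) o\<^sub>L op_inv S)"
      by (rule tr_trace) (use x So adj_in in \<open>auto intro!: M.mult_in\<close>)
    also have "\<dots> = \<tau> (adj x o\<^sub>L x)"
      by (simp add: compose_assoc unitary_op_inv(1)[OF So(1)])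
    finally show ?thesis .
  qed
  then obtain X where X: "X \<in> bops" "\<forall>x\<in>M. blinfun_apply X (Lam x) = Lam (x o\<^sub>L S)" "\<forall>u. norm (blinfun_apply X u) = norm u"
    using gns_extension[of "\<lambda>x. x o\<^sub>L S"] So(2) by (auto simp: M.mult_in compose_simps op_scale_compose_left)
  have "right_mult M Lam S = X"
    unfolding right_mult_def using X by (intro the_equality) (auto intro: gns_op_unique)
  then show "right_mult M Lam S \<in> bops" "\<And>x. x \<in> M \<Longrightarrow> right_mult M Lam S (Lam x) = Lam (x o\<^sub>L S)"
    "norm (right_mult M Lam S u) = norm u" using X by auto
qed

lemma left_mult_unitary:
  assumes S: "unitary_in M S"
  shows "unitary_op (left_mult M Lam S)" "op_inv (left_mult M Lam S) = left_mult M Lam (op_inv S)"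
proof -
  note So = unitary_in_op[OF S] note I = unitary_in_inv[OF S]
  let ?L = "left_mult M Lam"
  have e: "?L S o\<^sub>L ?L (op_inv S) = id_blinfun" "?L (op_inv S) o\<^sub>L ?L S = id_blinfun"
    using left_mult(2)[OF S] left_mult(2)[OF I] So unitary_op_inv(1,2)[OF So(1)]
    by (auto intro!: gns_op_unique[where G = Lam] simp: M.mult_in compose_cancel)
  then show "op_inv (?L S) = ?L (op_inv S)" by (rule op_inv_eqI)
  show "unitary_op (?L S)" unfolding unitary_op_def
    using left_mult(1)[OF S] left_mult(1)[OF I] e isometry_cinner[OF left_mult(1,3)[OF S]] by blast
qed

lemma right_mult_unitary:
  assumes S: "unitary_in M S"
  shows "unitary_op (right_mult M Lam S)" "op_inv (right_mult M Lam S) = right_mult M Lam (op_inv S)"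
proof -
  note So = unitary_in_op[OF S] note I = unitary_in_inv[OF S]
  let ?L = "right_mult M Lam"
  have e: "?L S o\<^sub>L ?L (op_inv S) = id_blinfun" "?L (op_inv S) o\<^sub>L ?L S = id_blinfun"
    using right_mult(2)[OF S] right_mult(2)[OF I] So unitary_op_inv(1,2)[OF So(1)]
    by (auto intro!: gns_op_unique[where G = Lam] simp: M.mult_in compose_assoc)
  then show "op_inv (?L S) = ?L (op_inv S)" by (rule op_inv_eqI)
  show "unitary_op (?L S)" unfolding unitary_op_def
    using right_mult(1)[OF S] right_mult(1)[OF I] e isometry_cinner[OF right_mult(1,3)[OF S]] by blast
qed

lemma left_mult_powi:
  assumes S: "unitary_in M S" and x: "x \<in> M"
  shows "op_powi (left_mult M Lam S) n (Lam x) = Lam (op_powi S n o\<^sub>L x)"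
proof (induction n rule: int_induct[of _ 0])
  case (step1 i)
  then show ?case using x unitary_in_op[OF S]
    by (simp add: op_powi_succ left_mult_unitary[OF S] left_mult(2)[OF S] M.mult_in compose_assoc)
next
  case (step2 i)
  then show ?case using x unitary_in_op[OF S]
    by (simp add: op_powi_pred left_mult_unitary[OF S] left_mult(2)[OF unitary_in_inv[OF S]] M.mult_in compose_assoc)
qed simp

lemma right_mult_powi:
  assumes S: "unitary_in M S" and x: "x \<in> M"
  shows "op_powi (right_mult M Lam S) n (Lam x) = Lam (x o\<^sub>L op_powi S n)"
proof (induction n rule: int_induct[of _ 0])
  case (step1 i)
  have "op_powi S (i + 1) = op_powi S i o\<^sub>L S" using op_powi_add[OF unitary_in_op(1)[OF S], of i 1] by simp
  then show ?case using step1 x unitary_in_op[OF S]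
    by (simp add: op_powi_succ[OF right_mult_unitary(1)[OF S]] right_mult(2)[OF S] M.mult_in compose_assoc)
next
  case (step2 i)
  have "op_powi S (i - 1) = op_powi S i o\<^sub>L op_inv S"
    using op_powi_add[OF unitary_in_op(1)[OF S], of i "-1"] op_powi_minus_1[OF unitary_in_op(1)[OF S]] by simp
  then show ?case using step2 x unitary_in_op[OF S]
    by (simp add: op_powi_pred[OF right_mult_unitary(1)[OF S]] right_mult_unitary(2)[OF S] right_mult(2)[OF unitary_in_inv[OF S]] M.mult_in compose_assoc)
qed simp

lemma left_right_commute:
  assumes "unitary_in M A" "unitary_in M B"
  shows "left_mult M Lam A o\<^sub>L right_mult M Lam B = right_mult M Lam B o\<^sub>L left_mult M Lam A"
  by (rule gns_op_unique[where G = "\<lambda>x. Lam (A o\<^sub>L (x o\<^sub>L B))"])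
     (use left_mult(2)[OF assms(1)] right_mult(2)[OF assms(2)] unitary_in_op(2)[OF assms(1)] unitary_in_op(2)[OF assms(2)]
       in \<open>auto simp: M.mult_in compose_assoc\<close>)

lemma vec_state_Lam: "x \<in> M \<Longrightarrow> cinner (Lam x) (Lam id_blinfun) = \<tau> x"
  by (simp add: Lam_cinner M.one_in adj_id)

lemma vec_state_moments:
  assumes A: "unitary_in M A" and B: "unitary_in M B"
  shows "vec_state Lam (op_powi (left_mult M Lam A) n o\<^sub>L op_powi (right_mult M Lam B) m) = \<tau> (op_powi A n o\<^sub>L op_powi B m)"
    "vec_state Lam (op_powi (left_mult M Lam A) n) = \<tau> (op_powi A n)"
    "vec_state Lam (op_powi (right_mult M Lam B) m) = \<tau> (op_powi B m)"
  using unitary_in_op(5)[OF A] unitary_in_op(5)[OF B]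
  by (simp_all add: vec_state_def left_mult_powi[OF A] right_mult_powi[OF B] M.one_in M.mult_in vec_state_Lam)

lemma joint_distribution_moments:
  assumes A: "unitary_in M A" and B: "unitary_in M B"
  shows "has_torus_moments (joint_distribution (vec_state Lam) (left_mult M Lam A) (right_mult M Lam B))
    (\<lambda>n m. \<tau> (op_powi A n o\<^sub>L op_powi B m))"
  using torus_moments_exist[OF left_mult_unitary(1)[OF A] right_mult_unitary(1)[OF B] left_right_commute[OF A B], of "Lam id_blinfun"]
  unfolding joint_distribution_def vec_state_def[symmetric] vec_state_moments[OF A B] .

text \<open>The moments of a unitary are matrix coefficients of the powers of \<open>L(A)\<close> at the vector \<open>Lam 1\<close>, so
  the measure with these moments exists.\<close>

lemma distribution_moments:
  assumes A: "unitary_in M A"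
  shows "has_circle_moments (distribution \<tau> A) (\<lambda>n. \<tau> (op_powi A n))"
  using circle_moments_exist[OF left_mult_unitary(1)[OF A], of "Lam id_blinfun"]
  unfolding distribution_def vec_state_def[symmetric] vec_state_moments(2)[OF A A] .

lemma vec_psi:
  assumes A: "unitary_in M A" and z: "norm z \<noteq> 1"
  shows "psi (vec_state Lam) (left_mult M Lam A) z = psi \<tau> A z" "psi (vec_state Lam) (right_mult M Lam A) z = psi \<tau> A z"
proof -
  have v: "op_state bops (vec_state Lam)" using vec_op_state[of "Lam id_blinfun"] by (simp add: vec_state_def[abs_def])
  have L: "op_powi (left_mult M Lam A) n \<in> bops" "op_powi (right_mult M Lam A) n \<in> bops" for n
    using op_powi_unitary[OF left_mult_unitary(1)[OF A]] op_powi_unitary[OF right_mult_unitary(1)[OF A]] unitary_op_inv(4) by blast+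
  note Ao = unitary_in_op[OF A]
  show "psi (vec_state Lam) (left_mult M Lam A) z = psi \<tau> A z"
    by (rule psi_cong[OF v left_mult_unitary(1)[OF A] L(1) M.op_state_axioms Ao(1,5) vec_state_moments(2)[OF A A] z])
  show "psi (vec_state Lam) (right_mult M Lam A) z = psi \<tau> A z"
    by (rule psi_cong[OF v right_mult_unitary(1)[OF A] L(2) M.op_state_axioms Ao(1,5) vec_state_moments(3)[OF A A] z])
qed

text \<open>The integrand is a product of two geometric series. Its partial sums are trigonometric polynomials
  with known integrals, and dominated convergence gives the limit.\<close>

lemma psi2_resolvents:
  assumes A: "unitary_in M A" and B: "unitary_in M B" and z: "norm z < 1" "norm w < 1"
  shows "psi2 (vec_state Lam) (left_mult M Lam A) (right_mult M Lam B) z w = \<tau> ((res z A - id_blinfun) o\<^sub>L (res w B - id_blinfun))"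
proof -
  let ?J = "joint_distribution (vec_state Lam) (left_mult M Lam A) (right_mult M Lam B)"
  note Ao = unitary_in_op[OF A] note Bo = unitary_in_op[OF B]
  have J: "sets ?J = sets (restrict_space borel torus)" "finite_measure ?J"
    and mom: "\<And>n m. (\<integral>p. fst p powi n * snd p powi m \<partial>?J) = \<tau> (op_powi A n o\<^sub>L op_powi B m)"
    using joint_distribution_moments[OF A B] by (auto simp: has_torus_moments_def)
  have sp: "space ?J = torus" using sets_eq_imp_space_eq[OF J(1)] by (simp add: space_restrict_space)
  interpret J: finite_measure ?J by (rule J(2))
  define a where "a N p = (\<Sum>n<N. z ^ Suc n * fst p powi int (Suc n))" for N and p :: "complex \<times> complex"
  define b where "b N p = (\<Sum>n<N. w ^ Suc n * snd p powi int (Suc n))" for N and p :: "complex \<times> complex"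
  define S where "S N = (\<Sum>n<N. op_scale (z ^ Suc n) (op_powi A (int (Suc n))))" for N
  define T where "T N = (\<Sum>n<N. op_scale (w ^ Suc n) (op_powi B (int (Suc n))))" for N
  have SM: "S N \<in> M" "T N \<in> M" for N unfolding S_def T_def using Ao Bo by (auto intro!: M.sum_in M.scale_in simp del: op_powi_int of_nat_Suc)
  have lim: "(\<lambda>N. \<Sum>n<N. op_scale (z ^ Suc n) (op_powi C (int (Suc n)))) \<longlonglongrightarrow> res z C - id_blinfun" if "unitary_op C" "norm z < 1" for C :: "'h \<Rightarrow>\<^sub>L 'h" and z
    using sums_Suc_iff[of "\<lambda>n. op_scale (z ^ n) (op_powi C (int n))" "res z C - id_blinfun"] res_sums[OF that]
    by (simp add: sums_def del: op_powi_int of_nat_Suc power_Suc)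
  have "(\<lambda>N. S N o\<^sub>L T N) \<longlonglongrightarrow> ((res z A - id_blinfun) o\<^sub>L (res w B - id_blinfun))"
    unfolding S_def T_def by (intro tendsto_blinfun_compose lim Ao Bo z)
  then have l1: "(\<lambda>N. \<tau> (S N o\<^sub>L T N)) \<longlonglongrightarrow> \<tau> ((res z A - id_blinfun) o\<^sub>L (res w B - id_blinfun))"
    by (intro tr_tendsto M.mult_in SM)
  have int: "integrable ?J (\<lambda>p. fst p powi n * snd p powi m)" for n m
    by (rule trig2.integrable_P[OF J trig2_mono])
  have eq: "\<tau> (S N o\<^sub>L T N) = (\<integral>p. a N p * b N p \<partial>?J)" for N
  proof -
    have "S N o\<^sub>L T N = (\<Sum>n<N. \<Sum>m<N. op_scale (z ^ Suc n * w ^ Suc m) (op_powi A (int (Suc n)) o\<^sub>L op_powi B (int (Suc m))))"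
      unfolding S_def T_def
        bounded_bilinear.sum_left[OF bounded_bilinear_blinfun_compose] bounded_bilinear.sum_right[OF bounded_bilinear_blinfun_compose]
      using Ao(5) by (simp add: op_scale_compose_left M.compose_scale op_scale_scale del: op_powi_int of_nat_Suc power_Suc) (rule sum.swap)
    then have "\<tau> (S N o\<^sub>L T N) = (\<Sum>n<N. \<Sum>m<N. z ^ Suc n * w ^ Suc m * \<tau> (op_powi A (int (Suc n)) o\<^sub>L op_powi B (int (Suc m))))"
      using Ao(5) Bo(5) by (simp add: M.\<phi>_sum M.sum_in M.scale_in M.mult_in tr_scale del: op_powi_int of_nat_Suc power_Suc)
    also have "\<dots> = (\<Sum>n<N. \<Sum>m<N. z ^ Suc n * w ^ Suc m * (\<integral>p. fst p powi int (Suc n) * snd p powi int (Suc m) \<partial>?J))"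
      by (simp only: mom)
    also have "\<dots> = (\<integral>p. (\<Sum>n<N. \<Sum>m<N. z ^ Suc n * w ^ Suc m * (fst p powi int (Suc n) * snd p powi int (Suc m))) \<partial>?J)"
      using int by (simp del: of_nat_Suc power_Suc power_int_of_nat)
    also have "\<dots> = (\<integral>p. a N p * b N p \<partial>?J)"
      unfolding a_def b_def sum_product by (intro Bochner_Integration.integral_cong sum.cong refl) simp
    finally show ?thesis .
  qed
  have geo: "(\<lambda>N. \<Sum>n<N. z ^ Suc n * s powi int (Suc n)) \<longlonglongrightarrow> z * s / (1 - z * s)"
    "\<And>N. norm (\<Sum>n<N. z ^ Suc n * s powi int (Suc n)) \<le> 1 / (1 - norm z)"
    if s: "norm s = 1" and z: "norm z < 1" for z s :: complex
  proof -
    have e: "z ^ Suc n * s powi int (Suc n) = (z * s) * (z * s) ^ n" for n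
      by (simp add: power_mult_distrib mult_ac del: of_nat_Suc)
    have zs: "norm (z * s) < 1" using s z by (simp add: norm_mult)
    have "(\<lambda>n. (z * s) * (z * s) ^ n) sums ((z * s) * (1 / (1 - z * s)))" by (intro sums_mult geometric_sums zs)
    then show "(\<lambda>N. \<Sum>n<N. z ^ Suc n * s powi int (Suc n)) \<longlonglongrightarrow> z * s / (1 - z * s)"
      unfolding e by (simp add: sums_def)
    fix N
    have "norm (\<Sum>n<N. z ^ Suc n * s powi int (Suc n)) \<le> (\<Sum>n<N. norm z ^ Suc n)"
      unfolding e using s by (intro order_trans[OF norm_sum] sum_mono) (simp add: norm_mult norm_power)
    also have "\<dots> \<le> (\<Sum>n<N. norm z ^ n)" using z by (intro sum_mono power_decreasing) auto
    also have "\<dots> \<le> (\<Sum>n. norm z ^ n)" using z by (intro sum_le_suminf) auto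
    also have "\<dots> = 1 / (1 - norm z)" using z by (intro suminf_geometric) simp
    finally show "norm (\<Sum>n<N. z ^ Suc n * s powi int (Suc n)) \<le> 1 / (1 - norm z)" .
  qed
  have am: "a N \<in> borel_measurable ?J" "b N \<in> borel_measurable ?J" for N
  proof -
    have "continuous_on torus (a N)" "continuous_on torus (b N)"
      unfolding a_def b_def by (auto intro!: continuous_intros)
    then show "a N \<in> borel_measurable ?J" "b N \<in> borel_measurable ?J"
      using trig2.measurable_cont[OF J(1)] J(2) by auto
  qed
  have cm: "(\<lambda>p. (z * fst p / (1 - z * fst p)) * (w * snd p / (1 - w * snd p))) \<in> borel_measurable ?J"
  proof -
    have "1 - z * s \<noteq> 0" if "norm z < 1" "norm s = 1" for z s :: complex
    proof
      assume "1 - z * s = 0"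
      then have "z * s = 1" by simp
      then have "norm (z * s) = 1" by simp
      then show False using that by (simp add: norm_mult)
    qed
    then have "continuous_on torus (\<lambda>p. (z * fst p / (1 - z * fst p)) * (w * snd p / (1 - w * snd p)))"
      using z by (intro continuous_intros) auto
    then show ?thesis using trig2.measurable_cont[OF J(1)] J(2) by auto
  qed
  have "(\<lambda>N. \<integral>p. a N p * b N p \<partial>?J) \<longlonglongrightarrow> (\<integral>p. (z * fst p / (1 - z * fst p)) * (w * snd p / (1 - w * snd p)) \<partial>?J)"
  proof (rule integral_dominated_convergence[where w = "\<lambda>_. (1 / (1 - norm z)) * (1 / (1 - norm w))"])
    show "AE p in ?J. (\<lambda>N. a N p * b N p) \<longlonglongrightarrow> (z * fst p / (1 - z * fst p)) * (w * snd p / (1 - w * snd p))"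
      unfolding a_def b_def by (intro AE_I2 tendsto_mult geo z) (auto simp: sp)
    show "AE p in ?J. norm (a N p * b N p) \<le> (1 / (1 - norm z)) * (1 / (1 - norm w))" for N
      unfolding a_def b_def norm_mult using z by (intro AE_I2 mult_mono geo) (auto simp: sp)
  qed (use am cm in auto)
  then show ?thesis unfolding psi2_def using l1 eq LIMSEQ_unique by simp
qed

lemma H_fun_resolvents:
  assumes A: "unitary_in M A" and B: "unitary_in M B" and z: "norm z < 1" "norm w < 1"
  shows "H_fun (vec_state Lam) (left_mult M Lam A) (right_mult M Lam B) z w = \<tau> (res z A o\<^sub>L res w B)"
proof -
  note Ao = unitary_in_op[OF A] note Bo = unitary_in_op[OF B]
  have "res z A \<in> M" "res w B \<in> M" using M.res_in[OF Ao(1,5) z(1)] M.res_in[OF Bo(1,5) z(2)] by auto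
  then have "\<tau> ((res z A - id_blinfun) o\<^sub>L (res w B - id_blinfun)) = \<tau> (res z A o\<^sub>L res w B) - \<tau> (res z A) - \<tau> (res w B) + 1"
    by (simp add: compose_simps tr_diff M.diff_in M.mult_in M.one_in tr_one)
  then show ?thesis
    unfolding H_fun_def psi2_resolvents[OF A B z]
    using vec_psi(1)[OF A, of z] vec_psi(2)[OF B, of w] z M.psi_res[OF Ao(1,5) z(1)] M.psi_res[OF Bo(1,5) z(2)]
    by (simp add: tr_one)
qed

end

section \<open>Transition operators\<close>

text \<open>If \<open>k\<close> is orthogonal to all trigonometric polynomials, approximating the conjugate of \<open>k\<close> by such
  polynomials yields \<open>\<integral> |k|\<^sup>2 d\<mu> = 0\<close>.\<close>

lemma zero_moments_AE:
  assumes \<mu>: "sets \<mu> = sets (restrict_space borel circle)" "finite_measure \<mu>"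
    and k: "k \<in> Linf" and zero: "\<And>n. (\<integral>s. s powi n * k s \<partial>\<mu>) = 0"
  shows "AE s in \<mu>. k s = 0"
proof -
  interpret finite_measure \<mu> by (rule \<mu>(2))
  have sp: "space \<mu> = circle" using sets_eq_imp_space_eq[OF \<mu>(1)] by (simp add: space_restrict_space)
  obtain C where C: "\<forall>s\<in>circle. norm (k s) \<le> C" using Linf_bounded[OF k] by blast
  have C0: "0 \<le> C" using C[rule_format, of 1] order_trans[OF norm_ge_zero] by auto
  have km: "k \<in> borel_measurable \<mu>"
    using Linf_measurable[OF k] by (simp only: measurable_cong_sets[OF \<mu>(1) refl])
  have ki: "integrable \<mu> k" by (rule Linf_integrable[OF k \<mu>])
  have bounded_product: "integrable \<mu> (\<lambda>s. f s * k s)" if f: "integrable \<mu> f" for f :: "complex \<Rightarrow> complex"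
  proof (rule Bochner_Integration.integrable_bound)
    show "integrable \<mu> (\<lambda>s. of_real C * f s)" using f by simp
    show "(\<lambda>s. f s * k s) \<in> borel_measurable \<mu>" using f km by measurable
    show "AE s in \<mu>. norm (f s * k s) \<le> norm (of_real C * f s)"
    proof (rule AE_I2)
      fix s assume "s \<in> space \<mu>"
      then have "norm (f s) * norm (k s) \<le> norm (f s) * C" using C by (intro mult_left_mono) (auto simp: sp)
      then show "norm (f s * k s) \<le> norm (of_real C * f s)" using C0 by (simp add: norm_mult mult.commute)
    qed
  qed
  have poly: "(\<integral>s. g s * k s \<partial>\<mu>) = 0" if "g \<in> trig1" for g
    using that
  proof (induction g rule: trig1_induct)
    case (mono n) show ?case by (rule zero)
  next
    case (add f g)
    then show ?case
      using bounded_product[OF trig1.integrable_P[OF \<mu> add(1)]] bounded_product[OF trig1.integrable_P[OF \<mu> add(2)]]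
      by (simp add: distrib_right)
  next
    case (scale f c)
    then show ?case by (simp add: mult.assoc)
  qed
  have cki: "integrable \<mu> (\<lambda>s. cnj (k s))" using ki by simp
  have "norm (\<integral>s. cnj (k s) * k s \<partial>\<mu>) \<le> 0 + e" if e: "e > 0" for e
  proof -
    define d where "d = e / (C + 1)"
    have d: "d > 0" "C * d \<le> e" using e C0 by (auto simp: d_def field_simps)
    obtain g where g: "g \<in> trig1" "(\<integral>s. norm (cnj (k s) - g s) \<partial>\<mu>) < d" using trig1.P_dense[OF \<mu> cki d(1)] by blast
    have gi: "integrable \<mu> g" by (rule trig1.integrable_P[OF \<mu> g(1)])
    have "(\<integral>s. cnj (k s) * k s \<partial>\<mu>) = (\<integral>s. (cnj (k s) - g s) * k s \<partial>\<mu>)"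
      using bounded_product[OF cki] bounded_product[OF gi] poly[OF g(1)] by (simp add: left_diff_distrib)
    then have "norm (\<integral>s. cnj (k s) * k s \<partial>\<mu>) \<le> (\<integral>s. norm ((cnj (k s) - g s) * k s) \<partial>\<mu>)" by simp
    also have "\<dots> \<le> (\<integral>s. C * norm (cnj (k s) - g s) \<partial>\<mu>)"
    proof (rule integral_mono)
      show "integrable \<mu> (\<lambda>s. norm ((cnj (k s) - g s) * k s))"
        by (intro integrable_norm bounded_product Bochner_Integration.integrable_diff cki gi)
      show "integrable \<mu> (\<lambda>s. C * norm (cnj (k s) - g s))" using cki gi by simp
      fix s assume "s \<in> space \<mu>"
      then have "norm (cnj (k s) - g s) * norm (k s) \<le> norm (cnj (k s) - g s) * C"
        using C by (intro mult_left_mono) (auto simp: sp)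
      then show "norm ((cnj (k s) - g s) * k s) \<le> C * norm (cnj (k s) - g s)" by (simp add: norm_mult mult.commute)
    qed
    also have "\<dots> = C * (\<integral>s. norm (cnj (k s) - g s) \<partial>\<mu>)" by simp
    also have "\<dots> \<le> C * d" using g(2) C0 by (intro mult_left_mono) auto
    finally show ?thesis using d(2) by simp
  qed
  then have "norm (\<integral>s. cnj (k s) * k s \<partial>\<mu>) \<le> 0" by (rule field_le_epsilon)
  moreover have "(\<integral>s. cnj (k s) * k s \<partial>\<mu>) = complex_of_real (\<integral>s. (norm (k s))\<^sup>2 \<partial>\<mu>)"
    by (subst integral_complex_of_real[symmetric])
       (intro Bochner_Integration.integral_cong refl, simp only: complex_norm_square[symmetric] mult.commute[of "cnj _"])
  moreover have "0 \<le> (\<integral>s. (norm (k s))\<^sup>2 \<partial>\<mu>)" by simp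
  ultimately have z: "(\<integral>s. (norm (k s))\<^sup>2 \<partial>\<mu>) = 0" by (simp add: antisym)
  have "integrable \<mu> (\<lambda>s. (norm (k s))\<^sup>2)"
    using bounded_product[OF cki] integrable_norm by (fastforce simp: norm_mult power2_eq_square)
  then have "AE s in \<mu>. (norm (k s))\<^sup>2 = 0"
    using z by (subst (asm) integral_nonneg_eq_0_iff_AE) auto
  then show ?thesis by eventually_elim simp
qed

context tracial_vna
begin

lemma vn_generated_powers:
  assumes "unitary_in M A"
  shows "op_powi A n \<in> vn_generated A" "vn_generated A \<subseteq> M"
proof -
  note Ao = unitary_in_op[OF assms]
  have "op_powi A n \<in> N" if N: "von_neumann_algebra N" "A \<in> N" for N
  proof -
    have "op_inv A \<in> N" using von_neumann_adj(1)[OF N] Ao(4) by simp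
    then show ?thesis by (rule op_algebra.op_powi_in[OF von_neumann_op_algebra[OF N(1)] Ao(1) N(2)])
  qed
  then show "op_powi A n \<in> vn_generated A" by (auto simp: vn_generated_def)
  show "vn_generated A \<subseteq> M" using vna Ao(2) by (auto simp: vn_generated_def)
qed

end

context gns_space
begin

text \<open>The case of one unitary: the joint distribution of the pair \<open>(A, A)\<close> is the image of the
  distribution of \<open>A\<close> on the diagonal of the torus.\<close>

lemma trace_own_calculus:
  assumes A: "unitary_in M A" and x: "x \<in> M" "is_borel_calculus A h x" and h: "h \<in> Linf"
  shows "\<tau> (op_powi A n o\<^sub>L x) = (\<integral>s. s powi n * h s \<partial>distribution \<tau> A)"
proof -
  let ?\<mu> = "distribution \<tau> A"
  note Ao = unitary_in_op[OF A]
  have \<mu>: "sets ?\<mu> = sets (restrict_space borel circle)" "finite_measure ?\<mu>" "\<And>n. (\<integral>s. s powi n \<partial>?\<mu>) = \<tau> (op_powi A n)"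
    using distribution_moments[OF A] by (auto simp: has_circle_moments_def)
  have sp: "space ?\<mu> = circle" using sets_eq_imp_space_eq[OF \<mu>(1)] by (simp add: space_restrict_space)
  define d where "d s = (s, s)" for s :: complex
  have dm: "d \<in> measurable ?\<mu> (restrict_space borel torus)"
  proof (subst measurable_cong_sets[OF \<mu>(1) refl], rule measurable_restrict_space3)
    show "d \<in> borel_measurable borel" unfolding d_def by (intro borel_measurable_continuous_onI continuous_intros)
    show "d \<in> circle \<rightarrow> torus" by (rule Pi_I) (simp add: d_def)
  qed
  let ?J = "distr ?\<mu> (restrict_space borel torus) d"
  have "has_torus_moments ?J (\<lambda>n m. \<tau> (op_powi A n o\<^sub>L op_powi A m))"
    unfolding has_torus_moments_def
  proof (intro conjI allI)
    show "finite_measure ?J" by (rule finite_measure.finite_measure_distr[OF \<mu>(2) dm])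
    fix n m
    have "(\<integral>p. fst p powi n * snd p powi m \<partial>?J) = (\<integral>s. s powi n * s powi m \<partial>?\<mu>)"
      by (subst integral_distr[OF dm trig2.P_measurable[OF trig2_mono]]) (simp add: d_def)
    also have "\<dots> = (\<integral>s. s powi (n + m) \<partial>?\<mu>)"
    proof (rule Bochner_Integration.integral_cong[OF refl])
      fix s assume "s \<in> space ?\<mu>"
      then have "s \<noteq> 0" by (auto simp: sp)
      then show "s powi n * s powi m = s powi (n + m)" by (simp add: power_int_add)
    qed
    finally show "(\<integral>p. fst p powi n * snd p powi m \<partial>?J) = \<tau> (op_powi A n o\<^sub>L op_powi A m)"
      by (simp add: \<mu>(3) op_powi_add[OF Ao(1)])
  qed simp
  then have "\<tau> (op_powi A n o\<^sub>L x) = (\<integral>p. fst p powi n * h (snd p) \<partial>?J)"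
    by (rule trace_borel_calculus[OF A A x h])
  also have "\<dots> = (\<integral>s. s powi n * h s \<partial>?\<mu>)"
  proof (subst integral_distr[OF dm])
    have R: "sets (restrict_space borel torus) = sets (restrict_space (borel :: (complex \<times> complex) measure) torus)" ..
    have "(\<lambda>p. h (snd p)) \<in> borel_measurable (restrict_space borel torus)"
      using measurable_comp[OF measurable_torus_coordinates(2)[OF R] Linf_measurable[OF h]] by (simp add: comp_def)
    moreover have "(\<lambda>p. fst p powi n) \<in> borel_measurable (restrict_space borel torus)"
      using measurable_comp[OF measurable_torus_coordinates(1)[OF R] trig1.P_measurable[OF trig1_mono]] by (simp add: comp_def)
    ultimately show "(\<lambda>p. fst p powi n * h (snd p)) \<in> borel_measurable (restrict_space borel torus)"
      by (intro borel_measurable_times)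
  qed (simp add: d_def)
  finally show ?thesis .
qed

text \<open>The moments of \<open>K h\<close> are \<open>\<tau>(A\<^sup>n E(h(B))) = \<tau>(A\<^sup>n h(B))\<close>, because \<open>E\<close> is a bimodule map that
  preserves the trace; so they are integrals with respect to the joint distribution.\<close>

lemma transition_moments:
  assumes A: "unitary_in M A" and B: "unitary_in M B" and K: "is_transition_operator M \<tau> B A K" and h: "h \<in> Linf"
  shows "K h \<in> Linf"
    "(\<integral>s. s powi n * K h s \<partial>distribution \<tau> A) =
      (\<integral>p. fst p powi n * h (snd p) \<partial>joint_distribution (vec_state Lam) (left_mult M Lam A) (right_mult M Lam B))"
proof -
  obtain E where E: "is_cond_exp M \<tau> (vn_generated A) E"
    and Kh: "\<forall>h\<in>Linf. K h \<in> Linf \<and> (\<exists>x\<in>M. is_borel_calculus B h x \<and> is_borel_calculus A (K h) (E x))"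
    using K unfolding is_transition_operator_def by blast
  obtain x where x: "x \<in> M" "is_borel_calculus B h x" "is_borel_calculus A (K h) (E x)" using Kh h by blast
  show KL: "K h \<in> Linf" using Kh h by blast
  note g = vn_generated_powers[OF A]
  have Ex: "E x \<in> M" using E x(1) g(2) unfolding is_cond_exp_def by blast
  have id: "id_blinfun \<in> vn_generated A" using g(1)[of 0] by simp
  have bim: "E (op_powi A n o\<^sub>L x o\<^sub>L id_blinfun) = op_powi A n o\<^sub>L E x o\<^sub>L id_blinfun"
    using E x(1) g(1)[of n] id unfolding is_cond_exp_def by blast
  have Ax: "op_powi A n o\<^sub>L x \<in> M" by (rule M.mult_in[OF unitary_in_op(5)[OF A] x(1)])
  have "\<tau> (E (op_powi A n o\<^sub>L x)) = \<tau> (op_powi A n o\<^sub>L x)"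
    using E Ax unfolding is_cond_exp_def by blast
  then have "\<tau> (op_powi A n o\<^sub>L E x) = \<tau> (op_powi A n o\<^sub>L x)" using bim by simp
  moreover have "\<tau> (op_powi A n o\<^sub>L E x) = (\<integral>s. s powi n * K h s \<partial>distribution \<tau> A)"
    by (rule trace_own_calculus[OF A Ex x(3) KL])
  moreover have "\<tau> (op_powi A n o\<^sub>L x) = (\<integral>p. fst p powi n * h (snd p) \<partial>joint_distribution (vec_state Lam) (left_mult M Lam A) (right_mult M Lam B))"
    by (rule trace_borel_calculus[OF A B x(1,2) h joint_distribution_moments[OF A B]])
  ultimately show "(\<integral>s. s powi n * K h s \<partial>distribution \<tau> A) =
      (\<integral>p. fst p powi n * h (snd p) \<partial>joint_distribution (vec_state Lam) (left_mult M Lam A) (right_mult M Lam B))" by simp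
qed

end

text \<open>The joint moments of \<open>(L(U), R(VU))\<close> are the mixed moments \<open>\<tau>(U\<^sup>n (VU)\<^sup>m)\<close>, which freeness
  determines from the distributions of \<open>U\<close> and \<open>V\<close>; everything else is a function of them.\<close>

lemma transforms_determined:
  fixes M :: "('h::chilbert_space \<Rightarrow>\<^sub>L 'h) set" and Lam :: "('h \<Rightarrow>\<^sub>L 'h) \<Rightarrow> 'g::chilbert_space"
    and M' :: "('k::chilbert_space \<Rightarrow>\<^sub>L 'k) set" and Lam' :: "('k \<Rightarrow>\<^sub>L 'k) \<Rightarrow> 'f::chilbert_space"
  assumes g: "gns_space M \<tau> Lam" "unitary_in M U" "unitary_in M V" "freely_independent \<tau> [U, V]"
    and g': "gns_space M' \<tau>' Lam'" "unitary_in M' U'" "unitary_in M' V'" "freely_independent \<tau>' [U', V']"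
    and d: "distribution \<tau>' U' = distribution \<tau> U" "distribution \<tau>' V' = distribution \<tau> V"
  shows "same_transforms_and_transitions M \<tau> Lam U (V o\<^sub>L U) M' \<tau>' Lam' U' (V' o\<^sub>L U')"
proof -
  interpret a: gns_space M \<tau> Lam by fact
  interpret b: gns_space M' \<tau>' Lam' by fact
  have mom: "\<tau> (op_powi U n) = \<tau>' (op_powi U' n)" "\<tau> (op_powi V n) = \<tau>' (op_powi V' n)" for n
    using a.distribution_moments[OF g(2)] b.distribution_moments[OF g'(2)]
      a.distribution_moments[OF g(3)] b.distribution_moments[OF g'(3)] d
    by (simp_all add: has_circle_moments_def)
  interpret two_free_pairs M \<tau> M' \<tau>' U V U' V'
    by unfold_locales (use g g' mom in auto)
  note VU = a.unitary_in_mult[OF g(3,2)] note VU' = b.unitary_in_mult[OF g'(3,2)]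
  have momVU: "\<tau> (op_powi (V o\<^sub>L U) m) = \<tau>' (op_powi (V' o\<^sub>L U') m)" for m
    using mixed_moments_agree[of 0 m] by simp
  have J: "joint_distribution (vec_state Lam) (left_mult M Lam U) (right_mult M Lam (V o\<^sub>L U)) =
       joint_distribution (vec_state Lam') (left_mult M' Lam' U') (right_mult M' Lam' (V' o\<^sub>L U'))"
    unfolding joint_distribution_def a.vec_state_moments[OF g(2) VU] b.vec_state_moments[OF g'(2) VU'] mixed_moments_agree ..
  have psiU: "psi \<tau> U z = psi \<tau>' U' z" if "norm z \<noteq> 1" for z
    by (rule psi_cong[OF a.M.op_state_axioms a.unitary_in_op(1,5)[OF g(2)] b.M.op_state_axioms b.unitary_in_op(1,5)[OF g'(2)] mom(1) that])
  have psiVU: "psi \<tau> (V o\<^sub>L U) z = psi \<tau>' (V' o\<^sub>L U') z" if "norm z \<noteq> 1" for z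
    by (rule psi_cong[OF a.M.op_state_axioms a.unitary_in_op(1,5)[OF VU] b.M.op_state_axioms b.unitary_in_op(1,5)[OF VU'] momVU that])
  have psi2: "psi2 (vec_state Lam) (left_mult M Lam U) (right_mult M Lam (V o\<^sub>L U)) z w =
      psi2 (vec_state Lam') (left_mult M' Lam' U') (right_mult M' Lam' (V' o\<^sub>L U')) z w" for z w
    unfolding psi2_def J ..
  have K: "AE s in distribution \<tau> U. K h s = K' h s"
    if K: "is_transition_operator M \<tau> (V o\<^sub>L U) U K" and K': "is_transition_operator M' \<tau>' (V' o\<^sub>L U') U' K'" and h: "h \<in> Linf" for K K' h
  proof -
    have \<mu>: "sets (distribution \<tau> U) = sets (restrict_space borel circle)" "finite_measure (distribution \<tau> U)"
      using a.distribution_moments[OF g(2)] by (auto simp: has_circle_moments_def)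
    note t = a.transition_moments[OF g(2) VU K h] and t' = b.transition_moments[OF g'(2) VU' K' h]
    have i: "integrable (distribution \<tau> U) (\<lambda>s. s powi n * k s)" if kL: "k \<in> Linf" for k n
    proof -
      obtain C where "\<forall>s\<in>circle. norm (k s) \<le> C" using Linf_bounded[OF kL] by blast
      then have "(\<lambda>s. s powi n * k s) \<in> Linf"
        unfolding Linf_def bounded_iff
        using borel_measurable_times[OF trig1.P_measurable[OF trig1_mono] Linf_measurable[OF kL]]
        by (auto simp: norm_mult norm_power_int)
      then show ?thesis by (rule Linf_integrable[OF _ \<mu>])
    qed
    have "AE s in distribution \<tau> U. K h s - K' h s = 0"
    proof (rule zero_moments_AE[OF \<mu> Linf_diff[OF t(1) t'(1)]])
      fix n
      have "(\<integral>s. s powi n * (K h s - K' h s) \<partial>distribution \<tau> U)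
          = (\<integral>s. s powi n * K h s \<partial>distribution \<tau> U) - (\<integral>s. s powi n * K' h s \<partial>distribution \<tau> U)"
        using i[OF t(1)] i[OF t'(1)] by (simp add: right_diff_distrib)
      then show "(\<integral>s. s powi n * (K h s - K' h s) \<partial>distribution \<tau> U) = 0"
        using t(2)[of n] t'(2)[of n] unfolding d(1) J by simp
    qed
    then show ?thesis by simp
  qed
  show ?thesis
    unfolding same_transforms_and_transitions_def
  proof (intro conjI allI impI ballI)
    fix z w :: complex assume z: "norm z \<noteq> 1" and w: "norm w \<noteq> 1"
    show "psi \<tau> U z = psi \<tau>' U' z" by (rule psiU[OF z])
    show "psi \<tau> (V o\<^sub>L U) w = psi \<tau>' (V' o\<^sub>L U') w" by (rule psiVU[OF w])
    show "psi2 (vec_state Lam) (left_mult M Lam U) (right_mult M Lam (V o\<^sub>L U)) z w =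
      psi2 (vec_state Lam') (left_mult M' Lam' U') (right_mult M' Lam' (V' o\<^sub>L U')) z w" by (rule psi2)
    show "g_fun (vec_state Lam) (left_mult M Lam U) (right_mult M Lam (V o\<^sub>L U)) z w =
      g_fun (vec_state Lam') (left_mult M' Lam' U') (right_mult M' Lam' (V' o\<^sub>L U')) z w"
      unfolding g_fun_def psi2 a.vec_psi(1)[OF g(2) z] a.vec_psi(2)[OF VU w] b.vec_psi(1)[OF g'(2) z] b.vec_psi(2)[OF VU' w]
        psiU[OF z] psiVU[OF w] ..
  qed (auto simp: J K)
qed

section \<open>The formula for \<open>H\<close> and the determination statements\<close>

text \<open>For small arguments the transform \<open>H\<close> of the pair is the trace of a product of resolvents of \<open>U\<close>
  and \<open>VU\<close>, since \<open>L(U)\<close> and \<open>R(VU)\<close> act on the vector \<open>Lam 1\<close> by multiplication with \<open>U\<close> and \<open>VU\<close>.\<close>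

lemma (in gns_space) H_formula:
  assumes U: "unitary_in M U" and V: "unitary_in M V" and free: "freely_independent \<tau> [U, V]"
    and U0: "\<tau> U \<noteq> 0" and V0: "\<tau> V \<noteq> 0"
  shows "\<forall>\<^sub>F (z, w) in nhds (0, 0).
           z \<noteq> psi_inv \<tau> U (psi \<tau> (V o\<^sub>L U) w) \<longrightarrow>
           H_fun (vec_state Lam) (left_mult M Lam U) (right_mult M Lam (V o\<^sub>L U)) z w =
             1 + (z * psi \<tau> U z - psi_inv \<tau> U (psi \<tau> (V o\<^sub>L U) w) * psi \<tau> (V o\<^sub>L U) w) /
                 (z - psi_inv \<tau> U (psi \<tau> (V o\<^sub>L U) w))"
proof -
  have z1: "\<forall>\<^sub>F z in nhds (0::complex). norm z < 1"
    using eventually_nhds_in_open[OF open_ball, of 0 "0::complex" 1] by (auto elim!: eventually_mono)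
  note VU = unitary_in_mult[OF V U]
  show ?thesis
    unfolding nhds_prod
    using eventually_prodI[OF z1 resolvent_trace_formula[OF U V free U0 V0]]
    by eventually_elim (auto simp: H_fun_resolvents[OF U VU])
qed

theorem theorem5p1:
  fixes M :: "('h::chilbert_space \<Rightarrow>\<^sub>L 'h) set"
    and \<tau> :: "('h \<Rightarrow>\<^sub>L 'h) \<Rightarrow> complex"
    and Lam :: "('h \<Rightarrow>\<^sub>L 'h) \<Rightarrow> 'g::chilbert_space"
    and M' :: "('k::chilbert_space \<Rightarrow>\<^sub>L 'k) set"
    and \<tau>' :: "('k \<Rightarrow>\<^sub>L 'k) \<Rightarrow> complex"
    and Lam' :: "('k \<Rightarrow>\<^sub>L 'k) \<Rightarrow> 'f::chilbert_space"
    and T :: "'t::linorder set"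
  assumes "gns_space M \<tau> Lam"
  shows
    "(\<forall>U V. unitary_in M U \<and> unitary_in M V \<and> freely_independent \<tau> [U, V] \<and> \<tau> U \<noteq> 0 \<and> \<tau> V \<noteq> 0 \<longrightarrow>
        (\<forall>\<^sub>F (z, w) in nhds (0, 0).
           z \<noteq> psi_inv \<tau> U (psi \<tau> (V o\<^sub>L U) w) \<longrightarrow>
           H_fun (vec_state Lam) (left_mult M Lam U) (right_mult M Lam (V o\<^sub>L U)) z w =
             1 + (z * psi \<tau> U z - psi_inv \<tau> U (psi \<tau> (V o\<^sub>L U) w) * psi \<tau> (V o\<^sub>L U) w) /
                 (z - psi_inv \<tau> U (psi \<tau> (V o\<^sub>L U) w))) \<and>
        (\<forall>\<^sub>F z in at 0. S_transform \<tau> (V o\<^sub>L U) z = S_transform \<tau> V z * S_transform \<tau> U z) \<and>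
        (\<forall>U' V'. gns_space M' \<tau>' Lam' \<and> unitary_in M' U' \<and> unitary_in M' V' \<and>
           freely_independent \<tau>' [U', V'] \<and>
           distribution \<tau>' U' = distribution \<tau> U \<and> distribution \<tau>' V' = distribution \<tau> V \<longrightarrow>
           same_transforms_and_transitions M \<tau> Lam U (V o\<^sub>L U) M' \<tau>' Lam' U' (V' o\<^sub>L U')))
     \<and>
     (\<forall>X l r V. unitary_process M T X \<and> left_mult_free_increments \<tau> T X \<and>
        l \<in> T \<and> r \<in> T \<and> l < r \<and> V = X r o\<^sub>L op_inv (X l) \<and> \<tau> (X l) \<noteq> 0 \<and> \<tau> V \<noteq> 0 \<longrightarrow>
        (\<forall>\<^sub>F (z, w) in nhds (0, 0).
           z \<noteq> psi_inv \<tau> (X l) (psi \<tau> (V o\<^sub>L X l) w) \<longrightarrow>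
           H_fun (vec_state Lam) (left_mult M Lam (X l)) (right_mult M Lam (V o\<^sub>L X l)) z w =
             1 + (z * psi \<tau> (X l) z - psi_inv \<tau> (X l) (psi \<tau> (V o\<^sub>L X l) w) * psi \<tau> (V o\<^sub>L X l) w) /
                 (z - psi_inv \<tau> (X l) (psi \<tau> (V o\<^sub>L X l) w))) \<and>
        (\<forall>\<^sub>F (z, w) in nhds (0, 0).
           z \<noteq> psi_inv \<tau> (X l) (psi \<tau> (X r) w) \<longrightarrow>
           H_fun (vec_state Lam) (left_mult M Lam (X l)) (right_mult M Lam (X r)) z w =
             1 + (z * psi \<tau> (X l) z - psi_inv \<tau> (X l) (psi \<tau> (X r) w) * psi \<tau> (X r) w) /
                 (z - psi_inv \<tau> (X l) (psi \<tau> (X r) w))) \<and>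
        (\<forall>U' V'. gns_space M' \<tau>' Lam' \<and> unitary_in M' U' \<and> unitary_in M' V' \<and>
           freely_independent \<tau>' [U', V'] \<and>
           distribution \<tau>' U' = distribution \<tau> (X l) \<and> distribution \<tau>' V' = distribution \<tau> V \<longrightarrow>
           same_transforms_and_transitions M \<tau> Lam (X l) (V o\<^sub>L X l) M' \<tau>' Lam' U' (V' o\<^sub>L U')))"
proof -
  interpret gns_space M \<tau> Lam by fact
  have main: "(\<forall>\<^sub>F (z, w) in nhds (0, 0).
           z \<noteq> psi_inv \<tau> U (psi \<tau> (V o\<^sub>L U) w) \<longrightarrow>
           H_fun (vec_state Lam) (left_mult M Lam U) (right_mult M Lam (V o\<^sub>L U)) z w =
             1 + (z * psi \<tau> U z - psi_inv \<tau> U (psi \<tau> (V o\<^sub>L U) w) * psi \<tau> (V o\<^sub>L U) w) /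
                 (z - psi_inv \<tau> U (psi \<tau> (V o\<^sub>L U) w))) \<and>
        (\<forall>\<^sub>F z in at 0. S_transform \<tau> (V o\<^sub>L U) z = S_transform \<tau> V z * S_transform \<tau> U z) \<and>
        (\<forall>U' V'. gns_space M' \<tau>' Lam' \<and> unitary_in M' U' \<and> unitary_in M' V' \<and>
           freely_independent \<tau>' [U', V'] \<and>
           distribution \<tau>' U' = distribution \<tau> U \<and> distribution \<tau>' V' = distribution \<tau> V \<longrightarrow>
           same_transforms_and_transitions M \<tau> Lam U (V o\<^sub>L U) M' \<tau>' Lam' U' (V' o\<^sub>L U'))"
    if "unitary_in M U" "unitary_in M V" "freely_independent \<tau> [U, V]" "\<tau> U \<noteq> 0" "\<tau> V \<noteq> 0" for U V
  proof (intro conjI allI impI)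
    fix U' V'
    assume "gns_space M' \<tau>' Lam' \<and> unitary_in M' U' \<and> unitary_in M' V' \<and> freely_independent \<tau>' [U', V'] \<and>
      distribution \<tau>' U' = distribution \<tau> U \<and> distribution \<tau>' V' = distribution \<tau> V"
    then show "same_transforms_and_transitions M \<tau> Lam U (V o\<^sub>L U) M' \<tau>' Lam' U' (V' o\<^sub>L U')"
      by (intro transforms_determined assms that) auto
  qed (fact H_formula[OF that] S_transform_mult[OF that])+
  have process: "(\<forall>\<^sub>F (z, w) in nhds (0, 0).
           z \<noteq> psi_inv \<tau> (X l) (psi \<tau> (V o\<^sub>L X l) w) \<longrightarrow>
           H_fun (vec_state Lam) (left_mult M Lam (X l)) (right_mult M Lam (V o\<^sub>L X l)) z w =
             1 + (z * psi \<tau> (X l) z - psi_inv \<tau> (X l) (psi \<tau> (V o\<^sub>L X l) w) * psi \<tau> (V o\<^sub>L X l) w) /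
                 (z - psi_inv \<tau> (X l) (psi \<tau> (V o\<^sub>L X l) w))) \<and>
        (\<forall>\<^sub>F (z, w) in nhds (0, 0).
           z \<noteq> psi_inv \<tau> (X l) (psi \<tau> (X r) w) \<longrightarrow>
           H_fun (vec_state Lam) (left_mult M Lam (X l)) (right_mult M Lam (X r)) z w =
             1 + (z * psi \<tau> (X l) z - psi_inv \<tau> (X l) (psi \<tau> (X r) w) * psi \<tau> (X r) w) /
                 (z - psi_inv \<tau> (X l) (psi \<tau> (X r) w))) \<and>
        (\<forall>U' V'. gns_space M' \<tau>' Lam' \<and> unitary_in M' U' \<and> unitary_in M' V' \<and>
           freely_independent \<tau>' [U', V'] \<and>
           distribution \<tau>' U' = distribution \<tau> (X l) \<and> distribution \<tau>' V' = distribution \<tau> V \<longrightarrow>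
           same_transforms_and_transitions M \<tau> Lam (X l) (V o\<^sub>L X l) M' \<tau>' Lam' U' (V' o\<^sub>L U'))"
    if a: "unitary_process M T X \<and> left_mult_free_increments \<tau> T X \<and>
        l \<in> T \<and> r \<in> T \<and> l < r \<and> V = X r o\<^sub>L op_inv (X l) \<and> \<tau> (X l) \<noteq> 0 \<and> \<tau> V \<noteq> 0" for X l r V
  proof -
    have Xl: "unitary_in M (X l)" and Xr: "unitary_in M (X r)"
      using a by (auto simp: unitary_process_def)
    have V: "unitary_in M V" using a unitary_in_mult[OF Xr unitary_in_inv[OF Xl]] by simp
    have "freely_independent \<tau> (increments X [l, r])"
      using a unfolding left_mult_free_increments_def by (elim conjE allE[of _ "[l, r]"]) simp
    moreover have "increments X [l, r] = [X l, V]"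
      using a by (simp add: increments_def)
    ultimately have free: "freely_independent \<tau> [X l, V]" by simp
    \<comment> \<open>A process is covered by the case \<open>U = X l\<close>, \<open>V = X r (X l)\<^sup>-\<^sup>1\<close> with the time list \<open>[l, r]\<close>.\<close>
    have VX: "V o\<^sub>L X l = X r"
      using a unitary_op_inv(2)[OF unitary_in_op(1)[OF Xl]] by (simp add: compose_assoc)
    have "\<tau> (X l) \<noteq> 0" "\<tau> V \<noteq> 0" using a by auto
    note m = main[OF Xl V free this]
    show ?thesis
      by (intro conjI conjunct1[OF m] conjunct1[OF m, unfolded VX] conjunct2[OF conjunct2[OF m]])
  qed
  show ?thesis
  proof (rule conjI)
  qed ((intro allI impI, (rule main process; (elim conjE; assumption)?)))+
qed

end
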